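(* Let $\varepsilon_0>0$ and let $\beta,\delta\colon\Omega\to(0,1)$ be measurable maps such that $$\alpha:=\operatorname{ess\,sup}_{\omega}\beta (\omega)+\varepsilon_0 <\tfrac 1 2 \quad \text{and} \quad \operatorname{ess\,inf}_{\omega}\beta(\omega)-\varepsilon_0>0.$$ For $\omega\in\Omega$ and $\varepsilon\in(-\varepsilon_0,\varepsilon_0)$ let $T_{\omega,\varepsilon}$ be the LSV map with parameter $\beta(\omega)+\varepsilon\delta(\omega)$, and let $(\mu_{\omega,\varepsilon})_{\omega\in\Omega}$ be the random a.c.i.m. of the cocycle $(T_{\omega,\varepsilon})_{\omega\in\Omega}$. Let $F\colon\Omega\times[0,1]\to\mathbb R$ be measurable with $F_\omega:=F(\omega,\cdot)\in C^1[0,1]$ for $\omega\in\Omega$ and $\operatorname{ess\,sup}_{\omega\in\Omega}\|F_\omega\|_{C^1}<+\infty$. Put $$f_{\omega,\varepsilon}:=F_\omega-\int_0^1F_\omega\,d\mu_{\omega,\varepsilon}$$ and $$\Sigma_\varepsilon^2:=\int_\Omega \int_0^1f_{\omega, \varepsilon}^2 \, d\mu_{\omega, \varepsilon} \, d\mathbb P(\omega)+2\sum_{n=1}^\infty \int_\Omega \int_0^1 f_{\omega, \varepsilon}\cdot (f_{\sigma^n \omega, \varepsilon}\circ T_{\omega, \varepsilon}^n)\, d\mu_{\omega, \varepsilon}\, d\mathbb P(\omega).$$ Then the map $\varepsilon\mapsto\Sigma_\varepsilon^2$ is continuous at $0$.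
   Context: $m$ is Lebesgue measure on $[0,1]$. For $\kappa\in(0,1)$ the Liverani--Saussol--Vaienti (LSV) map with parameter $\kappa$ is $T_\kappa\colon[0,1]\to[0,1]$, $T_\kappa(x)=x(1+2^\kappa x^\kappa)$ for $0\le x<\frac12$ and $T_\kappa(x)=2x-1$ for $\frac12\le x\le 1$. $(\Omega,\mathcal F,\mathbb P)$ is a probability space with an invertible $\mathbb P$-preserving transformation $\sigma\colon\Omega\to\Omega$, and $\mathbb P$ is ergodic. $T_{\omega,\varepsilon}^n:=T_{\sigma^{n-1}\omega,\varepsilon}\circ\dots\circ T_{\sigma\omega,\varepsilon}\circ T_{\omega,\varepsilon}$. It is known that for each $\varepsilon$ the cocycle $(T_{\omega,\varepsilon})_{\omega\in\Omega}$ has a unique random absolutely continuous invariant measure (random a.c.i.m.), i.e. a measurable family $(\mu_{\omega,\varepsilon})_{\omega\in\Omega}$ of probability measures on $[0,1]$ absolutely continuous with respect to $m$ such that the pushforward of $\mu_{\omega,\varepsilon}$ under $T_{\omega,\varepsilon}$ is $\mu_{\sigma\omega,\varepsilon}$ for $\mathbb P$-a.e. $\omega$. It is also known that $\Sigma_\varepsilon^2$ is finite for every $\varepsilon\in(-\varepsilon_0,\varepsilon_0)$. *)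

theory Defs
  imports "HOL-Probability.Probability"
begin

abbreviation unit_borel :: "real measure" where
  "unit_borel \<equiv> restrict_space borel {0..1}"

definition lsv :: "real \<Rightarrow> real \<Rightarrow> real" where
  "lsv \<kappa> x = (if x < 1/2 then x * (1 + 2 powr \<kappa> * x powr \<kappa>) else 2 * x - 1)"

text \<open>The library defines the essential supremum only; this is its mirror image.\<close>

definition essinf :: "'a measure \<Rightarrow> ('a \<Rightarrow> ereal) \<Rightarrow> ereal" where
  "essinf M f = (if f \<in> borel_measurable M then Liminf (ae_filter M) f else bot)"

locale ergodic_automorphism = prob_space M for M :: "'a measure" +
  fixes \<sigma> :: "'a \<Rightarrow> 'a"
  assumes bij: "bij_betw \<sigma> (space M) (space M)"
    and measurable: "\<sigma> \<in> M \<rightarrow>\<^sub>M M"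
    and measurable_inverse: "inv_into (space M) \<sigma> \<in> M \<rightarrow>\<^sub>M M"
    and preserving: "distr M M \<sigma> = M"
    and ergodic: "\<And>A. A \<in> sets M \<Longrightarrow> \<sigma> -` A \<inter> space M = A \<Longrightarrow> prob A = 0 \<or> prob A = 1"

primrec cocycle :: "('a \<Rightarrow> 'a) \<Rightarrow> ('a \<Rightarrow> real \<Rightarrow> real) \<Rightarrow> nat \<Rightarrow> 'a \<Rightarrow> real \<Rightarrow> real" where
  "cocycle \<sigma> T 0 \<omega> = id"
| "cocycle \<sigma> T (Suc n) \<omega> = T ((\<sigma> ^^ n) \<omega>) \<circ> cocycle \<sigma> T n \<omega>"

definition random_acim ::
    "'a measure \<Rightarrow> ('a \<Rightarrow> 'a) \<Rightarrow> ('a \<Rightarrow> real \<Rightarrow> real) \<Rightarrow> ('a \<Rightarrow> real measure) \<Rightarrow> bool" where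
  "random_acim M \<sigma> T \<mu> \<longleftrightarrow>
     \<mu> \<in> M \<rightarrow>\<^sub>M prob_algebra unit_borel \<and>
     (\<forall>\<omega>\<in>space M. absolutely_continuous (restrict_space lborel {0..1}) (\<mu> \<omega>)) \<and>
     (AE \<omega> in M. distr (\<mu> \<omega>) unit_borel (T \<omega>) = \<mu> (\<sigma> \<omega>))"

text \<open>\<open>C\<^sup>1[0,1]\<close> is understood with one-sided derivatives at the endpoints, so values outside the
  unit interval play no role.\<close>

definition C1_unit :: "(real \<Rightarrow> real) \<Rightarrow> bool" where
  "C1_unit g \<longleftrightarrow> (\<exists>g'. (\<forall>x\<in>{0..1}. (g has_real_derivative g' x) (at x within {0..1})) \<and>
                       continuous_on {0..1} g')"

definition C1_norm :: "(real \<Rightarrow> real) \<Rightarrow> real" where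
  "C1_norm g = (SUP x\<in>{0..1}. \<bar>g x\<bar>) +
               (SUP x\<in>{0..1}. \<bar>vector_derivative g (at x within {0..1})\<bar>)"

text \<open>The centred observable lives on the unit interval and is extended by zero. For the null set of
  \<open>\<omega>\<close> whose parameter lies outside \<open>(0,1)\<close> the map \<^term>\<open>lsv\<close> may leave the unit interval; without
  the extension, arbitrary values of \<open>F\<close> there could make an integral over \<open>\<Omega>\<close> have a non-measurable
  integrand, and the Bochner integral would then be zero by convention.\<close>

definition centred :: "('a \<Rightarrow> real \<Rightarrow> real) \<Rightarrow> ('a \<Rightarrow> real measure) \<Rightarrow> 'a \<Rightarrow> real \<Rightarrow> real" where
  "centred F \<mu> \<omega> x = (if x \<in> {0..1} then F \<omega> x - (\<integral>y. F \<omega> y \<partial>\<mu> \<omega>) else 0)"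

definition asymptotic_variance ::
    "'a measure \<Rightarrow> ('a \<Rightarrow> 'a) \<Rightarrow> ('a \<Rightarrow> real \<Rightarrow> real) \<Rightarrow> ('a \<Rightarrow> real measure) \<Rightarrow>
     ('a \<Rightarrow> real \<Rightarrow> real) \<Rightarrow> real" where
  "asymptotic_variance M \<sigma> T \<mu> F =
     (\<integral>\<omega>. (\<integral>x. (centred F \<mu> \<omega> x)\<^sup>2 \<partial>\<mu> \<omega>) \<partial>M) +
     2 * (\<Sum>n. \<integral>\<omega>. (\<integral>x. centred F \<mu> \<omega> x *
            centred F \<mu> ((\<sigma> ^^ Suc n) \<omega>) (cocycle \<sigma> T (Suc n) \<omega> x) \<partial>\<mu> \<omega>) \<partial>M)"

end

theory Submission
  imports Defs
begin

text \<open>The transfer operators of LSV maps preserve decreasing densities, and those bounded by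
  \<open>4 * x powr - \<alpha>\<close> times their mass. A Lyapunov function shows that a decreasing density whose mass
  \<open>m\<close> does not sit too close to \<open>0\<close> is pushed above a constant multiple of \<open>m\<close> on the whole interval within
  about \<open>m powr (- \<alpha> / (1 - \<alpha>))\<close> steps. Two densities of equal mass can therefore be coupled by
  subtracting the same constant from both, repeatedly, since the remainders stay decreasing; for
  \<open>\<alpha> < 1/2\<close> this gives a summable rate that is uniform over all parameter sequences.

  Consequently the correlations decay summably and uniformly in \<open>\<epsilon>\<close>, and each of them is uniformly
  approximated by the expected covariance, under Lebesgue measure on the fibre, of the observable at
  the times \<open>N\<close> and \<open>N + n\<close>. That covariance is continuous in \<open>\<epsilon>\<close> by dominated convergence, because
  almost no orbit hits the discontinuity \<open>1/2\<close>. Continuity of the series follows by dominated summation.\<close>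

text \<open>The exponent in the coupling time comes from the cutoff. Remainders of the coupling keep
  only the bound \<open>4 * x powr - \<alpha>\<close> of the full densities, so the smaller their
  mass \<open>m\<close>, the closer to \<open>0\<close> it may hide. Under that bound the interval
  up to \<open>\<xi>\<close> holds at most \<open>8 * \<xi> powr (1 - \<alpha>)\<close>, a quarter
  of \<open>m\<close> when \<open>\<xi>\<close> is of order
  \<open>m powr (1 / (1 - \<alpha>))\<close>. The weight cut off at \<open>\<xi>\<close> integrates
  to at most \<open>\<xi> powr - \<alpha> * m\<close> and loses a fixed fraction of \<open>m\<close>
  per step while the density stays low, so about \<open>\<xi> powr - \<alpha>\<close> steps suffice.
  Multiplied by \<open>m = \<theta> ^ k\<close> these times form a geometric series, because
  \<open>\<alpha> / (1 - \<alpha>) < 1\<close>. On the random side no rate is available fibre by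
  fibre. It is recovered for integrals over the base, by stationarity; therefore means under the
  invariant measures are compared with Lebesgue means only after multiplication by a bounded weight
  and integration over the base.\<close>

section \<open>The transfer operator on decreasing densities\<close>

text \<open>The absolute value makes the branch differentiable on both sides of \<open>0\<close>, as the substitution
  theorem for integrals requires.\<close>

definition left_branch :: "real \<Rightarrow> real \<Rightarrow> real" where
  "left_branch \<kappa> x = x * (1 + (2 * \<bar>x\<bar>) powr \<kappa>)"

definition left_slope :: "real \<Rightarrow> real \<Rightarrow> real" where
  "left_slope \<kappa> x = 1 + (1 + \<kappa>) * (2 * \<bar>x\<bar>) powr \<kappa>"

definition left_inverse :: "real \<Rightarrow> real \<Rightarrow> real" where
  "left_inverse \<kappa> = inv_into {0..1/2} (left_branch \<kappa>)"

lemma lsv_eq_left_branch: "0 \<le> x \<Longrightarrow> x < 1/2 \<Longrightarrow> lsv \<kappa> x = left_branch \<kappa> x"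
  by (simp add: lsv_def left_branch_def powr_mult)

lemma lsv_measurable [measurable (raw)]:
  assumes [measurable]: "f \<in> borel_measurable N" "g \<in> borel_measurable N"
  shows "(\<lambda>x. lsv (f x) (g x)) \<in> borel_measurable N"
  unfolding lsv_def by measurable

lemma left_branch_deriv:
  assumes "0 < \<kappa>" "0 \<le> x"
  shows "(left_branch \<kappa> has_real_derivative left_slope \<kappa> x) (at x)"
proof (cases "x = 0")
  \<comment> \<open>\<open>powr\<close> has no usable derivative rule at \<open>0\<close>, so the
    difference quotient is computed directly; the factor \<open>x\<close> in front cancels.\<close>
  case True
  have "((\<lambda>h. 1 + (2 * \<bar>h\<bar>) powr \<kappa>) \<longlongrightarrow> 1 + (2 * \<bar>0\<bar>) powr \<kappa>) (at (0::real))"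
    using assms by (intro tendsto_intros) auto
  moreover have "\<forall>\<^sub>F h in at 0. 1 + (2 * \<bar>h\<bar>) powr \<kappa> = left_branch \<kappa> h / h"
    by (auto simp: left_branch_def eventually_at_filter)
  ultimately have "((\<lambda>h. left_branch \<kappa> h / h) \<longlongrightarrow> 1) (at 0)"
    using assms by (auto dest: Lim_transform_eventually)
  then show ?thesis
    using True assms by (simp add: DERIV_def left_slope_def left_branch_def)
next
  case False
  then have "x > 0" using assms by simp
  have ev: "\<forall>\<^sub>F y in nhds x. left_branch \<kappa> y = y * (1 + (2 * y) powr \<kappa>)"
    using eventually_nhds_in_open[of "{0<..}" x] \<open>x > 0\<close>
    by (auto elim!: eventually_mono simp: left_branch_def)
  have "((\<lambda>y. y * (1 + (2 * y) powr \<kappa>)) has_real_derivative left_slope \<kappa> x) (at x)"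
    using \<open>x > 0\<close>
    by (auto intro!: derivative_eq_intros simp: left_slope_def field_simps powr_diff)
  then show ?thesis
    using DERIV_cong_ev[OF refl ev refl] by blast
qed

lemma left_slope_bounds:
  assumes "\<kappa> \<in> {0<..1/2}" "x \<in> {0..1/2}"
  shows "1 \<le> left_slope \<kappa> x" "left_slope \<kappa> x \<le> 3"
proof -
  have "(2 * x) powr \<kappa> \<le> 1"
    using assms powr_mono2[of \<kappa> "2 * x" 1] by auto
  then have "(1 + \<kappa>) * (2 * x) powr \<kappa> \<le> 2 * 1"
    using assms by (intro mult_mono) auto
  then show "left_slope \<kappa> x \<le> 3" using assms by (simp add: left_slope_def)
  show "1 \<le> left_slope \<kappa> x" using assms by (simp add: left_slope_def)
qed

lemma left_slope_mono:
  assumes "0 < \<kappa>" "0 \<le> x" "x \<le> y"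
  shows "left_slope \<kappa> x \<le> left_slope \<kappa> y"
  using assms by (auto simp: left_slope_def intro!: mult_left_mono powr_mono2)

lemma left_branch_strict_mono:
  assumes "0 < \<kappa>" "0 \<le> x" "x < y"
  shows "left_branch \<kappa> x < left_branch \<kappa> y"
proof -
  have "x * (1 + (2 * x) powr \<kappa>) \<le> x * (1 + (2 * y) powr \<kappa>)"
    using assms by (intro mult_left_mono add_left_mono powr_mono2) auto
  also have "\<dots> < y * (1 + (2 * y) powr \<kappa>)"
    using assms by (intro mult_strict_right_mono) (auto simp: add_pos_nonneg)
  finally show ?thesis using assms by (simp add: left_branch_def)
qed

lemma left_branch_ends [simp]: "left_branch \<kappa> 0 = 0" "left_branch \<kappa> (1/2) = 1"
  by (simp_all add: left_branch_def)

lemma left_branch_inj: "0 < \<kappa> \<Longrightarrow> inj_on (left_branch \<kappa>) {0..1/2}"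
  by (intro linorder_inj_onI) (auto dest: left_branch_strict_mono)

lemma left_branch_surj:
  assumes "0 < \<kappa>" "z \<in> {0..1}"
  shows "z \<in> left_branch \<kappa> ` {0..1/2}"
proof -
  have "continuous_on {0..1/2} (left_branch \<kappa>)"
    using left_branch_deriv[OF assms(1)]
    by (intro continuous_at_imp_continuous_on ballI) (meson DERIV_isCont atLeastAtMost_iff)
  then show ?thesis
    using IVT'[of "left_branch \<kappa>" 0 z "1/2"] assms by auto
qed

lemma left_inverse:
  assumes "0 < \<kappa>" "z \<in> {0..1}"
  shows "left_inverse \<kappa> z \<in> {0..1/2}" "left_branch \<kappa> (left_inverse \<kappa> z) = z"
  using inv_into_into[OF left_branch_surj[OF assms]] f_inv_into_f[OF left_branch_surj[OF assms]]
  by (auto simp: left_inverse_def)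

lemma left_inverse_left_branch:
  "0 < \<kappa> \<Longrightarrow> x \<in> {0..1/2} \<Longrightarrow> left_inverse \<kappa> (left_branch \<kappa> x) = x"
  unfolding left_inverse_def by (intro inv_into_f_f left_branch_inj)

lemma left_inverse_mono:
  assumes "0 < \<kappa>" "0 \<le> x" "x \<le> y" "y \<le> 1"
  shows "left_inverse \<kappa> x \<le> left_inverse \<kappa> y"
  using assms left_inverse[of \<kappa> x] left_inverse[of \<kappa> y]
    left_branch_strict_mono[of \<kappa> "left_inverse \<kappa> y" "left_inverse \<kappa> x"] by force

lemma left_inverse_pos:
  assumes "0 < \<kappa>" "z \<in> {0<..1}"
  shows "0 < left_inverse \<kappa> z"
  using left_inverse[of \<kappa> z] assms by (cases "left_inverse \<kappa> z = 0") auto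

lemma left_inverse_1 [simp]: "0 < \<kappa> \<Longrightarrow> left_inverse \<kappa> 1 = 1/2"
  using left_inverse_left_branch[of \<kappa> "1/2"] by simp

lemma lsv_range:
  assumes "0 < \<kappa>" "x \<in> {0..1}"
  shows "lsv \<kappa> x \<in> {0..1}"
proof (cases "x < 1/2")
  case True
  then have "left_branch \<kappa> x < left_branch \<kappa> (1/2)"
    using assms by (intro left_branch_strict_mono) auto
  then show ?thesis
    using True assms by (auto simp: lsv_eq_left_branch left_branch_def)
qed (use assms in \<open>auto simp: lsv_def\<close>)

text \<open>The point \<open>0\<close> is excluded because the densities may be unbounded there.\<close>

definition decr_density :: "(real \<Rightarrow> real) \<Rightarrow> bool" where
  "decr_density g \<longleftrightarrow>
     (\<forall>x. 0 \<le> g x) \<and> (\<forall>x. x \<notin> {0<..1} \<longrightarrow> g x = 0) \<and> antimono_on {0<..1} g"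

lemma decr_densityD:
  assumes "decr_density g"
  shows "0 \<le> g x" "x \<notin> {0<..1} \<Longrightarrow> g x = 0" "0 < x \<Longrightarrow> x \<le> y \<Longrightarrow> y \<le> 1 \<Longrightarrow> g y \<le> g x"
  using assms by (auto simp: decr_density_def monotone_on_def)

lemma decr_densityI:
  assumes "\<And>x. x \<in> {0<..1} \<Longrightarrow> 0 \<le> g x" "\<And>x. x \<notin> {0<..1} \<Longrightarrow> g x = 0"
    "\<And>x y. 0 < x \<Longrightarrow> x \<le> y \<Longrightarrow> y \<le> 1 \<Longrightarrow> g y \<le> g x"
  shows "decr_density g"
  unfolding decr_density_def monotone_on_def
  by (metis assms greaterThanAtMost_iff order_refl)

lemma decr_density_measurable:
  assumes "decr_density g"
  shows "g \<in> borel_measurable borel"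
proof -
  have "(\<lambda>x. - g x) \<in> borel_measurable (restrict_space borel {0<..1})"
    using assms by (intro borel_measurable_mono_on_fnc) (auto simp: decr_density_def monotone_on_def)
  then have "(\<lambda>x. indicator {0<..1} x *\<^sub>R (- g x)) \<in> borel_measurable borel"
    by (subst (asm) borel_measurable_restrict_space_iff) auto
  then have "(\<lambda>x. - (indicator {0<..1} x *\<^sub>R (- g x))) \<in> borel_measurable borel"
    by simp
  also have "(\<lambda>x. - (indicator {0<..1} x *\<^sub>R (- g x))) = g"
    using decr_densityD(2)[OF assms] by (auto simp: fun_eq_iff indicator_def)
  finally show ?thesis .
qed

section \<open>The transfer operator of a single map\<close>

definition transfer :: "real \<Rightarrow> (real \<Rightarrow> real) \<Rightarrow> real \<Rightarrow> real" where
  "transfer \<kappa> g x = (if x \<in> {0<..1}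
     then g (left_inverse \<kappa> x) / left_slope \<kappa> (left_inverse \<kappa> x) + g ((x + 1) / 2) / 2 else 0)"

text \<open>The inverse branch increases, so \<open>g\<close> composed with it decreases; the branch
  is convex, so the slope in the denominator increases.\<close>

lemma transfer_left_decreasing:
  assumes \<kappa>: "\<kappa> \<in> {0<..1/2}" and g: "decr_density g"
  shows "decr_density (\<lambda>x. if x \<in> {0<..1}
     then g (left_inverse \<kappa> x) / left_slope \<kappa> (left_inverse \<kappa> x) else 0)"
proof (rule decr_densityI)
  fix x :: real assume "x \<in> {0<..1}"
  then show "0 \<le> (if x \<in> {0<..1} then g (left_inverse \<kappa> x) / left_slope \<kappa> (left_inverse \<kappa> x) else 0)"
    using left_slope_bounds(1)[OF \<kappa> left_inverse(1), of \<kappa> x] \<kappa> decr_densityD(1)[OF g]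
    by (auto intro!: divide_nonneg_nonneg)
next
  fix x y :: real assume xy: "0 < x" "x \<le> y" "y \<le> 1"
  have *: "left_inverse \<kappa> x \<in> {0..1/2}" "left_inverse \<kappa> y \<in> {0..1/2}" "0 < left_inverse \<kappa> x"
      "left_inverse \<kappa> x \<le> left_inverse \<kappa> y"
    using left_inverse(1)[of \<kappa>] left_inverse_pos[of \<kappa>] left_inverse_mono[of \<kappa>] \<kappa> xy by auto
  have "g (left_inverse \<kappa> y) / left_slope \<kappa> (left_inverse \<kappa> y)
      \<le> g (left_inverse \<kappa> x) / left_slope \<kappa> (left_inverse \<kappa> x)"
    using * \<kappa> left_slope_bounds(1)[OF \<kappa> *(1)]
    by (intro frac_le left_slope_mono decr_densityD[OF g]) auto
  then show "(if y \<in> {0<..1} then g (left_inverse \<kappa> y) / left_slope \<kappa> (left_inverse \<kappa> y) else 0)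
     \<le> (if x \<in> {0<..1} then g (left_inverse \<kappa> x) / left_slope \<kappa> (left_inverse \<kappa> x) else 0)"
    using xy by auto
qed auto

lemma transfer_decreasing:
  assumes \<kappa>: "\<kappa> \<in> {0<..1/2}" and g: "decr_density g"
  shows "decr_density (transfer \<kappa> g)"
proof (rule decr_densityI)
  note l = transfer_left_decreasing[OF assms]
  show "0 \<le> transfer \<kappa> g x" if "x \<in> {0<..1}" for x
    using decr_densityD(1)[OF l, of x] decr_densityD(1)[OF g, of "(x + 1) / 2"] that
    by (simp add: transfer_def)
  show "transfer \<kappa> g y \<le> transfer \<kappa> g x" if "0 < x" "x \<le> y" "y \<le> 1" for x y
    using decr_densityD(3)[OF l that] decr_densityD(3)[OF g, of "(x + 1) / 2" "(y + 1) / 2"] that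
    by (simp add: transfer_def)
qed (auto simp: transfer_def)

text \<open>Change of variables on each branch separately. Values in \<open>ennreal\<close> keep
  integrability out of this stage.\<close>

lemma transfer_dual_nn:
  fixes \<phi> :: "real \<Rightarrow> ennreal"
  assumes \<kappa>: "\<kappa> \<in> {0<..1/2}" and g: "decr_density g" and \<phi> [measurable]: "\<phi> \<in> borel_measurable borel"
  shows "(\<integral>\<^sup>+x. ennreal (g x) * \<phi> (lsv \<kappa> x) \<partial>lborel) = (\<integral>\<^sup>+x. ennreal (transfer \<kappa> g x) * \<phi> x \<partial>lborel)"
proof -
  define l where "l = (\<lambda>x. if x \<in> {0<..1}
     then g (left_inverse \<kappa> x) / left_slope \<kappa> (left_inverse \<kappa> x) else 0)"
  have l: "decr_density l"
    using transfer_left_decreasing[OF \<kappa> g] by (simp add: l_def)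
  note [measurable] = decr_density_measurable[OF g] decr_density_measurable[OF l]
  have \<kappa>0: "0 < \<kappa>" using \<kappa> by simp
  have "continuous_on {0..1/2} (left_slope \<kappa>)"
    unfolding left_slope_def using \<kappa>0 by (intro continuous_intros continuous_on_powr') auto
  then have "(\<integral>\<^sup>+x. (ennreal (l x) * \<phi> x) * indicator {left_branch \<kappa> 0..left_branch \<kappa> (1/2)} x \<partial>lborel)
     = (\<integral>\<^sup>+x. (ennreal (l (left_branch \<kappa> x)) * \<phi> (left_branch \<kappa> x)) * ennreal (left_slope \<kappa> x)
           * indicator {0..1/2} x \<partial>lborel)"
    using left_slope_bounds(1)[OF \<kappa>] \<kappa>0
    by (intro nn_integral_substitution_aux left_branch_deriv) force+
  also have "\<dots> = (\<integral>\<^sup>+x. ennreal (g x) * \<phi> (lsv \<kappa> x) * indicator {0<..<1/2} x \<partial>lborel)"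
  proof (intro nn_integral_cong_AE)
    \<comment> \<open>At \<open>1/2\<close> the left branch takes the value \<open>1\<close>, while
      \<open>lsv\<close> already jumps to \<open>0\<close>; the endpoints form a null set.\<close>
    have "AE x in lborel. x \<noteq> 0 \<and> x \<noteq> (1/2::real)"
      using AE_lborel_singleton[of "0::real"] AE_lborel_singleton[of "1/2::real"] by eventually_elim blast
    then show "AE x in lborel. (ennreal (l (left_branch \<kappa> x)) * \<phi> (left_branch \<kappa> x)) * ennreal (left_slope \<kappa> x)
           * indicator {0..1/2} x = ennreal (g x) * \<phi> (lsv \<kappa> x) * indicator {0<..<1/2} x"
    proof eventually_elim
      case (elim x)
      show ?case
      proof (cases "x \<in> {0<..<1/2}")
        case True
        then have "left_branch \<kappa> x \<in> {0<..1}"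
          using left_branch_strict_mono[OF \<kappa>0, of 0 x] left_branch_strict_mono[OF \<kappa>0, of x "1/2"] by auto
        then have "l (left_branch \<kappa> x) = g x / left_slope \<kappa> x"
          using True left_inverse_left_branch[OF \<kappa>0, of x] by (simp add: l_def)
        then have "ennreal (l (left_branch \<kappa> x)) * ennreal (left_slope \<kappa> x) = ennreal (g x)"
          using left_slope_bounds(1)[OF \<kappa>, of x] True decr_densityD(1)[OF g, of x]
          by (simp flip: ennreal_mult)
        then show ?thesis
          using True lsv_eq_left_branch[of x \<kappa>]
          by (simp add: mult.commute[of _ "\<phi> _"] mult.assoc)
      qed (use elim in \<open>auto split: split_indicator\<close>)
    qed
  qed
  also have "(\<integral>\<^sup>+x. (ennreal (l x) * \<phi> x) * indicator {left_branch \<kappa> 0..left_branch \<kappa> (1/2)} x \<partial>lborel)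
      = (\<integral>\<^sup>+x. ennreal (l x) * \<phi> x \<partial>lborel)"
    by (intro nn_integral_cong) (auto simp: l_def split: split_indicator)
  finally have left: "(\<integral>\<^sup>+x. ennreal (l x) * \<phi> x \<partial>lborel)
      = (\<integral>\<^sup>+x. ennreal (g x) * \<phi> (lsv \<kappa> x) * indicator {0<..<1/2} x \<partial>lborel)" .
  have "(\<integral>\<^sup>+x. (ennreal (g ((x + 1) / 2)) * \<phi> x) * indicator {2 * (1/2) - 1..2 * 1 - (1::real)} x \<partial>lborel)
    = (\<integral>\<^sup>+x. (ennreal (g (((2 * x - 1) + 1) / 2)) * \<phi> (2 * x - 1)) * ennreal 2 * indicator {1/2..1} x \<partial>lborel)"
    by (rule nn_integral_substitution_aux[where g="\<lambda>x. 2 * x - 1" and g'="\<lambda>_. 2"])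
       (auto intro!: derivative_eq_intros)
  also have "\<dots> = 2 * (\<integral>\<^sup>+x. ennreal (g x) * \<phi> (lsv \<kappa> x) * indicator {1/2..1} x \<partial>lborel)"
    by (subst nn_integral_cmult[symmetric])
       (auto intro!: nn_integral_cong simp: lsv_def mult_ac split: split_indicator)
  finally have right: "(\<integral>\<^sup>+x. ennreal (g ((x + 1) / 2)) * \<phi> x * indicator {0..1} x \<partial>lborel)
    = 2 * (\<integral>\<^sup>+x. ennreal (g x) * \<phi> (lsv \<kappa> x) * indicator {1/2..1} x \<partial>lborel)" by simp
  have "(\<integral>\<^sup>+x. ennreal (transfer \<kappa> g x) * \<phi> x \<partial>lborel) =
     (\<integral>\<^sup>+x. ennreal (l x) * \<phi> x + ennreal (1/2) * (ennreal (g ((x + 1) / 2)) * \<phi> x * indicator {0..1} x) \<partial>lborel)"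
  proof (intro nn_integral_cong_AE)
    show "AE x in lborel. ennreal (transfer \<kappa> g x) * \<phi> x =
       ennreal (l x) * \<phi> x + ennreal (1/2) * (ennreal (g ((x + 1) / 2)) * \<phi> x * indicator {0..1} x)"
      using AE_lborel_singleton[of 0]
    proof eventually_elim
      case (elim x)
      show ?case
      proof (cases "x \<in> {0<..1}")
        case True
        then have "transfer \<kappa> g x = l x + (1/2) * g ((x + 1) / 2)"
          by (simp add: transfer_def l_def)
        then show ?thesis
          using True decr_densityD(1)[OF l, of x] decr_densityD(1)[OF g, of "(x + 1) / 2"]
          by (simp only: ennreal_plus ennreal_mult mult_nonneg_nonneg distrib_right) (simp add: mult.assoc)
      qed (use elim in \<open>auto simp: transfer_def l_def\<close>)
    qed
  qed
  also have "\<dots> = (\<integral>\<^sup>+x. ennreal (l x) * \<phi> x \<partial>lborel)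
      + ennreal (1/2) * (\<integral>\<^sup>+x. ennreal (g ((x + 1) / 2)) * \<phi> x * indicator {0..1} x \<partial>lborel)"
    by (subst nn_integral_add) (auto simp: nn_integral_cmult)
  also have "\<dots> = (\<integral>\<^sup>+x. ennreal (g x) * \<phi> (lsv \<kappa> x) * indicator {0<..<1/2} x \<partial>lborel)
      + (\<integral>\<^sup>+x. ennreal (g x) * \<phi> (lsv \<kappa> x) * indicator {1/2..1} x \<partial>lborel)"
  proof -
    have "ennreal (1/2) * (2 * z) = z" for z :: ennreal
    proof -
      have "ennreal (1/2) * (ennreal 2 * z) = ennreal (1/2 * 2) * z"
        by (subst ennreal_mult) (auto simp: mult.assoc)
      then show ?thesis by simp
    qed
    then show ?thesis unfolding left right by simp
  qed
  also have "\<dots> = (\<integral>\<^sup>+x. ennreal (g x) * \<phi> (lsv \<kappa> x) \<partial>lborel)"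
    by (subst nn_integral_add[symmetric])
       (auto intro!: nn_integral_cong simp: decr_densityD(2)[OF g] split: split_indicator)
  finally show ?thesis ..
qed

text \<open>As an equality of measures, the duality carries real integrals and integrability over
  together in \<open>transfer_integral\<close>.\<close>

lemma transfer_distr:
  assumes \<kappa>: "\<kappa> \<in> {0<..1/2}" and g: "decr_density g"
  shows "distr (density lborel (\<lambda>x. ennreal (g x))) borel (lsv \<kappa>) = density lborel (\<lambda>x. ennreal (transfer \<kappa> g x))"
proof (rule measure_eqI)
  note [measurable] = decr_density_measurable[OF g]
    decr_density_measurable[OF transfer_decreasing[OF \<kappa> g]]
  fix A assume "A \<in> sets (distr (density lborel (\<lambda>x. ennreal (g x))) borel (lsv \<kappa>))"
  then have [measurable]: "A \<in> sets borel" by simp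
  have "lsv \<kappa> -` A \<in> sets borel"
    using measurable_sets[of "lsv \<kappa>" borel borel A] by simp
  then show "emeasure (distr (density lborel (\<lambda>x. ennreal (g x))) borel (lsv \<kappa>)) A =
      emeasure (density lborel (\<lambda>x. ennreal (transfer \<kappa> g x))) A"
    using transfer_dual_nn[OF \<kappa> g, of "indicator A"]
    by (simp add: emeasure_distr emeasure_density indicator_def)
qed simp

lemma transfer_integral:
  fixes \<phi> :: "real \<Rightarrow> real"
  assumes \<kappa>: "\<kappa> \<in> {0<..1/2}" and g: "decr_density g" and [measurable]: "\<phi> \<in> borel_measurable borel"
  shows "(LBINT x. transfer \<kappa> g x * \<phi> x) = (LBINT x. g x * \<phi> (lsv \<kappa> x))" (is ?eq)
    and "integrable lborel (\<lambda>x. transfer \<kappa> g x * \<phi> x) \<longleftrightarrow> integrable lborel (\<lambda>x. g x * \<phi> (lsv \<kappa> x))" (is ?int)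
proof -
  note [measurable] = decr_density_measurable[OF g]
    decr_density_measurable[OF transfer_decreasing[OF \<kappa> g]]
  note [simp] = decr_densityD(1)[OF g] decr_densityD(1)[OF transfer_decreasing[OF \<kappa> g]]
  have "(LBINT x. transfer \<kappa> g x *\<^sub>R \<phi> x) = (\<integral>x. \<phi> x \<partial>density lborel (\<lambda>x. ennreal (transfer \<kappa> g x)))"
    by (subst integral_density) auto
  also have "\<dots> = (LBINT x. g x *\<^sub>R \<phi> (lsv \<kappa> x))"
    by (subst transfer_distr[OF \<kappa> g, symmetric]) (simp add: integral_distr integral_density)
  finally show ?eq by simp
  have "integrable lborel (\<lambda>x. transfer \<kappa> g x *\<^sub>R \<phi> x) \<longleftrightarrow> integrable (density lborel (\<lambda>x. ennreal (transfer \<kappa> g x))) \<phi>"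
    by (subst integrable_density) auto
  also have "\<dots> \<longleftrightarrow> integrable lborel (\<lambda>x. g x *\<^sub>R \<phi> (lsv \<kappa> x))"
    by (subst transfer_distr[OF \<kappa> g, symmetric]) (simp add: integrable_distr_eq integrable_density)
  finally show ?int by simp
qed

text \<open>In the coupling this hands the bound \<open>4 * x powr - \<alpha>\<close> from a full
  density down to its remainder, which has left the cone.\<close>

lemma transfer_mono:
  assumes \<kappa>: "\<kappa> \<in> {0<..1/2}" and le: "\<And>x. x \<in> {0<..1} \<Longrightarrow> f x \<le> g x"
  shows "transfer \<kappa> f x \<le> transfer \<kappa> g x"
proof (cases "x \<in> {0<..1}")
  case True
  have y: "left_inverse \<kappa> x \<in> {0<..1/2}"
    using left_inverse(1)[of \<kappa> x] left_inverse_pos[of \<kappa> x] True \<kappa> by auto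
  then have "1 \<le> left_slope \<kappa> (left_inverse \<kappa> x)"
    using left_slope_bounds(1)[OF \<kappa>] by auto
  then show ?thesis
    using True y le[of "left_inverse \<kappa> x"] le[of "(x + 1) / 2"]
    by (auto simp: transfer_def intro!: add_mono divide_right_mono)
qed (auto simp: transfer_def)

lemma transfer_diff: "transfer \<kappa> (\<lambda>x. f x - c * g x) x = transfer \<kappa> f x - c * transfer \<kappa> g x"
  by (simp add: transfer_def diff_divide_distrib right_diff_distrib add_divide_distrib distrib_left)

section \<open>Compositions along a sequence of parameters\<close>

primrec orbit :: "(nat \<Rightarrow> real) \<Rightarrow> nat \<Rightarrow> real \<Rightarrow> real" where
  "orbit \<kappa> 0 x = x"
| "orbit \<kappa> (Suc n) x = lsv (\<kappa> n) (orbit \<kappa> n x)"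

primrec transfers :: "(nat \<Rightarrow> real) \<Rightarrow> nat \<Rightarrow> (real \<Rightarrow> real) \<Rightarrow> real \<Rightarrow> real" where
  "transfers \<kappa> 0 g = g"
| "transfers \<kappa> (Suc n) g = transfer (\<kappa> n) (transfers \<kappa> n g)"

lemma orbit_measurable [measurable]: "orbit \<kappa> n \<in> borel_measurable borel"
  by (induction n) simp_all

lemma orbit_range: "(\<And>i. 0 < \<kappa> i) \<Longrightarrow> x \<in> {0..1} \<Longrightarrow> orbit \<kappa> n x \<in> {0..1}"
  by (induction n) (simp_all add: lsv_range del: atLeastAtMost_iff)

lemma orbit_add: "orbit \<kappa> (m + n) x = orbit (\<lambda>i. \<kappa> (m + i)) n (orbit \<kappa> m x)"
  by (induction n) simp_all

lemma transfers_add: "transfers \<kappa> (m + n) g = transfers (\<lambda>i. \<kappa> (m + i)) n (transfers \<kappa> m g)"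
  by (induction n) simp_all

lemma transfers_decreasing:
  "(\<And>i. \<kappa> i \<in> {0<..1/2}) \<Longrightarrow> decr_density g \<Longrightarrow> decr_density (transfers \<kappa> n g)"
  by (induction n) (simp_all add: transfer_decreasing)

lemma transfers_mono:
  assumes "\<And>i. \<kappa> i \<in> {0<..1/2}" "\<And>x. x \<in> {0<..1} \<Longrightarrow> f x \<le> g x"
  shows "x \<in> {0<..1} \<Longrightarrow> transfers \<kappa> n f x \<le> transfers \<kappa> n g x"
  by (induction n arbitrary: x) (simp_all add: assms transfer_mono del: greaterThanAtMost_iff)

lemma transfers_diff:
  "transfers \<kappa> n (\<lambda>x. f x - c * g x) = (\<lambda>x. transfers \<kappa> n f x - c * transfers \<kappa> n g x)"
proof (induction n)
  case (Suc n)
  show ?case by (rule ext) (simp add: Suc.IH transfer_diff)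
qed simp

lemma transfers_integral:
  fixes \<phi> :: "real \<Rightarrow> real"
  assumes \<kappa>: "\<And>i. \<kappa> i \<in> {0<..1/2}" and g: "decr_density g" and "\<phi> \<in> borel_measurable borel"
  shows "(LBINT x. transfers \<kappa> n g x * \<phi> x) = (LBINT x. g x * \<phi> (orbit \<kappa> n x))"
    and "integrable lborel (\<lambda>x. transfers \<kappa> n g x * \<phi> x) \<longleftrightarrow> integrable lborel (\<lambda>x. g x * \<phi> (orbit \<kappa> n x))"
  using assms(3)
  by (induction n arbitrary: \<phi>) (simp_all add: transfer_integral[OF \<kappa> transfers_decreasing[OF \<kappa> g]])

lemma transfers_mass:
  assumes \<kappa>: "\<And>i. \<kappa> i \<in> {0<..1/2}" and g: "decr_density g"
  shows "(LBINT x. transfers \<kappa> n g x) = (LBINT x. g x)"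
    and "integrable lborel (transfers \<kappa> n g) \<longleftrightarrow> integrable lborel g"
  using transfers_integral[OF assms, of "\<lambda>_. 1"] by simp_all

section \<open>Mass estimates and the invariant cone\<close>

lemma powr_neg_integral:
  fixes \<alpha> b :: real
  assumes "0 \<le> \<alpha>" "\<alpha> < 1" "0 \<le> b"
  shows "integrable lborel (\<lambda>x. indicator {0<..b} x * x powr - \<alpha>)"
    and "(LBINT x. indicator {0<..b} x * x powr - \<alpha>) = b powr (1 - \<alpha>) / (1 - \<alpha>)"
proof -
  have "((\<lambda>x. x powr - \<alpha>) has_integral (b powr (1 - \<alpha>) / (1 - \<alpha>))) {0..b}"
    using has_integral_powr_from_0[of "- \<alpha>" b] assms by simp
  from nn_integral_has_integral_lebesgue[OF _ this]
  have "(\<integral>\<^sup>+x. ennreal (indicator {0..b} x * x powr - \<alpha>) \<partial>lborel) = ennreal (b powr (1 - \<alpha>) / (1 - \<alpha>))"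
    by simp
  moreover have "indicator {0..b} x * x powr - \<alpha> = indicator {0<..b} x * x powr - \<alpha>" for x :: real
    by (auto split: split_indicator)
  ultimately have nn: "(\<integral>\<^sup>+x. ennreal (indicator {0<..b} x * x powr - \<alpha>) \<partial>lborel) = ennreal (b powr (1 - \<alpha>) / (1 - \<alpha>))"
    by simp
  show "integrable lborel (\<lambda>x. indicator {0<..b} x * x powr - \<alpha>)"
    using nn by (intro integrableI_nn_integral_finite[where x="b powr (1 - \<alpha>) / (1 - \<alpha>)"]) (use assms in auto)
  show "(LBINT x. indicator {0<..b} x * x powr - \<alpha>) = b powr (1 - \<alpha>) / (1 - \<alpha>)"
    using nn assms by (subst integral_eq_nn_integral) auto
qed

text \<open>The value at \<open>1/2\<close> bounds \<open>g\<close> from above on the right half and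
  from below on the left half. So the left half carries at least half of the mass, and
  \<open>g (1/2)\<close> is at most twice the mass.\<close>

lemma decr_density_half:
  assumes g: "decr_density g" and int: "integrable lborel g"
  shows "(LBINT x. indicator {1/2..1} x * g x) \<le> g (1/2) / 2"
    and "g (1/2) / 2 \<le> (LBINT x. indicator {0..<1/2} x * g x)"
    and "g (1/2) / 2 \<le> (LBINT x. g x)"
proof -
  note D = decr_densityD[OF g]
  have i1: "integrable lborel (\<lambda>x. indicator A x * g x)" if "A \<in> sets borel" for A
    using integrable_mult_indicator[OF _ int, of A] that by simp
  have "(LBINT x. indicator {1/2..1} x * g x) \<le> (LBINT x. indicator {1/2..1::real} x * g (1/2))"
    by (intro integral_mono i1 integrable_mult_left integrable_real_indicator emeasure_bounded_finite)
       (auto split: split_indicator intro: D)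
  then show "(LBINT x. indicator {1/2..1} x * g x) \<le> g (1/2) / 2" by simp
  have "(LBINT x. indicator {0<..<1/2::real} x * g (1/2)) \<le> (LBINT x. indicator {0..<1/2} x * g x)"
    by (intro integral_mono i1 integrable_mult_left integrable_real_indicator emeasure_bounded_finite)
       (auto split: split_indicator intro: D)
  then show l: "g (1/2) / 2 \<le> (LBINT x. indicator {0..<1/2} x * g x)" by simp
  have "(LBINT x. indicator {0..<1/2} x * g x) \<le> (LBINT x. g x)"
    by (intro integral_mono i1 int) (auto split: split_indicator intro: D)
  with l show "g (1/2) / 2 \<le> (LBINT x. g x)" by simp
qed

text \<open>The constant \<open>4\<close> is one for which the upper bound is invariant: the factor \<open>1 - s / 4\<close> gained on
  the left branch in \<open>transfer_cone\<close> pays for the mass that arrives through the right branch.\<close>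

definition cone :: "real \<Rightarrow> (real \<Rightarrow> real) \<Rightarrow> bool" where
  "cone \<alpha> g \<longleftrightarrow> decr_density g \<and> (LBINT x. g x) = 1 \<and> (\<forall>x\<in>{0<..1}. g x \<le> 4 * x powr - \<alpha>)"

text \<open>Integrability is implicit in \<open>cone\<close>: the Bochner integral of a
  nonintegrable function is \<open>0\<close>, not \<open>1\<close>.\<close>

lemma coneD:
  assumes "cone \<alpha> g"
  shows "decr_density g" "(LBINT x. g x) = 1" "integrable lborel g"
    "x \<in> {0<..1} \<Longrightarrow> g x \<le> 4 * x powr - \<alpha>"
  using assms not_integrable_integral_eq[of lborel g] by (auto simp: cone_def)

lemma transfer_cone:
  assumes \<alpha>: "\<alpha> < 1/2" and \<kappa>: "\<kappa> \<in> {0<..\<alpha>}" and g: "cone \<alpha> g"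
  shows "cone \<alpha> (transfer \<kappa> g)"
proof -
  note gd = coneD[OF g]
  have \<kappa>': "\<kappa> \<in> {0<..1/2}" using \<alpha> \<kappa> by auto
  have "transfer \<kappa> g x \<le> 4 * x powr - \<alpha>" if x: "x \<in> {0<..1}" for x
  proof -
    define y where "y = left_inverse \<kappa> x"
    define s where "s = (2 * y) powr \<kappa>"
    have y: "0 < y" "y \<le> 1/2" and xy: "x = y * (1 + s)"
      using left_inverse[of \<kappa> x] left_inverse_pos[of \<kappa> x] x \<kappa> by (auto simp: y_def left_branch_def s_def)
    have s: "0 < s" "s \<le> 1"
      using y \<kappa> powr_mono2[of \<kappa> "2 * y" 1] by (auto simp: s_def)
    \<comment> \<open>Since \<open>x \<le> 2 * y \<le> 1\<close> and
      \<open>\<kappa> \<le> \<alpha>\<close>, one gets \<open>x powr \<alpha> \<le> s\<close>. The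
      factor \<open>1 - s / 4\<close> gained on the left branch is thereby worth at least
      \<open>1\<close> out of \<open>4 * x powr - \<alpha>\<close>.\<close>
    have "x powr \<alpha> \<le> (2 * y) powr \<alpha>"
      using y s x \<kappa> by (intro powr_mono2) (auto simp: xy algebra_simps)
    also have "\<dots> \<le> s"
      unfolding s_def using y \<kappa> by (intro powr_mono') auto
    finally have "x powr - \<alpha> * x powr \<alpha> \<le> x powr - \<alpha> * s"
      by (intro mult_left_mono) auto
    then have xs: "1 \<le> x powr - \<alpha> * s"
      using x by (simp add: powr_minus)
    have "(1 + s) powr \<alpha> \<le> (1 + s) powr (1/2)"
      using s \<alpha> by (intro powr_mono) auto
    also have "\<dots> = sqrt (1 + s)"
      using s by (simp add: powr_half_sqrt)
    also have "\<dots> \<le> 1 + s / 2"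
      using s by (intro real_le_lsqrt) (auto simp: power2_eq_square algebra_simps)
    finally have "(1 + s) powr \<alpha> \<le> 1 + s / 2" .
    moreover have "(1 + s / 2) \<le> (1 - s / 4) * (1 + s)"
    proof -
      have "s * s \<le> s * 1" using s by (intro mult_left_mono) auto
      moreover have "(1 - s / 4) * (1 + s) = 1 + 3 / 4 * s - s * s / 4" by (simp add: field_simps)
      ultimately show ?thesis by linarith
    qed
    moreover have "1 + s \<le> left_slope \<kappa> y"
      using y \<kappa> s by (simp add: left_slope_def s_def algebra_simps)
    then have "(1 - s / 4) * (1 + s) \<le> (1 - s / 4) * left_slope \<kappa> y"
      using s by (intro mult_left_mono) auto
    ultimately have *: "(1 + s) powr \<alpha> \<le> (1 - s / 4) * left_slope \<kappa> y" by linarith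
    have "y powr - \<alpha> = x powr - \<alpha> * (1 + s) powr \<alpha>"
      using y s by (simp add: xy powr_mult powr_minus)
    also have "\<dots> \<le> x powr - \<alpha> * ((1 - s / 4) * left_slope \<kappa> y)"
      using * by (intro mult_left_mono) auto
    finally have ys: "y powr - \<alpha> / left_slope \<kappa> y \<le> x powr - \<alpha> * (1 - s / 4)"
      using left_slope_bounds(1)[OF \<kappa>', of y] y by (simp add: divide_le_eq mult_ac)
    have "g y / left_slope \<kappa> y \<le> 4 * (y powr - \<alpha> / left_slope \<kappa> y)"
      using gd(4)[of y] y left_slope_bounds(1)[OF \<kappa>', of y] by (simp add: divide_right_mono)
    also have "\<dots> \<le> 4 * (x powr - \<alpha> * (1 - s / 4))"
      using ys by simp
    also have "\<dots> \<le> 4 * x powr - \<alpha> - 1"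
      using xs by (simp add: algebra_simps)
    finally have "g y / left_slope \<kappa> y \<le> 4 * x powr - \<alpha> - 1" .
    \<comment> \<open>The right branch contributes at most \<open>g (1/2) / 2\<close>, hence at most
      the mass \<open>1\<close>, which is exactly the gain above.\<close>
    moreover have "g ((x + 1) / 2) \<le> g (1/2)"
      using x by (intro decr_densityD(3)[OF gd(1)]) auto
    moreover have "g (1/2) / 2 \<le> 1"
      using decr_density_half(3)[OF gd(1,3)] gd(2) by simp
    ultimately show ?thesis
      using x by (simp add: transfer_def y_def)
  qed
  then show ?thesis
    using transfer_decreasing[OF \<kappa>' gd(1)] transfer_integral(1)[OF \<kappa>' gd(1), of "\<lambda>_. 1"] gd(2)
    by (simp add: cone_def)
qed

lemma transfers_cone:
  "\<alpha> < 1/2 \<Longrightarrow> (\<And>i. \<kappa> i \<in> {0<..\<alpha>}) \<Longrightarrow> cone \<alpha> g \<Longrightarrow> cone \<alpha> (transfers \<kappa> n g)"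
  by (induction n) (simp_all add: transfer_cone)

text \<open>Near \<open>0\<close> the map moves \<open>x\<close> by about
  \<open>x powr (1 + \<kappa>)\<close>, and \<open>x powr - \<alpha>\<close> is the coordinate in
  which the slowest admissible map is roughly a translation. With
  \<open>s = (2 * x) powr \<kappa>\<close>, the estimates
  \<open>(1 + s) powr - \<alpha> \<le> 1 - \<alpha> / 4 * s\<close> and
  \<open>1 \<le> x powr - \<alpha> * s\<close> give the drop by \<open>\<alpha> / 4\<close>. Below
  \<open>\<xi>\<close> only monotonicity is used, and on the right half the image value is simply
  added.\<close>

lemma lyapunov_step:
  fixes \<alpha> \<xi> x :: real
  assumes \<alpha>: "0 < \<alpha>" "\<alpha> < 1/2" and \<kappa>: "\<kappa> \<in> {0<..\<alpha>}" and \<xi>: "0 < \<xi>" and x: "x \<in> {0<..1}"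
  defines "W \<equiv> \<lambda>x. (max x \<xi>) powr - \<alpha>"
  shows "W (lsv \<kappa> x) \<le> W x - \<alpha> / 4 * indicator {\<xi>..<1/2} x + indicator {1/2..1} x * W (2 * x - 1)"
proof (cases "x < 1/2")
  case True
  define s where "s = (2 * x) powr \<kappa>"
  have T: "lsv \<kappa> x = x * (1 + s)"
    using True x by (simp add: lsv_eq_left_branch left_branch_def s_def)
  have s: "0 < s" "s \<le> 1"
    using x True \<kappa> powr_mono2[of \<kappa> "2 * x" 1] by (auto simp: s_def)
  have Tx: "x < lsv \<kappa> x"
    using s x by (simp add: T algebra_simps)
  show ?thesis
  proof (cases "\<xi> \<le> x")
    case False
    have "W (lsv \<kappa> x) \<le> W x"
      unfolding W_def using Tx \<alpha> \<xi> by (intro powr_mono2') auto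
    then show ?thesis using False True by simp
  next
    case \<xi>x: True
    define u where "u = \<alpha> * s / 2"
    have u: "0 \<le> u" "u \<le> 1"
      using \<alpha> s mult_mono[of \<alpha> 1 s 1] by (auto simp: u_def)
    have "s / 2 \<le> ln (1 + s)"
    proof -
      have "s / 2 \<le> s / (1 + s)"
        using s by (intro divide_left_mono) auto
      also have "\<dots> = 1 - inverse (1 + s)"
        using s by (simp add: field_simps)
      also have "\<dots> \<le> ln (1 + s)"
        using ln_le_minus_one[of "inverse (1 + s)"] s by (simp add: ln_inverse)
      finally show ?thesis .
    qed
    then have "(1 + s) powr - \<alpha> \<le> exp (- u)"
      using s \<alpha> by (simp add: powr_def u_def mult_left_mono)
    also have "\<dots> \<le> 1 / (1 + u)"
      using exp_ge_add_one_self[of u] u by (simp add: exp_minus field_simps)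
    also have "\<dots> \<le> 1 - u / 2"
    proof -
      have "u * u \<le> u * 1" using u by (intro mult_left_mono) auto
      then show ?thesis using u by (subst pos_divide_le_eq) (auto simp: algebra_simps)
    qed
    finally have "(1 + s) powr - \<alpha> \<le> 1 - \<alpha> / 4 * s" by (simp add: u_def)
    then have "x powr - \<alpha> * (1 + s) powr - \<alpha> \<le> x powr - \<alpha> * (1 - \<alpha> / 4 * s)"
      by (intro mult_left_mono) auto
    also have "\<dots> = x powr - \<alpha> - \<alpha> / 4 * (x powr - \<alpha> * s)"
      by (simp add: algebra_simps)
    also have "\<dots> \<le> x powr - \<alpha> - \<alpha> / 4"
    proof -
      have "x powr \<alpha> \<le> (2 * x) powr \<alpha>"
        using x \<alpha> by (intro powr_mono2) auto
      also have "\<dots> \<le> s"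
        unfolding s_def using x True \<kappa> by (intro powr_mono') auto
      finally have "x powr - \<alpha> * x powr \<alpha> \<le> x powr - \<alpha> * s"
        by (intro mult_left_mono) auto
      then have "1 \<le> x powr - \<alpha> * s"
        using x by (simp add: powr_minus)
      then show ?thesis using \<alpha> by simp
    qed
    finally have "(x * (1 + s)) powr - \<alpha> \<le> x powr - \<alpha> - \<alpha> / 4"
      using x s by (simp add: powr_mult)
    then show ?thesis
      using \<xi>x True Tx by (simp add: W_def T max_def)
  qed
next
  case False
  then show ?thesis using x by (simp add: W_def lsv_def)
qed

section \<open>Loss of memory\<close>

text \<open>The weight \<open>x powr - \<alpha>\<close>, cut off at \<open>\<xi>\<close>, measures the time that a point needs to escape from \<open>0\<close>:
  on the left branch beyond \<open>\<xi>\<close> it drops by a fixed amount per step, and its increase on the right branch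
  is controlled by the height of the density at \<open>1/2\<close>.\<close>

lemma lyapunov_decrease:
  fixes \<alpha> \<xi> :: real
  assumes \<alpha>: "0 < \<alpha>" "\<alpha> < 1/2" and \<kappa>: "\<kappa> \<in> {0<..\<alpha>}" and \<xi>: "0 < \<xi>"
    and g: "decr_density g" and int: "integrable lborel g"
    and bound: "\<And>x. x \<in> {0<..1} \<Longrightarrow> g x \<le> 4 * x powr - \<alpha>"
    and small: "8 * \<xi> powr (1 - \<alpha>) \<le> (LBINT x. g x) / 4"
  defines "W \<equiv> \<lambda>x. (max x \<xi>) powr - \<alpha>"
  shows "(LBINT x. transfer \<kappa> g x * W x)
    \<le> (LBINT x. g x * W x) - \<alpha> / 16 * (LBINT x. g x) + g (1/2)"
proof -
  note D = decr_densityD[OF g]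
  note [measurable] = decr_density_measurable[OF g]
  define M where "M = (LBINT x. g x)"
  have W [measurable]: "W \<in> borel_measurable borel" by (simp add: W_def)
  have Wb: "0 \<le> W x" "W x \<le> \<xi> powr - \<alpha>" for x
    using \<alpha> \<xi> by (auto simp: W_def intro!: powr_mono2')
  have gW: "integrable lborel (\<lambda>x. g x * W (h x))" if [measurable]: "h \<in> borel_measurable borel" for h
    by (rule Bochner_Integration.integrable_bound[OF integrable_mult_right[OF int, of "\<xi> powr - \<alpha>"]])
       (use Wb D(1) in \<open>auto simp: abs_mult mult.commute intro!: mult_mono\<close>)
  have ig: "integrable lborel (\<lambda>x. indicator A x * g x)" if "A \<in> sets borel" for A
    using integrable_mult_indicator[OF _ int, of A] that by simp
  let ?p = "\<lambda>x::real. indicator {0<..1} x * x powr - \<alpha>"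
  have p: "integrable lborel ?p" "(LBINT x. ?p x) = 1 / (1 - \<alpha>)"
    using powr_neg_integral[of \<alpha> 1] \<alpha> by auto
  have p2: "integrable lborel (\<lambda>x. ?p (-1 + 2 * x))"
    using lborel_integrable_real_affine[OF p(1), of 2 "-1"] by simp
  have "(LBINT x. ?p x) = 2 * (LBINT x. ?p (-1 + 2 * x))"
    using lborel_integral_real_affine[of 2 ?p "-1"] by simp
  then have "(LBINT x. ?p (-1 + 2 * x)) = 1 / (1 - \<alpha>) / 2"
    unfolding p by simp
  also have "\<dots> \<le> 1"
    using \<alpha> by (simp add: divide_le_eq)
  finally have p2i: "(LBINT x. ?p (-1 + 2 * x)) \<le> 1" .
  let ?q = "\<lambda>x. g x * W x - \<alpha> / 4 * (indicator {\<xi>..<1/2} x * g x) + g (1/2) * ?p (-1 + 2 * x)"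
  have "(LBINT x. transfer \<kappa> g x * W x) = (LBINT x. g x * W (lsv \<kappa> x))"
    using \<kappa> \<alpha> by (intro transfer_integral g) auto
  also have "\<dots> \<le> (LBINT x. ?q x)"
  proof (intro integral_mono_AE gW)
    show "integrable lborel ?q"
      by (intro Bochner_Integration.integrable_add Bochner_Integration.integrable_diff integrable_mult_right ig p2 gW[of "\<lambda>x. x"]) auto
    \<comment> \<open>The point \<open>1/2\<close> has to be discarded: \<open>W 0\<close> is
      \<open>\<xi> powr - \<alpha>\<close>, whereas \<open>?p\<close> vanishes at
      \<open>0\<close>.\<close>
    show "AE x in lborel. g x * W (lsv \<kappa> x) \<le> ?q x"
      using AE_lborel_singleton[of "1/2"]
    proof eventually_elim
      case (elim x)
      show ?case
      proof (cases "x \<in> {0<..1}")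
        case True
        have "g x * W (lsv \<kappa> x) \<le> g x * (W x - \<alpha> / 4 * indicator {\<xi>..<1/2} x + indicator {1/2..1} x * W (2 * x - 1))"
          unfolding W_def using lyapunov_step[OF \<alpha> \<kappa> \<xi> True] D(1) by (intro mult_left_mono) auto
        also have "\<dots> = g x * W x - \<alpha> / 4 * (indicator {\<xi>..<1/2} x * g x) + indicator {1/2..1} x * (g x * W (2 * x - 1))"
          by (simp add: algebra_simps)
        also have "indicator {1/2..1} x * (g x * W (2 * x - 1)) \<le> g (1/2) * ?p (-1 + 2 * x)"
        proof (cases "x > 1/2")
          case x: True
          have "g x * W (2 * x - 1) \<le> g (1/2) * (2 * x - 1) powr - \<alpha>"
            using x True D(1) D(3)[of "1/2" x] \<alpha> by (intro mult_mono) (auto simp: W_def intro!: powr_mono2')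
          then show ?thesis using x True by (simp add: algebra_simps)
        qed (use elim in \<open>auto split: split_indicator\<close>)
        finally show ?thesis by simp
      qed (auto simp: D split: split_indicator)
    qed
  qed measurable
  also have "\<dots> = (LBINT x. g x * W x) - \<alpha> / 4 * (LBINT x. indicator {\<xi>..<1/2} x * g x)
      + g (1/2) * (LBINT x. ?p (-1 + 2 * x))"
    using gW[of "\<lambda>x. x"] ig p2
    by (simp add: Bochner_Integration.integral_add Bochner_Integration.integral_diff)
  also have "\<dots> \<le> (LBINT x. g x * W x) - \<alpha> / 4 * (M / 4) + g (1/2) * 1"
  proof (intro add_mono diff_mono mult_left_mono p2i D(1) order_refl)
    \<comment> \<open>At least half of the mass lies left of \<open>1/2\<close>, and by
      \<open>small\<close> at most a quarter of it lies below \<open>\<xi>\<close>.\<close>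
    have "M = (LBINT x. indicator {0..<1/2} x * g x + indicator {1/2..1} x * g x)"
      unfolding M_def by (intro Bochner_Integration.integral_cong) (auto simp: D split: split_indicator)
    also have "\<dots> = (LBINT x. indicator {0..<1/2} x * g x) + (LBINT x. indicator {1/2..1} x * g x)"
      by (intro Bochner_Integration.integral_add ig) auto
    finally have "M / 2 \<le> (LBINT x. indicator {0..<1/2} x * g x)"
      using decr_density_half(1,2)[OF g int] by linarith
    also have "\<dots> \<le> (LBINT x. indicator {\<xi>..<1/2} x * g x + 4 * (indicator {0<..\<xi>} x * x powr - \<alpha>))"
    proof (intro integral_mono Bochner_Integration.integrable_add integrable_mult_right ig)
      show "integrable lborel (\<lambda>x. indicator {0<..\<xi>} x * x powr - \<alpha>)"
        using powr_neg_integral[of \<alpha> \<xi>] \<alpha> \<xi> by auto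
      show "indicator {0..<1/2} x * g x \<le> indicator {\<xi>..<1/2} x * g x + 4 * (indicator {0<..\<xi>} x * x powr - \<alpha>)" for x
        using bound[of x] D(2)[of x] by (cases "x \<in> {0<..1}") (auto split: split_indicator)
    qed auto
    also have "\<dots> = (LBINT x. indicator {\<xi>..<1/2} x * g x) + 4 * (\<xi> powr (1 - \<alpha>) / (1 - \<alpha>))"
      using powr_neg_integral[of \<alpha> \<xi>] \<alpha> \<xi> ig[of "{\<xi>..<1/2}"] by (simp add: Bochner_Integration.integral_add)
    also have "4 * (\<xi> powr (1 - \<alpha>) / (1 - \<alpha>)) \<le> 8 * \<xi> powr (1 - \<alpha>)"
    proof -
      have "\<xi> powr (1 - \<alpha>) / (1 - \<alpha>) \<le> \<xi> powr (1 - \<alpha>) / (1/2)"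
        using \<alpha> by (intro divide_left_mono) auto
      then show ?thesis by simp
    qed
    finally show "M / 4 \<le> (LBINT x. indicator {\<xi>..<1/2} x * g x)"
      using small by (simp add: M_def)
  qed (use \<alpha> in auto)
  finally show ?thesis by (simp add: M_def)
qed

text \<open>If the value at \<open>1\<close> stayed too low for all \<open>j \<le> n\<close>, the
  value at \<open>1/2\<close> would stay below \<open>\<alpha> / 32\<close> times the mass. It would
  then offset at most half of the loss in \<open>lyapunov_decrease\<close>, and the weighted
  integral, initially at most \<open>\<xi> powr - \<alpha>\<close> times the mass, would be negative
  at time \<open>n\<close>.\<close>

lemma mass_leaves_zero:
  fixes \<alpha> \<xi> :: real
  assumes \<alpha>: "0 < \<alpha>" "\<alpha> < 1/2" and \<kappa>: "\<And>i. \<kappa> i \<in> {0<..\<alpha>}" and \<xi>: "0 < \<xi>"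
    and g: "decr_density g" and M: "0 < (LBINT x. g x)"
    and bound: "\<And>j x. x \<in> {0<..1} \<Longrightarrow> transfers \<kappa> j g x \<le> 4 * x powr - \<alpha>"
    and small: "8 * \<xi> powr (1 - \<alpha>) \<le> (LBINT x. g x) / 4"
    and n: "32 * \<xi> powr - \<alpha> / \<alpha> < real n"
  shows "\<exists>j\<le>n. \<alpha> / 96 * (LBINT x. g x) \<le> transfers \<kappa> j g 1"
proof (rule ccontr)
  define M where "M = (LBINT x. g x)"
  define W where "W = (\<lambda>x. (max x \<xi>) powr - \<alpha>)"
  define V where "V = (\<lambda>j. LBINT x. transfers \<kappa> j g x * W x)"
  have \<kappa>': "\<kappa> i \<in> {0<..1/2}" for i using \<kappa>[of i] \<alpha> by auto
  \<comment> \<open>A nonintegrable \<open>g\<close> would have integral \<open>0\<close>.\<close>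
  have int: "integrable lborel g"
    using M not_integrable_integral_eq[of lborel g] by force
  have W [measurable]: "W \<in> borel_measurable borel" by (simp add: W_def)
  have Wb: "0 \<le> W x" "W x \<le> \<xi> powr - \<alpha>" for x
    using \<alpha> \<xi> by (auto simp: W_def intro!: powr_mono2')
  assume "\<not> ?thesis"
  then have neg: "transfers \<kappa> j g 1 < \<alpha> / 96 * M" if "j \<le> n" for j
    using that unfolding M_def by (meson not_le)
  have td: "decr_density (transfers \<kappa> j g)" for j
    using transfers_decreasing[OF \<kappa>' g] .
  have V: "V j \<le> V 0 - real j * (\<alpha> / 32 * M)" if "j \<le> n" for j
    using that
  proof (induction j)
    case (Suc j)
    \<comment> \<open>The left preimage of \<open>1\<close> is \<open>1/2\<close>, where the slope
      is at most \<open>3\<close>; hence \<open>96 = 3 * 32\<close>.\<close>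
    have "transfers \<kappa> j g (1/2) / 3 \<le> transfers \<kappa> j g (1/2) / left_slope (\<kappa> j) (1/2)"
      using left_slope_bounds[OF \<kappa>', of "1/2" j] decr_densityD(1)[OF td] by (intro divide_left_mono) auto
    also have "\<dots> \<le> transfers \<kappa> (Suc j) g 1"
      using \<kappa>'[of j] decr_densityD(1)[OF td, of j 1] by (simp add: transfer_def)
    also have "\<dots> < \<alpha> / 96 * M"
      using neg Suc by blast
    finally have "transfers \<kappa> j g (1/2) \<le> \<alpha> / 32 * M" by simp
    moreover have "V (Suc j) \<le> V j - \<alpha> / 16 * M + transfers \<kappa> j g (1/2)"
      using lyapunov_decrease[OF \<alpha> \<kappa> \<xi> td _ bound, of j j] small int
      by (simp add: V_def W_def M_def transfers_mass[OF \<kappa>' g])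
    moreover have "\<alpha> / 16 * M = \<alpha> / 32 * M + \<alpha> / 32 * M" by simp
    moreover have "real (Suc j) * (\<alpha> / 32 * M) = real j * (\<alpha> / 32 * M) + \<alpha> / 32 * M"
      by (simp add: distrib_right)
    ultimately show ?case
      using Suc.IH Suc.prems by linarith
  qed simp
  have "0 \<le> V n"
    unfolding V_def using decr_densityD(1)[OF td] Wb by (intro Bochner_Integration.integral_nonneg) auto
  also have "V n \<le> V 0 - real n * (\<alpha> / 32 * M)" using V by simp
  also have "V 0 \<le> (LBINT x. g x * \<xi> powr - \<alpha>)"
    unfolding V_def transfers.simps
  proof (intro integral_mono integrable_mult_left int)
    show gW: "g x * W x \<le> g x * \<xi> powr - \<alpha>" for x
      using Wb decr_densityD(1)[OF g] by (intro mult_left_mono) auto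
    note [measurable] = decr_density_measurable[OF g]
    show "integrable lborel (\<lambda>x. g x * W x)"
      by (rule Bochner_Integration.integrable_bound[OF integrable_mult_left[OF int, of "\<xi> powr - \<alpha>"]])
         (use Wb decr_densityD(1)[OF g] in \<open>auto simp: abs_mult intro!: mult_left_mono\<close>)
  qed
  also have "\<dots> = \<xi> powr - \<alpha> * M" by (simp add: M_def)
  finally have "M * (real n * \<alpha>) \<le> M * (32 * \<xi> powr - \<alpha>)" by (simp add: algebra_simps)
  then have "real n * \<alpha> \<le> 32 * \<xi> powr - \<alpha>"
    using M by (subst (asm) mult_le_cancel_left_pos) (auto simp: M_def)
  then show False using n \<alpha> by (simp add: field_simps)
qed

text \<open>Why subtracting the common constant works as a coupling: the remainders are decreasing again,
  although they leave the cone.\<close>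

lemma subtract_constant:
  assumes "decr_density g" "c \<le> g 1"
  shows "decr_density (\<lambda>x. g x - c * indicator {0<..1} x)"
proof (rule decr_densityI)
  show "0 \<le> g x - c * indicator {0<..1} x" if "x \<in> {0<..1}" for x
    using decr_densityD(3)[OF assms(1), of x 1] assms(2) that by auto
qed (use decr_densityD[OF assms(1)] in auto)

section \<open>Uniform lower bounds and coupling\<close>

lemma one_cone:
  assumes "0 \<le> \<alpha>"
  shows "cone \<alpha> (indicator {0<..1})"
proof -
  have "1 \<le> 4 * x powr - \<alpha>" if "x \<in> {0<..1}" for x
    using powr_mono2'[of "- \<alpha>" x 1] assms that by simp
  then show ?thesis
    unfolding cone_def by (auto intro!: decr_densityI)
qed

text \<open>Subtracting \<open>c\<close> leaves a decreasing density, and its image is nonnegative;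
  linearity turns this into domination by the image of the constant.\<close>

lemma transfers_lower:
  fixes \<kappa> :: "nat \<Rightarrow> real"
  assumes \<kappa>: "\<And>i. \<kappa> i \<in> {0<..1/2}" and g: "decr_density g" "c \<le> g 1"
  shows "c * transfers \<kappa> n (indicator {0<..1}) x \<le> transfers \<kappa> n g x"
  using decr_densityD(1)[OF transfers_decreasing[of \<kappa>, OF \<kappa> subtract_constant[OF g]], of n x]
  by (simp add: transfers_diff)

text \<open>The right branch alone passes on half of any lower bound. The estimate degenerates with
  \<open>n\<close> and serves for boundedly many steps.\<close>

lemma transfers_one_lower_trivial:
  fixes \<kappa> :: "nat \<Rightarrow> real"
  assumes \<kappa>: "\<And>i. \<kappa> i \<in> {0<..1/2}"
  shows "x \<in> {0<..1} \<Longrightarrow> (1/2) ^ n \<le> transfers \<kappa> n (indicator {0<..1}) x"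
proof (induction n arbitrary: x)
  case (Suc n)
  have "decr_density (transfers \<kappa> n (indicator {0<..1}))"
    using coneD(1)[OF one_cone[of 0]] by (intro transfers_decreasing \<kappa>) auto
  then have "0 \<le> transfers \<kappa> n (indicator {0<..1}) (left_inverse (\<kappa> n) x) / left_slope (\<kappa> n) (left_inverse (\<kappa> n) x)"
    using left_slope_bounds(1)[of "\<kappa> n", OF \<kappa> left_inverse(1)[of "\<kappa> n" x]] Suc.prems \<kappa>[of n]
    by (simp add: decr_densityD(1))
  moreover have "(1/2) ^ n \<le> transfers \<kappa> n (indicator {0<..1}) ((x + 1) / 2)"
    using Suc.IH[of "(x + 1) / 2"] Suc.prems by simp
  ultimately have "(1/2) ^ n / 2 \<le> transfers \<kappa> n (indicator {0<..1}) (left_inverse (\<kappa> n) x) / left_slope (\<kappa> n) (left_inverse (\<kappa> n) x)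
      + transfers \<kappa> n (indicator {0<..1}) ((x + 1) / 2) / 2" by linarith
  then show ?case
    using Suc.prems by (simp add: transfer_def)
qed simp

lemma powr_exponent: "0 < y \<Longrightarrow> \<alpha> < 1 \<Longrightarrow> 8 * ((y / 32) powr (1 / (1 - \<alpha>))) powr (1 - \<alpha>) = y / (4::real)"
  by (simp add: powr_powr)

text \<open>For a late time \<open>n\<close> the argument restarts \<open>J\<close> steps earlier,
  where the image of the constant lies in the cone and again has mass \<open>1\<close>; so one
  \<open>J\<close> works for every \<open>n\<close>. Within these \<open>J\<close> steps the value
  at \<open>1\<close> reaches \<open>\<alpha> / 96\<close> at least once, and each step that remains
  costs at most a factor \<open>1/2\<close>.\<close>

lemma transfers_one_lower:
  fixes \<alpha> :: real
  assumes \<alpha>: "0 < \<alpha>" "\<alpha> < 1/2"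
  obtains c where "0 < c" "c \<le> 1"
    "\<And>\<kappa> n. (\<And>i. \<kappa> i \<in> {0<..\<alpha>}) \<Longrightarrow> c \<le> transfers \<kappa> n (indicator {0<..1}) 1"
proof -
  \<comment> \<open>The cutoff for mass \<open>1\<close>, where
    \<open>8 * \<xi> powr (1 - \<alpha>)\<close> equals \<open>1/4\<close>.\<close>
  define \<xi> :: real where "\<xi> = (1 / 32) powr (1 / (1 - \<alpha>))"
  obtain J :: nat where J: "32 * \<xi> powr - \<alpha> / \<alpha> < real J"
    using reals_Archimedean2 by blast
  define c where "c = \<alpha> / 96 * (1/2) ^ J"
  have c: "0 < c" "c \<le> (1/2) ^ J"
    using \<alpha> by (auto simp: c_def mult_le_cancel_right1)
  have c1: "(1/2::real) ^ J \<le> 1" by (intro power_le_one) auto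
  have lower: "c \<le> transfers \<kappa> n (indicator {0<..1}) 1" if \<kappa>: "\<And>i. \<kappa> i \<in> {0<..\<alpha>}" for \<kappa> n
  proof (cases "n < J")
    case True
    have \<kappa>': "\<kappa> i \<in> {0<..1/2}" for i using \<kappa>[of i] \<alpha> by auto
    have pow: "(1/2::real) ^ J \<le> (1/2) ^ n" using True by (intro power_decreasing) auto
    then show ?thesis
      by (intro order_trans[OF c(2)] order_trans[OF pow] transfers_one_lower_trivial \<kappa>') auto
  next
    case False
    define \<kappa>1 where "\<kappa>1 = (\<lambda>i. \<kappa> (n - J + i))"
    define h where "h = transfers \<kappa> (n - J) (indicator {0<..1})"
    have \<kappa>1: "\<kappa>1 i \<in> {0<..\<alpha>}" "\<kappa>1 i \<in> {0<..1/2}" for i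
      using \<kappa>[of "n - J + i"] \<alpha> by (auto simp: \<kappa>1_def)
    have h: "cone \<alpha> h"
      unfolding h_def using \<alpha> \<kappa> by (intro transfers_cone one_cone) auto
    have "\<exists>j\<le>J. \<alpha> / 96 * (LBINT x. h x) \<le> transfers \<kappa>1 j h 1"
    proof (rule mass_leaves_zero[OF \<alpha> \<kappa>1(1)])
      show "transfers \<kappa>1 j h x \<le> 4 * x powr - \<alpha>" if "x \<in> {0<..1}" for j x
        using coneD(4)[OF transfers_cone[OF \<alpha>(2) \<kappa>1(1) h] that] .
      show "8 * \<xi> powr (1 - \<alpha>) \<le> (LBINT x. h x) / 4"
        using powr_exponent[of 1 \<alpha>] \<alpha> coneD(2)[OF h] by (simp add: \<xi>_def)
    qed (use J coneD[OF h] in \<open>auto simp: \<xi>_def\<close>)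
    then obtain j where j: "j \<le> J" "\<alpha> / 96 \<le> transfers \<kappa>1 j h 1"
      using coneD(2)[OF h] by auto
    define \<kappa>2 where "\<kappa>2 = (\<lambda>i. \<kappa>1 (j + i))"
    have "c \<le> \<alpha> / 96 * (1/2) ^ (J - j)"
      unfolding c_def using \<alpha> by (intro mult_left_mono power_decreasing) auto
    also have "\<dots> \<le> \<alpha> / 96 * transfers \<kappa>2 (J - j) (indicator {0<..1}) 1"
      using \<alpha> \<kappa>1 by (intro mult_left_mono transfers_one_lower_trivial) (auto simp: \<kappa>2_def)
    also have "\<dots> \<le> transfers \<kappa>2 (J - j) (transfers \<kappa>1 j h) 1"
      using \<kappa>1 j coneD(1)[OF h] by (intro transfers_lower transfers_decreasing) (auto simp: \<kappa>2_def)
    also have "\<dots> = transfers \<kappa>1 J h 1"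
      using transfers_add[of \<kappa>1 j "J - j" h] j by (simp add: \<kappa>2_def)
    also have "\<dots> = transfers \<kappa> n (indicator {0<..1}) 1"
      using transfers_add[of \<kappa> "n - J" J "indicator {0<..1}"] False by (simp add: \<kappa>1_def h_def)
    finally show ?thesis .
  qed
  show ?thesis by (rule that[OF c(1) order_trans[OF c(2) c1] lower])
qed

text \<open>\<open>mass_leaves_zero\<close> gives the height only at some time
  \<open>j \<le> n\<close>. From then on the density dominates a constant, whose images stay above a
  multiple of it by \<open>transfers_one_lower\<close>, so the bound persists until time
  \<open>n\<close>. The pointwise bound is assumed for all images because remainders of the coupling
  do not lie in the cone.\<close>

lemma minorization:
  fixes \<alpha> :: real
  assumes \<alpha>: "0 < \<alpha>" "\<alpha> < 1/2"
  obtains \<gamma> where "0 < \<gamma>" "\<gamma> < 1"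
    "\<And>\<kappa> g n. (\<And>i. \<kappa> i \<in> {0<..\<alpha>}) \<Longrightarrow> decr_density g \<Longrightarrow> 0 < (LBINT x. g x) \<Longrightarrow>
      (\<And>j x. x \<in> {0<..1} \<Longrightarrow> transfers \<kappa> j g x \<le> 4 * x powr - \<alpha>) \<Longrightarrow>
      32 * (((LBINT x. g x) / 32) powr (1 / (1 - \<alpha>))) powr - \<alpha> / \<alpha> < real n \<Longrightarrow>
      \<gamma> * (LBINT x. g x) \<le> transfers \<kappa> n g 1"
proof -
  obtain c where c: "0 < c" "c \<le> 1"
    "\<And>\<kappa> n. (\<And>i. \<kappa> i \<in> {0<..\<alpha>}) \<Longrightarrow> c \<le> transfers \<kappa> n (indicator {0<..1}) 1"
    using transfers_one_lower[OF \<alpha>] by blast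
  define \<gamma> where "\<gamma> = \<alpha> / 96 * c"
  have \<gamma>: "\<gamma> \<le> \<alpha> / 96 * 1" "0 < \<gamma>"
    unfolding \<gamma>_def using c \<alpha> by (auto intro!: mult_left_mono)
  have lower: "\<gamma> * (LBINT x. g x) \<le> transfers \<kappa> n g 1"
    if \<kappa>: "\<And>i. \<kappa> i \<in> {0<..\<alpha>}" and g: "decr_density g" and M: "0 < (LBINT x. g x)"
      and bound: "\<And>j x. x \<in> {0<..1} \<Longrightarrow> transfers \<kappa> j g x \<le> 4 * x powr - \<alpha>"
      and n: "32 * (((LBINT x. g x) / 32) powr (1 / (1 - \<alpha>))) powr - \<alpha> / \<alpha> < real n" for \<kappa> g n
  proof -
    let ?M = "LBINT x. g x"
    have \<kappa>': "\<kappa> i \<in> {0<..1/2}" for i using \<kappa>[of i] \<alpha> by auto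
    obtain j where j: "j \<le> n" "\<alpha> / 96 * ?M \<le> transfers \<kappa> j g 1"
      using mass_leaves_zero[OF \<alpha> \<kappa> _ g M bound _ n] powr_exponent[of ?M \<alpha>] M \<alpha> by auto
    define \<kappa>2 where "\<kappa>2 = (\<lambda>i. \<kappa> (j + i))"
    have "\<gamma> * ?M = (\<alpha> / 96 * ?M) * c" by (simp add: \<gamma>_def)
    also have "\<dots> \<le> (\<alpha> / 96 * ?M) * transfers \<kappa>2 (n - j) (indicator {0<..1}) 1"
      using \<alpha> M \<kappa> by (intro mult_left_mono c) (auto simp: \<kappa>2_def)
    also have "\<dots> \<le> transfers \<kappa>2 (n - j) (transfers \<kappa> j g) 1"
      using \<kappa>' j g by (intro transfers_lower transfers_decreasing) (auto simp: \<kappa>2_def)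
    also have "\<dots> = transfers \<kappa> n g 1"
      using transfers_add[of \<kappa> j "n - j" g] j by (simp add: \<kappa>2_def)
    finally show ?thesis .
  qed
  show ?thesis
    by (rule that[OF \<gamma>(2) _ lower]) (use \<gamma> \<alpha> in auto)
qed

text \<open>Time is cut into consecutive blocks, the \<open>k\<close>-th of length
  \<open>N k\<close>, and \<open>l n\<close> is the block containing \<open>n\<close>. Then
  \<open>\<theta> ^ k\<close> is counted \<open>N k\<close> times in the sum over
  \<open>n\<close>.\<close>

lemma level_function:
  fixes \<theta> :: real and N :: "nat \<Rightarrow> nat"
  assumes \<theta>: "0 \<le> \<theta>" and N: "\<And>k. 0 < N k" and summable: "summable (\<lambda>k. \<theta> ^ k * real (N k))"
  obtains l where "summable (\<lambda>n. \<theta> ^ l n)" "\<And>n. (\<Sum>j<l n. N j) \<le> n"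
proof -
  define t where "t = (\<lambda>k. \<Sum>j<k. N j)"
  define l where "l = (\<lambda>n. LEAST k. n < t (Suc k))"
  have t_Suc: "t (Suc k) = t k + N k" for k by (simp add: t_def)
  have t_ge: "k \<le> t k" for k
    by (induction k) (use N in \<open>auto simp: t_Suc Suc_le_eq intro: le_less_trans add_less_le_mono\<close>)
  have t_mono: "mono t" unfolding t_def by (intro monoI sum_mono2) auto
  have l_le: "t (l n) \<le> n" for n
  proof (cases "l n")
    case (Suc k)
    then have "\<not> n < t (Suc k)"
      using not_less_Least[of k "\<lambda>k. n < t (Suc k)"] by (simp add: l_def)
    then show ?thesis using Suc by simp
  qed (simp add: t_def)
  have l_eq: "l n = k" if "t k \<le> n" "n < t (Suc k)" for n k
    unfolding l_def
  proof (rule Least_equality)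
    fix j assume "n < t (Suc j)"
    with that have "t k < t (Suc j)" by simp
    then show "k \<le> j" using monoD[OF t_mono, of "Suc j" k] by (meson not_less not_less_eq_eq)
  qed fact
  have block: "(\<Sum>n<t K. \<theta> ^ l n) = (\<Sum>k<K. \<theta> ^ k * real (N k))" for K
  proof (induction K)
    case (Suc K)
    have "(\<Sum>n<t (Suc K). \<theta> ^ l n) = (\<Sum>n<t K. \<theta> ^ l n) + (\<Sum>n=t K..<t (Suc K). \<theta> ^ l n)"
      by (rule sum.atLeastLessThan_concat[of 0 "t K" "t (Suc K)", unfolded lessThan_atLeast0[symmetric], symmetric])
         (auto simp: t_Suc)
    also have "(\<Sum>n=t K..<t (Suc K). \<theta> ^ l n) = (\<Sum>n=t K..<t (Suc K). \<theta> ^ K)"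
      by (intro sum.cong) (auto simp: l_eq)
    finally show ?case using Suc by (simp add: t_Suc)
  qed (simp add: t_def)
  have "summable (\<lambda>n. \<theta> ^ l n)"
  proof (rule summableI_nonneg_bounded)
    fix n
    have "(\<Sum>i<n. \<theta> ^ l i) \<le> (\<Sum>i<t n. \<theta> ^ l i)"
      using \<theta> t_ge[of n] by (intro sum_mono2) auto
    also have "\<dots> \<le> (\<Sum>k. \<theta> ^ k * real (N k))"
      unfolding block using \<theta> by (intro sum_le_suminf summable) auto
    finally show "(\<Sum>i<n. \<theta> ^ l i) \<le> (\<Sum>k. \<theta> ^ k * real (N k))" .
  qed (use \<theta> in auto)
  then show ?thesis using that l_le by (simp add: t_def)
qed

text \<open>After \<open>k\<close> blocks the two images differ only by remainders of mass
  \<open>\<theta> ^ k\<close>. A test function bounded by \<open>1\<close> sees nothing else, which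
  gives the bound \<open>2 * \<theta> ^ l n\<close>.\<close>

lemma loss_of_memory_cone:
  fixes \<alpha> :: real
  assumes \<alpha>: "0 < \<alpha>" "\<alpha> < 1/2"
  obtains D :: "nat \<Rightarrow> real" where "summable D"
    "\<And>\<kappa> g1 g2 \<phi> n. (\<And>i. \<kappa> i \<in> {0<..\<alpha>}) \<Longrightarrow> cone \<alpha> g1 \<Longrightarrow> cone \<alpha> g2 \<Longrightarrow>
      \<phi> \<in> borel_measurable borel \<Longrightarrow> (\<And>x. \<bar>\<phi> x\<bar> \<le> 1) \<Longrightarrow>
      \<bar>(LBINT x. g1 x * \<phi> (orbit \<kappa> n x)) - (LBINT x. g2 x * \<phi> (orbit \<kappa> n x))\<bar> \<le> D n"
proof -
  obtain \<gamma> where \<gamma>: "0 < \<gamma>" "\<gamma> < 1" and minor: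
    "\<And>\<kappa> g n. (\<And>i. \<kappa> i \<in> {0<..\<alpha>}) \<Longrightarrow> decr_density g \<Longrightarrow> 0 < (LBINT x. g x) \<Longrightarrow>
      (\<And>j x. x \<in> {0<..1} \<Longrightarrow> transfers \<kappa> j g x \<le> 4 * x powr - \<alpha>) \<Longrightarrow>
      32 * (((LBINT x. g x) / 32) powr (1 / (1 - \<alpha>))) powr - \<alpha> / \<alpha> < real n \<Longrightarrow>
      \<gamma> * (LBINT x. g x) \<le> transfers \<kappa> n g 1"
    using minorization[OF \<alpha>] by blast
  define \<theta> where "\<theta> = 1 - \<gamma>"
  have \<theta>: "0 < \<theta>" "\<theta> < 1" using \<gamma> by (auto simp: \<theta>_def)
  define A where "A = (\<lambda>k. 32 * ((\<theta> ^ k / 32) powr (1 / (1 - \<alpha>))) powr - \<alpha> / \<alpha>)"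
  \<comment> \<open>The successor makes \<open>A k < N k\<close> strict, as
    \<open>minorization\<close> requires, and every block nonempty, as \<open>level_function\<close>
    requires.\<close>
  define N where "N = (\<lambda>k. Suc (nat \<lceil>A k\<rceil>))"
  have A0: "0 \<le> A k" for k using \<alpha> by (simp add: A_def)
  have N: "A k < real (N k)" "real (N k) \<le> A k + 2" for k
    using A0[of k] by (auto simp: N_def) linarith+
  \<comment> \<open>A block of about \<open>\<theta> powr (- k * r)\<close> steps reduces the uncoupled mass from \<open>\<theta> ^ k\<close> to \<open>\<theta> ^ Suc k\<close>;
    the times these masses sum up since \<open>r < 1\<close>, which is where \<open>\<alpha> < 1/2\<close> is essential.\<close>
  define r where "r = \<alpha> / (1 - \<alpha>)"
  have r: "0 < r" "r < 1" using \<alpha> by (auto simp: r_def)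
  define \<rho> where "\<rho> = \<theta> powr (1 - r)"
  have \<rho>: "0 < \<rho>" "\<rho> < 1"
    using \<theta> r powr_less_mono2[of "1 - r" \<theta> 1] by (auto simp: \<rho>_def)
  have A_eq: "\<theta> ^ k * A k = 32 powr (1 + r) / \<alpha> * \<rho> ^ k" for k
  proof -
    have "((\<theta> ^ k / 32) powr (1 / (1 - \<alpha>))) powr - \<alpha> = (\<theta> ^ k / 32) powr - r"
      by (simp add: powr_powr r_def)
    also have "\<dots> = (\<theta> ^ k) powr - r * 32 powr r"
      using \<theta> by (simp add: powr_divide powr_minus field_simps)
    finally have "\<theta> ^ k * A k = (\<theta> ^ k * (\<theta> ^ k) powr - r) * (32 * 32 powr r) / \<alpha>"
      by (simp add: A_def)
    also have "\<theta> ^ k * (\<theta> ^ k) powr - r = (\<theta> ^ k) powr (1 - r)"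
      using \<theta> by (simp add: powr_diff powr_minus divide_inverse)
    also have "\<dots> = \<rho> ^ k"
      using \<theta> by (simp add: \<rho>_def powr_powr mult.commute flip: powr_realpow)
    also have "32 * 32 powr r = 32 powr (1 + r)"
      by (simp add: powr_add)
    finally show ?thesis by simp
  qed
  have "summable (\<lambda>k. 32 powr (1 + r) / \<alpha> * \<rho> ^ k + 2 * \<theta> ^ k)"
    using \<rho> \<theta> by (intro summable_add summable_mult summable_geometric) auto
  then have summable_N: "summable (\<lambda>k. \<theta> ^ k * real (N k))"
  proof (rule summable_comparison_test[rotated], intro exI allI impI)
    fix k
    have "\<theta> ^ k * real (N k) \<le> \<theta> ^ k * (A k + 2)"
      using N \<theta> by (intro mult_left_mono) auto
    then show "norm (\<theta> ^ k * real (N k)) \<le> 32 powr (1 + r) / \<alpha> * \<rho> ^ k + 2 * \<theta> ^ k"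
      using \<theta> A_eq[of k] by (simp add: algebra_simps)
  qed
  obtain l where l: "summable (\<lambda>n. \<theta> ^ l n)" "\<And>n. (\<Sum>j<l n. N j) \<le> n"
    using level_function[of \<theta> N] \<theta> summable_N by (auto simp: N_def)
  \<comment> \<open>Staying below the full images is how the remainders keep the bound
    \<open>4 * x powr - \<alpha>\<close>. The same function is removed from both sides, so the
    difference of the remainders remains the full difference.\<close>
  have coupling: "\<exists>r1 r2. decr_density r1 \<and> decr_density r2
      \<and> (LBINT x. r1 x) = \<theta> ^ k \<and> (LBINT x. r2 x) = \<theta> ^ k
      \<and> (\<forall>x\<in>{0<..1}. r1 x \<le> transfers \<kappa> (\<Sum>j<k. N j) g1 x \<and> r2 x \<le> transfers \<kappa> (\<Sum>j<k. N j) g2 x)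
      \<and> (\<forall>x. r1 x - r2 x = transfers \<kappa> (\<Sum>j<k. N j) g1 x - transfers \<kappa> (\<Sum>j<k. N j) g2 x)"
    if \<kappa>: "\<And>i. \<kappa> i \<in> {0<..\<alpha>}" and g: "cone \<alpha> g1" "cone \<alpha> g2" for \<kappa> g1 g2 k
  proof (induction k)
    case 0
    then show ?case using coneD[OF g(1)] coneD[OF g(2)] by auto
  next
    case (Suc k)
    define s where "s = (\<Sum>j<k. N j)"
    define \<kappa>1 where "\<kappa>1 = (\<lambda>i. \<kappa> (s + i))"
    have \<kappa>1: "\<kappa>1 i \<in> {0<..\<alpha>}" "\<kappa>1 i \<in> {0<..1/2}" for i
      using \<kappa>[of "s + i"] \<alpha> by (auto simp: \<kappa>1_def)
    define u where "u = (\<lambda>r x. transfers \<kappa>1 (N k) r x - \<gamma> * \<theta> ^ k * indicator {0<..1} x)"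
    have u: "decr_density (u r)" "(LBINT x. u r x) = \<theta> ^ Suc k"
        "\<And>x. x \<in> {0<..1} \<Longrightarrow> u r x \<le> transfers \<kappa> (s + N k) g x"
      if r: "decr_density r" "(LBINT x. r x) = \<theta> ^ k" and g: "cone \<alpha> g"
        and le: "\<And>x. x \<in> {0<..1} \<Longrightarrow> r x \<le> transfers \<kappa> s g x" for r g
    proof -
      have mass: "0 < (LBINT x. r x)" using r \<theta> by simp
      have bound: "transfers \<kappa>1 j r x \<le> 4 * x powr - \<alpha>" if x: "x \<in> {0<..1}" for j x
      proof -
        have "transfers \<kappa>1 j r x \<le> transfers \<kappa>1 j (transfers \<kappa> s g) x"
          by (intro transfers_mono le x \<kappa>1)
        also have "\<dots> \<le> 4 * x powr - \<alpha>"
          using \<alpha> \<kappa> \<kappa>1 g x by (intro coneD(4)[of \<alpha>] transfers_cone) auto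
        finally show ?thesis .
      qed
      have "\<gamma> * \<theta> ^ k \<le> transfers \<kappa>1 (N k) r 1"
        using minor[OF \<kappa>1(1) r(1) mass bound] N(1)[of k] r(2) by (simp add: A_def)
      then show "decr_density (u r)"
        unfolding u_def using r \<kappa>1 by (intro subtract_constant transfers_decreasing) auto
      have "integrable lborel r"
        using mass not_integrable_integral_eq[of lborel r] by force
      then have "integrable lborel (transfers \<kappa>1 (N k) r)" "(LBINT x. transfers \<kappa>1 (N k) r x) = \<theta> ^ k"
        using transfers_mass[of \<kappa>1, OF \<kappa>1(2) r(1)] r(2) by simp_all
      then have "(LBINT x. u r x) = \<theta> ^ k - \<gamma> * \<theta> ^ k"
        unfolding u_def by (subst Bochner_Integration.integral_diff) (auto intro!: integrable_mult_right integrable_real_indicator)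
      then show "(LBINT x. u r x) = \<theta> ^ Suc k"
        by (simp add: \<theta>_def algebra_simps)
      fix x :: real assume x: "x \<in> {0<..1}"
      have "u r x \<le> transfers \<kappa>1 (N k) r x"
        using \<gamma> \<theta> by (simp add: u_def)
      also have "\<dots> \<le> transfers \<kappa>1 (N k) (transfers \<kappa> s g) x"
        by (intro transfers_mono le x \<kappa>1)
      finally show "u r x \<le> transfers \<kappa> (s + N k) g x"
        by (simp add: transfers_add \<kappa>1_def)
    qed
    obtain r1 r2 where r: "decr_density r1" "decr_density r2"
      "(LBINT x. r1 x) = \<theta> ^ k" "(LBINT x. r2 x) = \<theta> ^ k"
      "\<And>x. x \<in> {0<..1} \<Longrightarrow> r1 x \<le> transfers \<kappa> s g1 x" "\<And>x. x \<in> {0<..1} \<Longrightarrow> r2 x \<le> transfers \<kappa> s g2 x"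
      "\<And>x. r1 x - r2 x = transfers \<kappa> s g1 x - transfers \<kappa> s g2 x"
      using Suc unfolding s_def by blast
    \<comment> \<open>The factor \<open>1\<close> brings both differences into the form of
      \<open>transfers_diff\<close>.\<close>
    have "(\<lambda>x. r1 x - 1 * r2 x) = (\<lambda>x. transfers \<kappa> s g1 x - 1 * transfers \<kappa> s g2 x)"
      using r(7) by simp
    then have "transfers \<kappa>1 (N k) (\<lambda>x. r1 x - 1 * r2 x) =
        transfers \<kappa>1 (N k) (\<lambda>x. transfers \<kappa> s g1 x - 1 * transfers \<kappa> s g2 x)"
      by (rule arg_cong)
    then have "u r1 x - u r2 x = transfers \<kappa> (s + N k) g1 x - transfers \<kappa> (s + N k) g2 x" for x
      unfolding transfers_diff by (simp add: u_def transfers_add \<kappa>1_def fun_eq_iff)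
    then show ?case
      using u[OF r(1,3) g(1) r(5)] u[OF r(2,4) g(2) r(6)]
      by (intro exI[of _ "u r1"] exI[of _ "u r2"]) (simp add: s_def)
  qed
  have "\<bar>(LBINT x. g1 x * \<phi> (orbit \<kappa> n x)) - (LBINT x. g2 x * \<phi> (orbit \<kappa> n x))\<bar> \<le> 2 * \<theta> ^ l n"
    if \<kappa>: "\<And>i. \<kappa> i \<in> {0<..\<alpha>}" and g: "cone \<alpha> g1" "cone \<alpha> g2"
      and \<phi> [measurable]: "\<phi> \<in> borel_measurable borel" and \<phi>1: "\<And>x. \<bar>\<phi> x\<bar> \<le> 1" for \<kappa> g1 g2 \<phi> n
  proof -
    define s where "s = (\<Sum>j<l n. N j)"
    have sn: "n = s + (n - s)" using l(2)[of n] by (simp add: s_def)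
    have \<kappa>': "\<kappa> i \<in> {0<..1/2}" for i using \<kappa>[of i] \<alpha> by auto
    \<comment> \<open>The steps after the last complete block are moved into the test
      function.\<close>
    define \<psi> where "\<psi> = (\<lambda>x. \<phi> (orbit (\<lambda>i. \<kappa> (s + i)) (n - s) x))"
    have \<psi> [measurable]: "\<psi> \<in> borel_measurable borel" by (simp add: \<psi>_def)
    have \<psi>1: "\<bar>\<psi> x\<bar> \<le> 1" for x by (simp add: \<psi>_def \<phi>1)
    have orb: "\<phi> (orbit \<kappa> n x) = \<psi> (orbit \<kappa> s x)" for x
      by (subst sn) (simp add: orbit_add \<psi>_def)
    have int: "integrable lborel (\<lambda>x. h x * \<psi> x)" if "decr_density h" "integrable lborel h" for h
      using decr_density_measurable[OF that(1)] \<psi>1 decr_densityD(1)[OF that(1)]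
      by (intro Bochner_Integration.integrable_bound[OF that(2)])
         (auto simp: abs_mult mult_left_le)
    obtain r1 r2 where r: "decr_density r1" "decr_density r2"
      "(LBINT x. r1 x) = \<theta> ^ l n" "(LBINT x. r2 x) = \<theta> ^ l n"
      "\<And>x. r1 x - r2 x = transfers \<kappa> s g1 x - transfers \<kappa> s g2 x"
      using coupling[of \<kappa>, OF \<kappa> g, of "l n"] unfolding s_def by blast
    have ri: "integrable lborel r1" "integrable lborel r2"
      using r(3,4) \<theta> not_integrable_integral_eq[of lborel r1] not_integrable_integral_eq[of lborel r2] by force+
    have small: "\<bar>LBINT x. h x * \<psi> x\<bar> \<le> \<theta> ^ l n"
      if h: "decr_density h" "integrable lborel h" "(LBINT x. h x) = \<theta> ^ l n" for h
    proof -
      have "\<bar>LBINT x. h x * \<psi> x\<bar> \<le> (LBINT x. \<bar>h x * \<psi> x\<bar>)"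
        using integral_abs_bound .
      also have "\<dots> \<le> (LBINT x. h x)"
        using \<psi>1 decr_densityD(1)[OF h(1)]
        by (intro integral_mono integrable_abs int h) (auto simp: abs_mult mult_left_le)
      finally show ?thesis using h(3) by simp
    qed
    have tc: "cone \<alpha> (transfers \<kappa> s g1)" "cone \<alpha> (transfers \<kappa> s g2)"
      using \<alpha> \<kappa> g by (auto intro: transfers_cone)
    have "(LBINT x. g1 x * \<phi> (orbit \<kappa> n x)) - (LBINT x. g2 x * \<phi> (orbit \<kappa> n x))
        = (LBINT x. transfers \<kappa> s g1 x * \<psi> x) - (LBINT x. transfers \<kappa> s g2 x * \<psi> x)"
      using transfers_integral(1)[of \<kappa>, OF \<kappa>' coneD(1)[OF g(1)] \<psi>, of s]
        transfers_integral(1)[of \<kappa>, OF \<kappa>' coneD(1)[OF g(2)] \<psi>, of s]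
      by (simp add: orb)
    also have "\<dots> = (LBINT x. (transfers \<kappa> s g1 x - transfers \<kappa> s g2 x) * \<psi> x)"
      using int[OF coneD(1,3)[OF tc(1)]] int[OF coneD(1,3)[OF tc(2)]] by (simp add: left_diff_distrib)
    also have "\<dots> = (LBINT x. r1 x * \<psi> x) - (LBINT x. r2 x * \<psi> x)"
      using int[OF r(1) ri(1)] int[OF r(2) ri(2)] by (simp add: left_diff_distrib flip: r(5))
    finally show ?thesis
      using small[OF r(1) ri(1) r(3)] small[OF r(2) ri(2) r(4)] by linarith
  qed
  then show ?thesis
    using that[of "\<lambda>n. 2 * \<theta> ^ l n"] summable_mult[OF l(1), of 2] \<theta> by auto
qed

text \<open>Normalised by the constant \<open>K\<close> of the pointwise bound instead of the mass,
  so that densities outside the cone can be compared. Quantifying over all parameter sequences lets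
  one \<open>D\<close> serve every fibre and every \<open>\<epsilon>\<close>.\<close>

definition memory_rate :: "real \<Rightarrow> (nat \<Rightarrow> real) \<Rightarrow> bool" where
  "memory_rate \<alpha> D \<longleftrightarrow> (\<forall>\<kappa> K g1 g2 \<phi> n.
     (\<forall>i. \<kappa> i \<in> {0<..\<alpha>}) \<longrightarrow> 0 < K \<longrightarrow> decr_density g1 \<longrightarrow> decr_density g2 \<longrightarrow>
     (LBINT x. g1 x) = (LBINT x. g2 x) \<longrightarrow>
     (\<forall>x\<in>{0<..1}. g1 x \<le> K * x powr - \<alpha> \<and> g2 x \<le> K * x powr - \<alpha>) \<longrightarrow>
     \<phi> \<in> borel_measurable borel \<longrightarrow> (\<forall>x. \<bar>\<phi> x\<bar> \<le> 1) \<longrightarrow>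
     \<bar>(LBINT x. g1 x * \<phi> (orbit \<kappa> n x)) - (LBINT x. g2 x * \<phi> (orbit \<kappa> n x))\<bar> \<le> K * D n)"

lemma memory_rateD:
  assumes "memory_rate \<alpha> D" "\<And>i. \<kappa> i \<in> {0<..\<alpha>}" "0 < K" "decr_density g1" "decr_density g2"
    "(LBINT x. g1 x) = (LBINT x. g2 x)"
    "\<And>x. x \<in> {0<..1} \<Longrightarrow> g1 x \<le> K * x powr - \<alpha>" "\<And>x. x \<in> {0<..1} \<Longrightarrow> g2 x \<le> K * x powr - \<alpha>"
    "\<phi> \<in> borel_measurable borel" "\<And>x. \<bar>\<phi> x\<bar> \<le> 1"
  shows "\<bar>(LBINT x. g1 x * \<phi> (orbit \<kappa> n x)) - (LBINT x. g2 x * \<phi> (orbit \<kappa> n x))\<bar> \<le> K * D n"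
  using assms unfolding memory_rate_def by blast

lemma summable_memory_rate:
  fixes \<alpha> :: real
  assumes \<alpha>: "0 < \<alpha>" "\<alpha> < 1/2"
  shows "\<exists>D. summable D \<and> memory_rate \<alpha> D"
proof -
  obtain D :: "nat \<Rightarrow> real" where D: "summable D"
    "\<And>\<kappa> g1 g2 \<phi> n. (\<And>i. \<kappa> i \<in> {0<..\<alpha>}) \<Longrightarrow> cone \<alpha> g1 \<Longrightarrow> cone \<alpha> g2 \<Longrightarrow>
      \<phi> \<in> borel_measurable borel \<Longrightarrow> (\<And>x. \<bar>\<phi> x\<bar> \<le> 1) \<Longrightarrow>
      \<bar>(LBINT x. g1 x * \<phi> (orbit \<kappa> n x)) - (LBINT x. g2 x * \<phi> (orbit \<kappa> n x))\<bar> \<le> D n"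
    using loss_of_memory_cone[OF \<alpha>] by blast
  have main: "\<bar>(LBINT x. g1 x * \<phi> (orbit \<kappa> n x)) - (LBINT x. g2 x * \<phi> (orbit \<kappa> n x))\<bar> \<le> K * (2 * D n)"
    if \<kappa>: "\<And>i. \<kappa> i \<in> {0<..\<alpha>}" and K: "0 < K" and g1: "decr_density g1" and g2: "decr_density g2"
      and eq: "(LBINT x. g1 x) = (LBINT x. g2 x)"
      and b1: "\<And>x. x \<in> {0<..1} \<Longrightarrow> g1 x \<le> K * x powr - \<alpha>"
      and b2: "\<And>x. x \<in> {0<..1} \<Longrightarrow> g2 x \<le> K * x powr - \<alpha>"
      and \<phi> [measurable]: "\<phi> \<in> borel_measurable borel" and \<phi>1: "\<And>x. \<bar>\<phi> x\<bar> \<le> 1"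
    for \<kappa> K g1 g2 \<phi> n
  proof -
    let ?I = "\<lambda>g. LBINT x. g x * \<phi> (orbit \<kappa> n x)"
    \<comment> \<open>Adding the same constant to both densities does not change the difference of the integrals,
      and it makes their common mass large enough for the cone after normalisation.\<close>
    define c where "c = 2 * K - (LBINT x. g1 x)"
    define u where "u = (\<lambda>(g :: real \<Rightarrow> real) x. (g x + c * indicator {0<..1} x) / (2 * K))"
    let ?p = "\<lambda>x. K * (indicator {0<..1} x * x powr - \<alpha>)"
    have p: "integrable lborel ?p" "(LBINT x. ?p x) \<le> 2 * K"
    proof -
      \<comment> \<open>Since \<open>1 / (1 - \<alpha>) \<le> 2\<close>, the mass is at most
        \<open>2 * K\<close>, which makes the added constant \<open>c\<close> nonnegative.\<close>
      have "K * (1 / (1 - \<alpha>)) \<le> K * 2"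
        using K \<alpha> by (intro mult_left_mono) (auto simp: divide_le_eq)
      then show "integrable lborel ?p" "(LBINT x. ?p x) \<le> 2 * K"
        using powr_neg_integral[of \<alpha> 1] \<alpha> by auto
    qed
    have le_p: "g x \<le> ?p x"
      if g: "decr_density g" and b: "\<And>x. x \<in> {0<..1} \<Longrightarrow> g x \<le> K * x powr - \<alpha>" for g x
      using b[of x] decr_densityD(2)[OF g, of x] by (auto split: split_indicator)
    have int: "integrable lborel g"
      if g: "decr_density g" and b: "\<And>x. x \<in> {0<..1} \<Longrightarrow> g x \<le> K * x powr - \<alpha>" for g
      using le_p[OF that] decr_densityD(1)[OF g] decr_density_measurable[OF g]
      by (intro Bochner_Integration.integrable_bound[OF p(1)]) (auto intro!: AE_I2 order_trans[OF _ abs_ge_self])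
    have "(LBINT x. g1 x) \<le> (LBINT x. ?p x)"
      by (intro integral_mono int g1 b1 p le_p)
    moreover have "0 \<le> (LBINT x. g1 x)"
      using decr_densityD(1)[OF g1] by (intro Bochner_Integration.integral_nonneg) auto
    ultimately have c: "0 \<le> c" "c \<le> 2 * K"
      using p(2) by (auto simp: c_def)
    have u: "cone \<alpha> (u g)"
      if g: "decr_density g" and m: "(LBINT x. g x) = (LBINT x. g1 x)"
        and b: "\<And>x. x \<in> {0<..1} \<Longrightarrow> g x \<le> K * x powr - \<alpha>" for g
      unfolding cone_def
    proof (intro conjI ballI)
      show "decr_density (u g)"
        using decr_densityD[OF g] c K
        by (intro decr_densityI) (auto simp: u_def intro!: divide_right_mono)
      have "(LBINT x. u g x) = ((LBINT x. g x) + c) / (2 * K)"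
        unfolding u_def using int[OF g b]
        by (subst integral_divide_zero, subst Bochner_Integration.integral_add)
           (auto intro!: integrable_mult_right integrable_real_indicator)
      then show "(LBINT x. u g x) = 1"
        using K by (simp add: m c_def)
      fix x :: real assume x: "x \<in> {0<..1}"
      have x1: "1 \<le> x powr - \<alpha>"
        using powr_mono2'[of "- \<alpha>" x 1] \<alpha> x by simp
      have "u g x \<le> (K * x powr - \<alpha> + 2 * K) / (2 * K)"
        unfolding u_def using b[OF x] c K x by (intro divide_right_mono add_mono) auto
      also have "\<dots> = x powr - \<alpha> / 2 + 1"
        using K by (simp add: field_simps)
      also have "\<dots> \<le> 4 * x powr - \<alpha>" using x1 by linarith
      finally show "u g x \<le> 4 * x powr - \<alpha>" .
    qed
    have iphi: "integrable lborel (\<lambda>x. h x * \<phi> (orbit \<kappa> n x))" if "integrable lborel h" for h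
    proof -
      have [measurable]: "h \<in> borel_measurable borel"
        using borel_measurable_integrable[OF that] by simp
      show ?thesis
        using \<phi>1 by (intro Bochner_Integration.integrable_bound[OF that]) (auto simp: abs_mult mult_left_le)
    qed
    have ui: "?I (u g) =
        (?I g + (LBINT x. c * indicator {0<..1} x * \<phi> (orbit \<kappa> n x))) / (2 * K)"
      if "integrable lborel g" for g
    proof -
      have "?I (u g) =
         (LBINT x. (g x * \<phi> (orbit \<kappa> n x) + c * indicator {0<..1} x * \<phi> (orbit \<kappa> n x)) / (2 * K))"
        by (simp add: u_def distrib_right)
      then show ?thesis
        using iphi[OF that] iphi[of "\<lambda>x. c * indicator {0<..1} x"]
        by (simp add: integral_divide_zero)
    qed
    have "\<bar>?I (u g1) - ?I (u g2)\<bar> \<le> D n"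
      using u[OF g1 refl b1] u[OF g2 eq[symmetric] b2] by (intro D(2) \<kappa> \<phi> \<phi>1) auto
    then have "\<bar>(?I g1 - ?I g2) / (2 * K)\<bar> \<le> D n"
      using ui[OF int[OF g1 b1]] ui[OF int[OF g2 b2]] by (simp add: diff_divide_distrib add_divide_distrib)
    then show ?thesis using K by (simp add: abs_divide divide_le_eq mult_ac)
  qed
  have "memory_rate \<alpha> (\<lambda>n. 2 * D n)"
    unfolding memory_rate_def
  proof (intro allI impI)
    fix \<kappa> :: "nat \<Rightarrow> real" and K :: real and g1 g2 \<phi> :: "real \<Rightarrow> real" and n :: nat
    assume "\<forall>i. \<kappa> i \<in> {0<..\<alpha>}" "0 < K" "decr_density g1" "decr_density g2"
      "(LBINT x. g1 x) = (LBINT x. g2 x)"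
      "\<forall>x\<in>{0<..1}. g1 x \<le> K * x powr - \<alpha> \<and> g2 x \<le> K * x powr - \<alpha>"
      "\<phi> \<in> borel_measurable borel" "\<forall>x. \<bar>\<phi> x\<bar> \<le> 1"
    then show "\<bar>(LBINT x. g1 x * \<phi> (orbit \<kappa> n x)) - (LBINT x. g2 x * \<phi> (orbit \<kappa> n x))\<bar> \<le> K * (2 * D n)"
      by (intro main) auto
  qed
  then show ?thesis
    using D(1) by (intro exI[of _ "\<lambda>n. 2 * D n"]) (simp add: summable_mult)
qed

section \<open>Decorrelation with respect to Lebesgue measure on the unit interval\<close>

abbreviation unit_leb :: "real measure" where
  "unit_leb \<equiv> restrict_space lborel {0..1}"

lemma sets_unit_leb [measurable_cong]: "sets unit_leb = sets unit_borel"
  by (intro sets_restrict_space_cong) simp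

lemma space_unit [simp]: "space unit_leb = {0..1}" "space unit_borel = {0..1}"
  by (simp_all add: space_restrict_space)

lemma prob_space_unit_leb: "prob_space unit_leb"
  by (intro prob_spaceI) (simp add: emeasure_restrict_space)

lemma unit_leb_integral:
  fixes f :: "real \<Rightarrow> real"
  assumes [measurable]: "f \<in> borel_measurable borel"
  shows "(LINT x|unit_leb. f x) = (LBINT x. indicator {0<..1} x * f x)"
proof -
  have "(LINT x|unit_leb. f x) = (LBINT x. indicator {0..1} x *\<^sub>R f x)"
    by (intro integral_restrict_space) simp
  also have "\<dots> = (LBINT x. indicator {0<..1} x * f x)"
    using AE_lborel_singleton[of 0]
    by (intro integral_cong_AE) (auto split: split_indicator elim!: eventually_mono)
  finally show ?thesis .
qed

text \<open>\<open>memory_rate\<close> tests with functions that are Borel and bounded by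
  \<open>1\<close> on the whole line, while observables are controlled on the unit interval
  only.\<close>

definition extend_unit :: "(real \<Rightarrow> real) \<Rightarrow> real \<Rightarrow> real" where
  "extend_unit \<phi> x = indicator {0..1} x * \<phi> x"

lemma extend_unit [simp]: "x \<in> {0..1} \<Longrightarrow> extend_unit \<phi> x = \<phi> x"
  by (simp add: extend_unit_def)

lemma extend_unit_measurable [measurable]:
  assumes "\<phi> \<in> borel_measurable unit_borel"
  shows "extend_unit \<phi> \<in> borel_measurable borel"
  using assms by (subst (asm) borel_measurable_restrict_space_iff) (auto simp: extend_unit_def[abs_def])

text \<open>Loss of memory speaks about decreasing densities, and indicators of initial intervals
  are decreasing. The covariance is linear in \<open>g\<close> and at most twice the L1 norm of
  \<open>g\<close>, uniformly in \<open>k\<close>; so its convergence to \<open>0\<close> survives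
  disjoint unions and dominated limits and reaches every integrable \<open>g\<close>, at the price
  of the rate.\<close>

lemma decorrelation_from_intervals:
  fixes \<psi> :: "nat \<Rightarrow> real \<Rightarrow> real"
  assumes \<psi> [measurable]: "\<And>k. \<psi> k \<in> borel_measurable unit_borel"
    and \<psi>1: "\<And>k x. x \<in> {0..1} \<Longrightarrow> \<bar>\<psi> k x\<bar> \<le> 1"
    and interval: "\<And>a. (\<lambda>k. (LINT x|unit_leb. indicator {..a} x * \<psi> k x)
       - (LINT x|unit_leb. indicator {..a} x) * (LINT x|unit_leb. \<psi> k x)) \<longlonglongrightarrow> 0"
    and g: "integrable unit_leb g"
  shows "(\<lambda>k. (LINT x|unit_leb. g x * \<psi> k x)
       - (LINT x|unit_leb. g x) * (LINT x|unit_leb. \<psi> k x)) \<longlonglongrightarrow> 0"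
proof -
  let ?U = unit_leb
  interpret U: prob_space ?U by (rule prob_space_unit_leb)
  define cov where "cov = (\<lambda>g k. (LINT x|?U. g x * \<psi> k x)
       - (LINT x|?U. g x) * (LINT x|?U. \<psi> k x))"
  have pU: "measure ?U {0..1} = 1"
    using U.prob_space by simp
  have \<psi>i: "integrable ?U (\<psi> k)" for k
    using \<psi>1 by (intro U.integrable_const_bound[of _ 1]) (auto intro!: AE_I2)
  have g\<psi>i: "integrable ?U (\<lambda>x. g x * \<psi> k x)" if g: "integrable ?U g" for g k
    using \<psi>1 borel_measurable_integrable[OF g]
    by (intro Bochner_Integration.integrable_bound[OF g]) (auto simp: abs_mult intro!: AE_I2 mult_left_le)
  have \<psi>b: "\<bar>LINT x|?U. \<psi> k x\<bar> \<le> 1" for k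
  proof -
    have "\<bar>LINT x|?U. \<psi> k x\<bar> \<le> (LINT x|?U. \<bar>\<psi> k x\<bar>)"
      by (rule integral_abs_bound)
    also have "\<dots> \<le> (LINT x|?U. 1)"
      using \<psi>1 by (intro integral_mono integrable_abs \<psi>i) auto
    finally show ?thesis by (simp add: pU)
  qed
  have cov_bound: "\<bar>cov g k\<bar> \<le> 2 * (LINT x|?U. \<bar>g x\<bar>)" if g: "integrable ?U g" for g k
  proof -
    have "\<bar>LINT x|?U. g x * \<psi> k x\<bar> \<le> (LINT x|?U. \<bar>g x * \<psi> k x\<bar>)"
      by (rule integral_abs_bound)
    also have "\<dots> \<le> (LINT x|?U. \<bar>g x\<bar>)"
      using \<psi>1 by (intro integral_mono integrable_abs g g\<psi>i) (auto simp: abs_mult intro!: mult_left_le)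
    finally have 1: "\<bar>LINT x|?U. g x * \<psi> k x\<bar> \<le> (LINT x|?U. \<bar>g x\<bar>)" .
    have "\<bar>(LINT x|?U. g x) * (LINT x|?U. \<psi> k x)\<bar> \<le> (LINT x|?U. \<bar>g x\<bar>) * 1"
      unfolding abs_mult by (intro mult_mono integral_abs_bound \<psi>b) auto
    with 1 show ?thesis unfolding cov_def by linarith
  qed
  have cov_add: "cov (\<lambda>x. f x + g x) k = cov f k + cov g k"
    if "integrable ?U f" "integrable ?U g" for f g k
    using g\<psi>i[OF that(1)] g\<psi>i[OF that(2)] that by (simp add: cov_def distrib_right)
  have cov_cmult: "cov (\<lambda>x. c * f x) k = c * cov f k" for c f k
    by (simp add: cov_def mult.assoc right_diff_distrib)
  \<comment> \<open>\<open>cov_bound\<close> does not depend on \<open>k\<close>, so a single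
    \<open>s i\<close> close to \<open>f\<close> in L1 controls all \<open>k\<close> at
    once.\<close>
  have cov_lim: "cov f \<longlonglongrightarrow> 0"
    if s: "\<And>i. integrable ?U (s i)" "\<And>i. cov (s i) \<longlonglongrightarrow> 0"
      "\<And>x. x \<in> {0..1} \<Longrightarrow> (\<lambda>i. s i x) \<longlonglongrightarrow> f x"
      "\<And>i x. x \<in> {0..1} \<Longrightarrow> \<bar>s i x\<bar> \<le> w x" "integrable ?U w" "integrable ?U f"
    for s :: "nat \<Rightarrow> real \<Rightarrow> real" and f w
  proof (rule LIMSEQ_I)
    fix e :: real assume e: "0 < e"
    have fw: "\<bar>f x\<bar> \<le> w x" if "x \<in> {0..1}" for x
      using tendsto_rabs[OF s(3)[OF that]] s(4)[OF that] by (intro LIMSEQ_le_const2) auto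
    have "(\<lambda>i. LINT x|?U. \<bar>f x - s i x\<bar>) \<longlonglongrightarrow> (LINT x|?U. 0)"
    proof (rule integral_dominated_convergence[where w="\<lambda>x. 2 * w x"])
      show "AE x in ?U. (\<lambda>i. \<bar>f x - s i x\<bar>) \<longlonglongrightarrow> 0"
        using s(3) by (intro AE_I2) (auto intro!: tendsto_rabs_zero tendsto_eq_intros)
      show "AE x in ?U. norm \<bar>f x - s i x\<bar> \<le> 2 * w x" for i
      proof (intro AE_I2)
        fix x assume "x \<in> space ?U"
        then show "norm \<bar>f x - s i x\<bar> \<le> 2 * w x" using fw[of x] s(4)[of x i] by simp
      qed
    qed (use s in \<open>auto intro!: borel_measurable_integrable\<close>)
    then have "\<forall>\<^sub>F i in sequentially. (LINT x|?U. \<bar>f x - s i x\<bar>) < e / 4"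
      using e by (intro order_tendstoD(2)) auto
    then obtain i where "(LINT x|?U. \<bar>f x - s i x\<bar>) < e / 4"
      unfolding eventually_sequentially by blast
    then have i: "2 * (LINT x|?U. \<bar>f x - s i x\<bar>) < e / 2" by simp
    obtain k0 where k0: "\<And>k. k \<ge> k0 \<Longrightarrow> norm (cov (s i) k - 0) < e / 2"
      using LIMSEQ_D[OF s(2), of "e / 2" i] e by auto
    have "norm (cov f k - 0) < e" if k: "k \<ge> k0" for k
    proof -
      have "cov f k = cov (\<lambda>x. (f x - s i x) + s i x) k" by simp
      also have "\<dots> = cov (\<lambda>x. f x - s i x) k + cov (s i) k"
        using s by (intro cov_add) auto
      finally show ?thesis
        using cov_bound[of "\<lambda>x. f x - s i x" k] i k0[OF k] s by auto
    qed
    then show "\<exists>k0. \<forall>k\<ge>k0. norm (cov f k - 0) < e" by blast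
  qed
  have ind: "integrable ?U (indicator A :: real \<Rightarrow> real)" if "A \<in> sets borel" for A
    using that by (intro U.integrable_const_bound[of _ 1]) (auto intro!: measurable_restrict_space1)
  have borel_set: "cov (indicator A) \<longlonglongrightarrow> 0" if A: "A \<in> sets borel" for A
  proof -
    have "Int_stable (range (\<lambda>a::real. {..a}))"
      by (auto simp: Int_stable_def)
    moreover have "range (\<lambda>a::real. {..a}) \<subseteq> Pow UNIV" by simp
    moreover have "A \<in> sigma_sets UNIV (range (\<lambda>a::real. {..a}))"
      using A by (simp add: borel_eq_atMost)
    ultimately show ?thesis
    proof (induction rule: sigma_sets_induct_disjoint)
      case (basic A)
      then show ?case using interval by (auto simp: cov_def)
    next
      case (compl A)
      have A: "A \<in> sets borel" using compl by (simp add: borel_eq_atMost)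
      have "cov (indicator (UNIV - A)) k = - cov (indicator A) k" for k
      proof -
        have "cov (\<lambda>x. indicator (UNIV - A) x + indicator A x) k = cov (\<lambda>x. 1) k"
          by (intro arg_cong2[of _ _ _ _ cov]) (auto split: split_indicator)
        moreover have "cov (\<lambda>x. 1) k = 0"
          by (simp add: cov_def pU)
        ultimately show ?thesis
          using cov_add[OF ind ind, of "UNIV - A" A k] A by simp
      qed
      then show ?case using tendsto_minus[OF compl(2)] by simp
    next
      case (union A)
      have A: "A i \<in> sets borel" for i using union by (auto simp: borel_eq_atMost)
      have fin: "cov (indicator (\<Union>i<n. A i)) \<longlonglongrightarrow> 0" for n
      proof (induction n)
        case 0
        then show ?case by (simp add: cov_def)
      next
        case (Suc n)
        have "(indicator (\<Union>i<Suc n. A i) :: real \<Rightarrow> real) = (\<lambda>x. indicator (\<Union>i<n. A i) x + indicator (A n) x)"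
        proof -
          have "(\<Union>i<Suc n. A i) = (\<Union>i<n. A i) \<union> A n" by (auto simp: less_Suc_eq)
          moreover have "A i \<inter> A n = {}" if "i < n" for i
            using disjoint_family_onD[OF union(1), of i n] that by simp
          then have "(\<Union>i<n. A i) \<inter> A n = {}" by blast
          ultimately show ?thesis by (simp add: indicator_disj_union fun_eq_iff)
        qed
        moreover have "(\<lambda>k. cov (indicator (\<Union>i<n. A i)) k + cov (indicator (A n)) k) \<longlonglongrightarrow> 0 + 0"
          using Suc union by (intro tendsto_add) auto
        ultimately show ?case
          using cov_add[OF ind ind, of "\<Union>i<n. A i" "A n"] A by auto
      qed
      show ?case
      proof (rule cov_lim[of "\<lambda>n. indicator (\<Union>i<n. A i)" _ "\<lambda>_. 1"])
        show "(\<lambda>n. indicator (\<Union>i<n. A i) x :: real) \<longlonglongrightarrow> indicator (\<Union>i. A i) x" for x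
          by (rule LIMSEQ_indicator_UN)
      qed (use fin A in \<open>auto intro!: ind split: split_indicator\<close>)
    qed (simp_all add: cov_def)
  qed
  have "cov g \<longlonglongrightarrow> 0"
    using g
  proof (induction rule: integrable_induct)
    case (base A c)
    then have A: "A \<in> sets borel"
      by (auto simp: sets_restrict_space)
    have "cov (\<lambda>x. indicat_real A x *\<^sub>R c) k = c * cov (indicator A) k" for k
      using cov_cmult[of c "indicator A" k] by (simp add: mult.commute)
    then show ?case
      using tendsto_mult_left[OF borel_set[OF A], of c] by simp
  next
    case (add f g)
    then show ?case
      using tendsto_add[OF add(3,4)] by (simp add: cov_add)
  next
    case (lim f s)
    show ?case
    proof (rule cov_lim[of s f "\<lambda>x. 2 * \<bar>f x\<bar>"])
      show "(\<lambda>i. s i x) \<longlonglongrightarrow> f x" "\<bar>s i x\<bar> \<le> 2 * \<bar>f x\<bar>" if "x \<in> {0..1}" for x i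
        using lim(2,3)[of x] that by simp_all
    qed (use lim(1,4,5) in \<open>simp_all\<close>)
  qed
  then show ?thesis by (simp add: cov_def)
qed

lemma decr_density_mult:
  assumes h: "decr_density h" and p: "\<And>x. x \<in> {0<..1} \<Longrightarrow> 0 \<le> p x"
    "\<And>x y. 0 < x \<Longrightarrow> x \<le> y \<Longrightarrow> y \<le> 1 \<Longrightarrow> p y \<le> p x"
  shows "decr_density (\<lambda>x. h x * p x)"
  using decr_densityD[OF h] p
  by (intro decr_densityI) (auto intro!: mult_mono mult_nonneg_nonneg)

lemma orbit_unit_integral:
  fixes \<phi> :: "real \<Rightarrow> real"
  assumes \<alpha>: "\<alpha> < 1/2" and \<kappa>: "\<And>i. \<kappa> i \<in> {0<..\<alpha>}" and [measurable]: "\<phi> \<in> borel_measurable borel"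
  shows "(LINT x|unit_leb. \<phi> (orbit \<kappa> n x)) = (LBINT x. transfers \<kappa> n (indicator {0<..1}) x * \<phi> x)"
proof -
  have \<kappa>': "\<kappa> i \<in> {0<..1/2}" for i using \<kappa>[of i] \<alpha> by auto
  have "decr_density (indicator {0<..1})"
    using coneD(1)[OF one_cone[of 0]] by simp
  then show ?thesis
    using transfers_integral(1)[of \<kappa>, OF \<kappa>', of "indicator {0<..1}" \<phi> n]
    by (simp add: unit_leb_integral)
qed

lemma extend_unit_bound:
  assumes "\<And>x. x \<in> {0..1} \<Longrightarrow> \<bar>\<phi> x\<bar> \<le> K" "0 \<le> K"
  shows "\<bar>extend_unit \<phi> x\<bar> \<le> K"
  using assms(1)[of x] assms(2) by (auto simp: extend_unit_def split: split_indicator)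

lemma extend_unit_orbit:
  fixes \<kappa> :: "nat \<Rightarrow> real"
  assumes "\<And>i. \<kappa> i \<in> {0<..\<alpha>}" "x \<in> {0..1}"
  shows "extend_unit \<phi> (orbit \<kappa> n x) = \<phi> (orbit \<kappa> n x)"
  using orbit_range[of \<kappa> x n] assms by (intro extend_unit) auto

text \<open>After \<open>N\<close> steps Lebesgue measure has a density in the cone, and so has
  Lebesgue measure itself; both then run through the same last \<open>n\<close> maps. The factor
  \<open>4\<close> is the constant of the cone.\<close>

lemma lebesgue_loss_of_memory:
  fixes \<kappa> :: "nat \<Rightarrow> real" and \<phi> :: "real \<Rightarrow> real" and \<alpha> :: real
  assumes \<alpha>: "0 < \<alpha>" "\<alpha> < 1/2" and D: "memory_rate \<alpha> D"
    and \<kappa>: "\<And>i. \<kappa> i \<in> {0<..\<alpha>}" and \<phi> [measurable]: "\<phi> \<in> borel_measurable unit_borel"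
    and \<phi>1: "\<And>x. x \<in> {0..1} \<Longrightarrow> \<bar>\<phi> x\<bar> \<le> 1"
  shows "\<bar>(LINT x|unit_leb. \<phi> (orbit \<kappa> (N + n) x))
        - (LINT x|unit_leb. \<phi> (orbit (\<lambda>i. \<kappa> (N + i)) n x))\<bar> \<le> 4 * D n"
proof -
  let ?one = "indicator {0<..1} :: real \<Rightarrow> real"
  have one: "cone \<alpha> ?one" using \<alpha> by (intro one_cone) auto
  define \<kappa>1 where "\<kappa>1 = (\<lambda>i. \<kappa> (N + i))"
  define h where "h = transfers \<kappa> N ?one"
  have \<kappa>1: "\<kappa>1 i \<in> {0<..\<alpha>}" for i using \<kappa> by (simp add: \<kappa>1_def)
  have h: "cone \<alpha> h" unfolding h_def using \<alpha> \<kappa> one by (intro transfers_cone) auto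
  have "(LINT x|unit_leb. \<phi> (orbit \<kappa> (N + n) x))
      = (LINT x|unit_leb. extend_unit \<phi> (orbit \<kappa>1 n (orbit \<kappa> N x)))"
    using \<kappa> by (intro Bochner_Integration.integral_cong) (auto simp: extend_unit_orbit[of \<kappa> \<alpha>, OF \<kappa>] \<kappa>1_def simp flip: orbit_add)
  also have "\<dots> = (LBINT x. h x * extend_unit \<phi> (orbit \<kappa>1 n x))"
    unfolding h_def using \<alpha> \<kappa>
    by (intro orbit_unit_integral[where \<phi>="\<lambda>x. extend_unit \<phi> (orbit \<kappa>1 n x)"]) auto
  finally have 1: "(LINT x|unit_leb. \<phi> (orbit \<kappa> (N + n) x))
      = (LBINT x. h x * extend_unit \<phi> (orbit \<kappa>1 n x))" .
  have "(LINT x|unit_leb. \<phi> (orbit \<kappa>1 n x)) = (LINT x|unit_leb. extend_unit \<phi> (orbit \<kappa>1 n x))"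
    by (intro Bochner_Integration.integral_cong) (auto simp: extend_unit_orbit[of \<kappa>1 \<alpha>, OF \<kappa>1])
  also have "\<dots> = (LBINT x. ?one x * extend_unit \<phi> (orbit \<kappa>1 n x))"
    by (intro unit_leb_integral) measurable
  finally have 2: "(LINT x|unit_leb. \<phi> (orbit \<kappa>1 n x)) = (LBINT x. ?one x * extend_unit \<phi> (orbit \<kappa>1 n x))" .
  have "\<bar>(LBINT x. h x * extend_unit \<phi> (orbit \<kappa>1 n x)) - (LBINT x. ?one x * extend_unit \<phi> (orbit \<kappa>1 n x))\<bar> \<le> 4 * D n"
    using coneD[OF h] coneD[OF one] \<kappa>1 extend_unit_bound[OF \<phi>1] by (intro memory_rateD[OF D]) auto
  then show ?thesis unfolding 1 2[unfolded \<kappa>1_def] by (simp add: \<kappa>1_def)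
qed

text \<open>Centring \<open>G\<close> by its mean at time \<open>N\<close> turns the covariance into
  the pairing of \<open>\<phi>\<close> with a signed density of integral zero. The bound does not
  depend on \<open>N\<close>, because the density at time \<open>N\<close> is always in the
  cone.\<close>

lemma covariance_decay:
  fixes \<kappa> :: "nat \<Rightarrow> real" and \<phi> :: "real \<Rightarrow> real" and \<alpha> :: real
  assumes \<alpha>: "0 < \<alpha>" "\<alpha> < 1/2" and D: "memory_rate \<alpha> D"
    and \<kappa>: "\<And>i. \<kappa> i \<in> {0<..\<alpha>}" and \<phi> [measurable]: "\<phi> \<in> borel_measurable unit_borel"
    and \<phi>1: "\<And>x. x \<in> {0..1} \<Longrightarrow> \<bar>\<phi> x\<bar> \<le> 1" and K: "0 < K" and G [measurable]: "G \<in> borel_measurable unit_borel"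
    and GK: "\<And>x. x \<in> {0..1} \<Longrightarrow> \<bar>G x\<bar> \<le> K"
    and lip: "\<And>x y. x \<in> {0..1} \<Longrightarrow> y \<in> {0..1} \<Longrightarrow> \<bar>G x - G y\<bar> \<le> K * \<bar>x - y\<bar>"
  shows "\<bar>(LINT x|unit_leb. G (orbit \<kappa> N x) * \<phi> (orbit \<kappa> (N + n) x))
        - (LINT x|unit_leb. G (orbit \<kappa> N x)) * (LINT x|unit_leb. \<phi> (orbit \<kappa> (N + n) x))\<bar> \<le> (20 * K) * D n"
proof -
  let ?one = "indicator {0<..1} :: real \<Rightarrow> real"
  have one: "cone \<alpha> ?one" using \<alpha> by (intro one_cone) auto
  define \<kappa>1 where "\<kappa>1 = (\<lambda>i. \<kappa> (N + i))"
  define h where "h = transfers \<kappa> N ?one"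
  define \<psi> where "\<psi> = (\<lambda>x. extend_unit \<phi> (orbit \<kappa>1 n x))"
  define J where "J = (LINT x|unit_leb. G (orbit \<kappa> N x))"
  have \<kappa>1: "\<kappa>1 i \<in> {0<..\<alpha>}" for i using \<kappa> by (simp add: \<kappa>1_def)
  have h: "cone \<alpha> h" unfolding h_def using \<alpha> \<kappa> one by (intro transfers_cone) auto
  note hD = decr_densityD[OF coneD(1)[OF h]]
  have [measurable]: "\<psi> \<in> borel_measurable borel" by (simp add: \<psi>_def)
  have [measurable]: "h \<in> borel_measurable borel" by (intro decr_density_measurable coneD[OF h])
  have \<psi>1: "\<bar>\<psi> x\<bar> \<le> 1" for x unfolding \<psi>_def by (rule extend_unit_bound[OF \<phi>1]) auto
  have GK': "\<bar>extend_unit G x\<bar> \<le> K" for x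
    using GK[of x] K by (auto simp: extend_unit_def split: split_indicator)
  have ht: "(LINT x|unit_leb. f (orbit \<kappa> N x)) = (LBINT x. h x * f x)"
    if "f \<in> borel_measurable borel" for f :: "real \<Rightarrow> real"
    unfolding h_def using \<alpha> \<kappa> that by (intro orbit_unit_integral) auto
  have hi: "integrable lborel (\<lambda>x. h x * f x)"
    if [measurable]: "f \<in> borel_measurable borel" and f: "\<And>x. x \<in> {0<..1} \<Longrightarrow> \<bar>f x\<bar> \<le> C" for f :: "real \<Rightarrow> real" and C
  proof (rule Bochner_Integration.integrable_bound[OF integrable_mult_right[OF coneD(3)[OF h], of C]])
    show "AE x in lborel. norm (h x * f x) \<le> norm (C * h x)"
    proof (intro AE_I2)
      fix x :: real
      show "norm (h x * f x) \<le> norm (C * h x)"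
      proof (cases "x \<in> {0<..1}")
        case True
        have "\<bar>f x\<bar> * h x \<le> \<bar>C\<bar> * h x"
          using f[OF True] hD(1) by (intro mult_right_mono) auto
        then show ?thesis using hD(1)[of x] by (simp add: abs_mult mult.commute)
      qed (simp add: hD(2))
    qed
  qed simp
  have J: "J = (LBINT x. h x * extend_unit G x)"
  proof -
    have "J = (LINT x|unit_leb. extend_unit G (orbit \<kappa> N x))"
      unfolding J_def using \<kappa> by (intro Bochner_Integration.integral_cong) (auto simp: extend_unit_orbit[of \<kappa> \<alpha>, OF \<kappa>])
    then show ?thesis by (simp add: ht)
  qed
  have JK: "\<bar>J\<bar> \<le> K"
  proof -
    have "\<bar>J\<bar> \<le> (LBINT x. \<bar>h x * extend_unit G x\<bar>)"
      unfolding J by (rule integral_abs_bound)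
    also have "\<dots> \<le> (LBINT x. h x * K)"
      using GK' GK K hD(1) by (intro integral_mono integrable_abs hi[of _ K] integrable_mult_left coneD(3)[OF h])
          (auto simp: abs_mult less_imp_le intro!: mult_left_mono)
    finally show ?thesis using coneD(2)[OF h] by simp
  qed
  have phi_int: "(LINT x|unit_leb. \<phi> (orbit \<kappa> (N + n) x)) = (LBINT x. h x * \<psi> x)"
  proof -
    have "(LINT x|unit_leb. \<phi> (orbit \<kappa> (N + n) x)) = (LINT x|unit_leb. \<psi> (orbit \<kappa> N x))"
      using \<kappa> by (intro Bochner_Integration.integral_cong) (auto simp: \<psi>_def extend_unit_orbit[of \<kappa> \<alpha>, OF \<kappa>] \<kappa>1_def simp flip: orbit_add)
    then show ?thesis by (simp add: ht)
  qed
  have Gphi_int: "(LINT x|unit_leb. G (orbit \<kappa> N x) * \<phi> (orbit \<kappa> (N + n) x)) = (LBINT x. h x * (extend_unit G x * \<psi> x))"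
  proof -
    have "(LINT x|unit_leb. G (orbit \<kappa> N x) * \<phi> (orbit \<kappa> (N + n) x))
        = (LINT x|unit_leb. extend_unit G (orbit \<kappa> N x) * \<psi> (orbit \<kappa> N x))"
      using \<kappa> by (intro Bochner_Integration.integral_cong) (auto simp: \<psi>_def extend_unit_orbit[of \<kappa> \<alpha>, OF \<kappa>] \<kappa>1_def simp flip: orbit_add)
    then show ?thesis by (simp add: ht[of "\<lambda>x. extend_unit G x * \<psi> x"])
  qed
  have psi: "extend_unit \<phi> (orbit \<kappa>1 n x) = \<psi> x" for x by (simp add: \<psi>_def)
  \<comment> \<open>The signed density \<open>h * (G - J)\<close> is a difference of two decreasing ones, because adding
    \<open>3 * K - K * x\<close> makes a \<open>K\<close>-Lipschitz factor decreasing and nonnegative.\<close>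
  define g2 where "g2 = (\<lambda>x. h x * (3 * K - K * x))"
  define g1 where "g1 = (\<lambda>x. h x * (extend_unit G x - J + 3 * K - K * x))"
  \<comment> \<open>\<open>extend_unit G x - J\<close> lies between \<open>- 2 * K\<close> and
    \<open>2 * K\<close>, and \<open>K * x\<close> between \<open>0\<close> and \<open>K\<close>.
    The upper bound \<open>5 * K\<close> times the constant \<open>4\<close> of the cone is the
    factor \<open>20 * K\<close>.\<close>
  have p1: "0 \<le> extend_unit G x - J + 3 * K - K * x" "extend_unit G x - J + 3 * K - K * x \<le> 5 * K"
    "0 \<le> 3 * K - K * x" "3 * K - K * x \<le> 5 * K" if "x \<in> {0<..1}" for x
  proof -
    have "0 \<le> K * x" "K * x \<le> K * 1" using that K by (auto intro!: mult_left_mono)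
    then show "0 \<le> extend_unit G x - J + 3 * K - K * x" "extend_unit G x - J + 3 * K - K * x \<le> 5 * K"
      "0 \<le> 3 * K - K * x" "3 * K - K * x \<le> 5 * K"
      using GK'[of x] JK K by linarith+
  qed
  have dec1: "decr_density g1"
    unfolding g1_def
  proof (intro decr_density_mult coneD(1)[OF h] p1)
    fix x y :: real assume xy: "0 < x" "x \<le> y" "y \<le> 1"
    have "extend_unit G y - extend_unit G x \<le> K * (y - x)"
      using lip[of y x] xy by auto
    then show "extend_unit G y - J + 3 * K - K * y \<le> extend_unit G x - J + 3 * K - K * x"
      by (simp add: algebra_simps)
  qed
  have dec2: "decr_density g2"
    unfolding g2_def using K by (intro decr_density_mult coneD(1)[OF h] p1) auto
  have pb: "h x * p \<le> 20 * K * x powr - \<alpha>" if "x \<in> {0<..1}" "0 \<le> p" "p \<le> 5 * K" for x p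
  proof -
    have "h x * p \<le> (4 * x powr - \<alpha>) * (5 * K)"
      using coneD(4)[OF h that(1)] hD(1)[of x] that by (intro mult_mono) auto
    then show ?thesis by (simp add: mult_ac)
  qed
  have ia: "integrable lborel g1" "integrable lborel g2" "integrable lborel (\<lambda>x. g1 x * \<psi> x)" "integrable lborel (\<lambda>x. g2 x * \<psi> x)"
  proof -
    have *: "\<bar>p * \<psi> x\<bar> \<le> 5 * K" if "0 \<le> p" "p \<le> 5 * K" for p x
      using mult_mono[OF that(2) \<psi>1[of x]] that K by (auto simp: abs_mult)
    show "integrable lborel g1" "integrable lborel g2"
      unfolding g1_def g2_def using p1 by (auto intro!: hi[of _ "5 * K"])
    show "integrable lborel (\<lambda>x. g1 x * \<psi> x)" "integrable lborel (\<lambda>x. g2 x * \<psi> x)"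
      unfolding g1_def g2_def mult.assoc using p1 by (auto intro!: hi[of _ "5 * K"] *)
  qed
  have hG: "integrable lborel (\<lambda>x. h x * extend_unit G x)" "integrable lborel (\<lambda>x. h x * \<psi> x)"
      "integrable lborel (\<lambda>x. h x * (extend_unit G x * \<psi> x))"
  proof -
    have "\<bar>extend_unit G x * \<psi> x\<bar> \<le> K" for x
      using mult_mono[OF GK'[of x] \<psi>1[of x]] K by (auto simp: abs_mult)
    then show "integrable lborel (\<lambda>x. h x * extend_unit G x)" "integrable lborel (\<lambda>x. h x * \<psi> x)"
      "integrable lborel (\<lambda>x. h x * (extend_unit G x * \<psi> x))"
      using GK' \<psi>1 by (auto intro!: hi)
  qed
  have "(LBINT x. g1 x) - (LBINT x. g2 x) = (LBINT x. h x * extend_unit G x - J * h x)"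
    unfolding Bochner_Integration.integral_diff[OF ia(1,2), symmetric]
    by (intro Bochner_Integration.integral_cong) (auto simp: g1_def g2_def algebra_simps)
  also have "\<dots> = J - J * 1"
    using hG(1) coneD(2,3)[OF h] by (simp add: J)
  finally have eq: "(LBINT x. g1 x) = (LBINT x. g2 x)" by simp
  have "\<bar>(LBINT x. g1 x * extend_unit \<phi> (orbit \<kappa>1 n x)) - (LBINT x. g2 x * extend_unit \<phi> (orbit \<kappa>1 n x))\<bar> \<le> (20 * K) * D n"
    by (rule memory_rateD[OF D \<kappa>1 _ dec1 dec2 eq _ _ _ extend_unit_bound[OF \<phi>1]])
       (use K pb p1 in \<open>auto simp: g1_def g2_def\<close>)
  also have "(LBINT x. g1 x * extend_unit \<phi> (orbit \<kappa>1 n x)) - (LBINT x. g2 x * extend_unit \<phi> (orbit \<kappa>1 n x))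
      = (LBINT x. h x * (extend_unit G x * \<psi> x) - J * (h x * \<psi> x))"
    unfolding psi Bochner_Integration.integral_diff[OF ia(3,4), symmetric]
    by (intro Bochner_Integration.integral_cong) (auto simp: g1_def g2_def algebra_simps)
  also have "\<dots> = (LBINT x. h x * (extend_unit G x * \<psi> x)) - J * (LBINT x. h x * \<psi> x)"
    using hG by simp
  finally show ?thesis unfolding phi_int Gphi_int J_def[symmetric] .
qed

text \<open>With \<open>d\<close> the density of \<open>\<nu>\<close>, the difference is the
  covariance of \<open>d\<close> with the test functions, since \<open>d\<close> has integral
  \<open>1\<close>. The test function varies with \<open>k\<close> because the observable changes
  along the orbit of the base.\<close>

lemma absolutely_continuous_loss_of_memory:
  fixes \<kappa> :: "nat \<Rightarrow> real" and \<phi> :: "nat \<Rightarrow> real \<Rightarrow> real" and \<alpha> :: real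
  assumes \<alpha>: "0 < \<alpha>" "\<alpha> < 1/2" and D: "memory_rate \<alpha> D" "D \<longlonglongrightarrow> 0"
    and \<kappa>: "\<And>i. \<kappa> i \<in> {0<..\<alpha>}" and \<phi> [measurable]: "\<And>k. \<phi> k \<in> borel_measurable unit_borel"
    and \<phi>1: "\<And>k x. x \<in> {0..1} \<Longrightarrow> \<bar>\<phi> k x\<bar> \<le> 1"
    and \<nu>: "prob_space \<nu>" "sets \<nu> = sets unit_borel" "absolutely_continuous unit_leb \<nu>"
  shows "(\<lambda>k. (LINT x|\<nu>. \<phi> k (orbit \<kappa> k x)) - (LINT x|unit_leb. \<phi> k (orbit \<kappa> k x))) \<longlonglongrightarrow> 0"
proof -
  interpret U: prob_space unit_leb by (rule prob_space_unit_leb)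
  let ?one = "indicator {0<..1} :: real \<Rightarrow> real"
  have one: "cone \<alpha> ?one" using \<alpha> by (intro one_cone) auto
  interpret \<nu>: prob_space \<nu> by fact
  note [measurable_cong] = \<nu>(2)
  have orb [measurable]: "orbit \<kappa> k \<in> unit_borel \<rightarrow>\<^sub>M unit_borel" for k
    using orbit_range[of \<kappa> _ k] \<kappa> by (intro measurable_restrict_space3) auto
  define \<psi> where "\<psi> = (\<lambda>k x. \<phi> k (orbit \<kappa> k x))"
  have [measurable]: "\<psi> k \<in> borel_measurable unit_borel" for k unfolding \<psi>_def by measurable
  have \<psi>1: "\<bar>\<psi> k x\<bar> \<le> 1" if "x \<in> {0..1}" for k x
    unfolding \<psi>_def using \<kappa> that by (intro \<phi>1 orbit_range) auto
  obtain d where d: "d \<in> borel_measurable unit_leb"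
    "AE x in unit_leb. RN_deriv unit_leb \<nu> x = ennreal (d x)" "\<And>x. 0 \<le> d x"
    using U.real_RN_deriv[OF \<nu>.finite_measure_axioms \<nu>(3)] \<nu>(2) sets_unit_leb by metis
  have dens: "density unit_leb (\<lambda>x. ennreal (d x)) = \<nu>"
  proof -
    have "density unit_leb (RN_deriv unit_leb \<nu>) = \<nu>"
      using \<nu> by (intro U.density_RN_deriv) (auto simp: sets_unit_leb)
    moreover have "density unit_leb (RN_deriv unit_leb \<nu>) = density unit_leb (\<lambda>x. ennreal (d x))"
      using d by (intro density_cong) auto
    ultimately show ?thesis by simp
  qed
  have \<nu>_int: "(LINT x|\<nu>. f x) = (LINT x|unit_leb. d x * f x)" if "f \<in> borel_measurable unit_leb" for f :: "real \<Rightarrow> real"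
    by (subst dens[symmetric], subst integral_density) (use d that in auto)
  have e: "(LINT x|\<nu>. \<phi> k (orbit \<kappa> k x)) = (LINT x|unit_leb. d x * \<psi> k x)" for k
    unfolding \<psi>_def by (rule \<nu>_int) measurable
  have d1: "(LINT x|unit_leb. d x) = 1"
    using \<nu>_int[of "\<lambda>_. 1"] \<nu>.prob_space by simp
  then have di: "integrable unit_leb d"
    using not_integrable_integral_eq[of unit_leb d] by force
  have "(\<lambda>k. (LINT x|unit_leb. d x * \<psi> k x)
     - (LINT x|unit_leb. d x) * (LINT x|unit_leb. \<psi> k x)) \<longlonglongrightarrow> 0"
  proof (rule decorrelation_from_intervals[OF _ \<psi>1 _ di])
    fix a :: real
    \<comment> \<open>An initial interval is compared with the constant density of the same mass
      \<open>p\<close>; both are decreasing and at most \<open>x powr - \<alpha>\<close>, so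
      \<open>K = 1\<close> applies.\<close>
    define p :: real where "p = (LINT x|unit_leb. indicator {..a} x)"
    define g1 where "g1 = (\<lambda>x. ?one x * indicator {..a} x :: real)"
    define g2 where "g2 = (\<lambda>x. ?one x * p)"
    have p_eq: "p = (LBINT x. g1 x)"
      unfolding p_def g1_def by (intro unit_leb_integral) auto
    have p: "0 \<le> p" "p \<le> 1"
      unfolding p_def by (auto intro!: U.integral_le_const measurable_restrict_space1 U.integrable_const_bound[of _ 1])
    have dec: "decr_density g1" "decr_density g2"
      unfolding g1_def g2_def using p
      by (auto intro!: decr_density_mult coneD(1)[OF one] split: split_indicator)
    have ge1: "1 \<le> x powr - \<alpha>" if "x \<in> {0<..1}" for x
      using powr_mono2'[of "- \<alpha>" x 1] \<alpha> that by simp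
    have bd: "g1 x \<le> 1 * x powr - \<alpha>" "g2 x \<le> 1 * x powr - \<alpha>" if "x \<in> {0<..1}" for x
      using ge1[OF that] p by (auto simp: g1_def g2_def split: split_indicator)
    have eq: "(LBINT x. g1 x) = (LBINT x. g2 x)"
      unfolding p_eq[symmetric] by (simp add: g2_def)
    have conv: "(LINT x|unit_leb. \<psi> k x * f x) = (LBINT x. (?one x * f x) * extend_unit (\<phi> k) (orbit \<kappa> k x))"
      if [measurable]: "f \<in> borel_measurable borel" for f k
    proof -
      have "(LINT x|unit_leb. \<psi> k x * f x) = (LINT x|unit_leb. extend_unit (\<phi> k) (orbit \<kappa> k x) * f x)"
        using \<kappa> by (intro Bochner_Integration.integral_cong) (auto simp: \<psi>_def extend_unit_orbit[of \<kappa> \<alpha>, OF \<kappa>])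
      also have "\<dots> = (LBINT x. ?one x * (extend_unit (\<phi> k) (orbit \<kappa> k x) * f x))"
        by (intro unit_leb_integral) measurable
      finally show ?thesis by (simp add: mult_ac)
    qed
    have "\<bar>(LINT x|unit_leb. indicator {..a} x * \<psi> k x) - p * (LINT x|unit_leb. \<psi> k x)\<bar> \<le> 1 * D k" for k
    proof -
      have "\<bar>(LBINT x. g1 x * extend_unit (\<phi> k) (orbit \<kappa> k x)) - (LBINT x. g2 x * extend_unit (\<phi> k) (orbit \<kappa> k x))\<bar> \<le> 1 * D k"
        by (rule memory_rateD[OF D(1) \<kappa> _ dec eq bd _ extend_unit_bound[OF \<phi>1]]) auto
      then show ?thesis
        using conv[of "indicator {..a}" k] conv[of "\<lambda>_. p" k] by (simp add: g1_def g2_def mult.commute)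
    qed
    then have "\<forall>k. norm ((LINT x|unit_leb. indicator {..a} x * \<psi> k x) - p * (LINT x|unit_leb. \<psi> k x)) \<le> D k"
      unfolding mult_1 real_norm_def by blast
    then show "(\<lambda>k. (LINT x|unit_leb. indicator {..a} x * \<psi> k x)
       - (LINT x|unit_leb. indicator {..a} x) * (LINT x|unit_leb. \<psi> k x)) \<longlonglongrightarrow> 0"
      unfolding p_def[symmetric] by (rule Lim_null_comparison[OF always_eventually D(2)])
  qed measurable
  then show ?thesis
    unfolding d1 e by (simp add: \<psi>_def)
qed

section \<open>Random orbits\<close>

text \<open>Pushing \<open>L \<omega>\<close> forward into the product, onto the section over
  \<open>\<omega>\<close>, makes the integrand independent of \<open>\<omega>\<close>; only the
  kernel still varies.\<close>

lemma kernel_integral_measurable: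
  fixes f :: "'a \<Rightarrow> 'b \<Rightarrow> real"
  assumes f: "(\<lambda>(\<omega>, x). f \<omega> x) \<in> borel_measurable (M \<Otimes>\<^sub>M N)" and L: "L \<in> M \<rightarrow>\<^sub>M prob_algebra N"
  shows "(\<lambda>\<omega>. LINT x|L \<omega>. f \<omega> x) \<in> borel_measurable M"
proof -
  note [measurable] = measurable_prob_algebraD[OF L] measurable_distr2
  have "(\<lambda>\<omega>. distr (L \<omega>) (M \<Otimes>\<^sub>M N) (\<lambda>x. (\<omega>, x))) \<in> M \<rightarrow>\<^sub>M subprob_algebra (M \<Otimes>\<^sub>M N)"
    by measurable
  then have "(\<lambda>\<omega>. \<integral>p. (\<lambda>(\<omega>, x). f \<omega> x) p \<partial>distr (L \<omega>) (M \<Otimes>\<^sub>M N) (\<lambda>x. (\<omega>, x))) \<in> borel_measurable M"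
    by (rule measurable_compose[OF _ integral_measurable_subprob_algebra[OF f]])
  also have "?this \<longleftrightarrow> ?thesis"
  proof (rule measurable_cong)
    fix \<omega> assume \<omega>: "\<omega> \<in> space M"
    then have [measurable_cong]: "sets (L \<omega>) = sets N"
      using subprob_measurableD(2)[OF measurable_prob_algebraD[OF L]] by blast
    have "(\<integral>p. (\<lambda>(\<omega>, x). f \<omega> x) p \<partial>distr (L \<omega>) (M \<Otimes>\<^sub>M N) (\<lambda>x. (\<omega>, x))) = (LINT x|L \<omega>. (\<lambda>(\<omega>, x). f \<omega> x) (\<omega>, x))"
      using f \<omega> by (intro integral_distr) auto
    then show "(\<integral>p. (\<lambda>(\<omega>, x). f \<omega> x) p \<partial>distr (L \<omega>) (M \<Otimes>\<^sub>M N) (\<lambda>x. (\<omega>, x))) = (LINT x|L \<omega>. f \<omega> x)"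
      by simp
  qed
  finally show ?thesis .
qed

lemma lebesgue_kernel [measurable]: "(\<lambda>_. unit_leb) \<in> M \<rightarrow>\<^sub>M prob_algebra unit_borel"
  by (intro measurable_const) (auto simp: space_prob_algebra prob_space_unit_leb sets_unit_leb)

definition base_orbit :: "('a \<Rightarrow> 'a) \<Rightarrow> ('a \<Rightarrow> real) \<Rightarrow> nat \<Rightarrow> 'a \<Rightarrow> real \<Rightarrow> real" where
  "base_orbit \<sigma> \<kappa> n \<omega> = orbit (\<lambda>i. \<kappa> ((\<sigma> ^^ i) \<omega>)) n"

lemma cocycle_eq_base_orbit: "cocycle \<sigma> (\<lambda>\<omega>. lsv (\<kappa> \<omega>)) n \<omega> = base_orbit \<sigma> \<kappa> n \<omega>"
  by (induction n) (auto simp: fun_eq_iff base_orbit_def)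

lemma base_orbit_0 [simp]: "base_orbit \<sigma> \<kappa> 0 \<omega> x = x"
  by (simp add: base_orbit_def)

lemma base_orbit_shift: "orbit (\<lambda>i. \<kappa> ((\<sigma> ^^ (m + i)) \<omega>)) n x = base_orbit \<sigma> \<kappa> n ((\<sigma> ^^ m) \<omega>) x"
  by (simp add: base_orbit_def funpow_add add.commute[of m])

lemma base_orbit_add: "base_orbit \<sigma> \<kappa> (m + n) \<omega> x = base_orbit \<sigma> \<kappa> n ((\<sigma> ^^ m) \<omega>) (base_orbit \<sigma> \<kappa> m \<omega> x)"
  unfolding base_orbit_shift[symmetric] by (simp add: base_orbit_def orbit_add)

lemma funpow_shift: "(f ^^ n) ((f ^^ m) x) = (f ^^ (m + n)) x"
  by (simp add: funpow_add add.commute[of m])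

section \<open>Iterates of the base and measurability of fibre orbits\<close>

context ergodic_automorphism
begin

lemma funpow_measurable [measurable]: "(\<sigma> ^^ n) \<in> M \<rightarrow>\<^sub>M M"
  using measurable by (induction n) (auto intro: measurable_comp)

lemma funpow_space: "\<omega> \<in> space M \<Longrightarrow> (\<sigma> ^^ n) \<omega> \<in> space M"
  using measurable_space[OF funpow_measurable] .

lemma funpow_preserving: "distr M M (\<sigma> ^^ n) = M"
proof (induction n)
  case (Suc n)
  have "distr M M (\<sigma> ^^ Suc n) = distr (distr M M (\<sigma> ^^ n)) M \<sigma>"
    using measurable by (simp add: distr_distr)
  then show ?case using Suc preserving by (simp add: comp_def)
qed (simp add: id_def distr_id2)

lemma funpow_integral:
  fixes g :: "'a \<Rightarrow> real"
  assumes "g \<in> borel_measurable M"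
  shows "(LINT \<omega>|M. g ((\<sigma> ^^ n) \<omega>)) = (LINT \<omega>|M. g \<omega>)"
proof -
  have "(LINT \<omega>|M. g \<omega>) = (\<integral>\<omega>. g \<omega> \<partial>distr M M (\<sigma> ^^ n))" by (simp add: funpow_preserving)
  also have "\<dots> = (LINT \<omega>|M. g ((\<sigma> ^^ n) \<omega>))"
    using assms by (intro integral_distr) auto
  finally show ?thesis ..
qed

lemma AE_funpow:
  assumes "AE \<omega> in M. P \<omega>"
  shows "AE \<omega> in M. P ((\<sigma> ^^ n) \<omega>)"
proof -
  have "AE \<omega> in distr M M (\<sigma> ^^ n). P \<omega>" unfolding funpow_preserving by fact
  then show ?thesis by (rule AE_distrD[rotated]) measurable
qed

lemma inverse_funpow:
  obtains \<tau> where "\<tau> \<in> M \<rightarrow>\<^sub>M M" "\<And>\<omega>. \<omega> \<in> space M \<Longrightarrow> \<tau> ((\<sigma> ^^ n) \<omega>) = \<omega>"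
proof -
  let ?\<tau> = "inv_into (space M) \<sigma>"
  have "(?\<tau> ^^ n) \<in> M \<rightarrow>\<^sub>M M"
    using measurable_inverse by (induction n) (auto intro: measurable_comp)
  moreover have "(?\<tau> ^^ n) ((\<sigma> ^^ n) \<omega>) = \<omega>" if "\<omega> \<in> space M" for \<omega>
  proof (induction n)
    case (Suc n)
    have "(?\<tau> ^^ Suc n) ((\<sigma> ^^ Suc n) \<omega>) = (?\<tau> ^^ n) (?\<tau> (\<sigma> ((\<sigma> ^^ n) \<omega>)))"
      by (simp add: funpow_swap1)
    also have "?\<tau> (\<sigma> ((\<sigma> ^^ n) \<omega>)) = (\<sigma> ^^ n) \<omega>"
      using bij funpow_space[OF that] by (intro inv_into_f_f) (auto simp: bij_betw_def)
    finally show ?case using Suc by simp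
  qed simp
  ultimately show ?thesis using that by blast
qed

text \<open>Stated on the whole line and for arbitrary parameters: over exceptional base points an
  orbit may leave the unit interval, and the integrands have to be measurable there as well.\<close>

lemma base_orbit_measurable_real [measurable]:
  assumes [measurable]: "\<kappa> \<in> borel_measurable M"
  shows "(\<lambda>(\<omega>, x). base_orbit \<sigma> \<kappa> n \<omega> x) \<in> borel_measurable (M \<Otimes>\<^sub>M borel)"
  unfolding base_orbit_def by (induction n) (simp_all add: case_prod_beta')

lemma base_orbit_range:
  assumes "\<And>\<omega>. \<omega> \<in> space M \<Longrightarrow> 0 < \<kappa> \<omega>" "\<omega> \<in> space M" "x \<in> {0..1}"
  shows "base_orbit \<sigma> \<kappa> n \<omega> x \<in> {0..1}"
  unfolding base_orbit_def using assms funpow_space by (intro orbit_range) auto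

lemma base_orbit_measurable_unit:
  assumes \<kappa> [measurable]: "\<kappa> \<in> borel_measurable M" and pos: "\<And>\<omega>. \<omega> \<in> space M \<Longrightarrow> 0 < \<kappa> \<omega>"
  shows "(\<lambda>(\<omega>, x). base_orbit \<sigma> \<kappa> n \<omega> x) \<in> M \<Otimes>\<^sub>M unit_borel \<rightarrow>\<^sub>M unit_borel"
proof (rule measurable_restrict_space2)
  have [measurable]: "(\<lambda>x. x) \<in> unit_borel \<rightarrow>\<^sub>M borel" by (rule measurable_restrict_space1) simp
  have "(\<lambda>p. (\<lambda>(\<omega>, x). base_orbit \<sigma> \<kappa> n \<omega> x) (fst p, (\<lambda>x. x) (snd p))) \<in> M \<Otimes>\<^sub>M unit_borel \<rightarrow>\<^sub>M borel"
    by (rule measurable_compose[OF _ base_orbit_measurable_real[OF \<kappa>, of n]]) measurable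
  then show "(\<lambda>(\<omega>, x). base_orbit \<sigma> \<kappa> n \<omega> x) \<in> M \<Otimes>\<^sub>M unit_borel \<rightarrow>\<^sub>M borel"
    by (simp add: case_prod_beta')
qed (use base_orbit_range[OF pos] in \<open>auto simp: space_pair_measure\<close>)

lemma kernel_integral_bound:
  fixes f :: "real \<Rightarrow> real"
  assumes L: "L \<in> M \<rightarrow>\<^sub>M prob_algebra unit_borel" and \<omega>: "\<omega> \<in> space M"
    and f: "\<And>x. x \<in> {0..1} \<Longrightarrow> \<bar>f x\<bar> \<le> C" "0 \<le> C"
  shows "\<bar>LINT x|L \<omega>. f x\<bar> \<le> C"
proof -
  have L_prob: "prob_space (L \<omega>)"
    using measurable_space[OF L \<omega>] by (simp add: space_prob_algebra)
  have sp: "space (L \<omega>) = {0..1}"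
    using measurable_space[OF L \<omega>] sets_eq_imp_space_eq[of "L \<omega>" unit_borel] by (simp add: space_prob_algebra)
  show ?thesis
  proof (cases "integrable (L \<omega>) f")
    case True
    have "\<bar>LINT x|L \<omega>. f x\<bar> \<le> (LINT x|L \<omega>. \<bar>f x\<bar>)" by (rule integral_abs_bound)
    also have "\<dots> \<le> C"
      using f sp True by (intro prob_space.integral_le_const[OF L_prob] integrable_abs AE_I2) auto
    finally show ?thesis .
  qed (simp add: not_integrable_integral_eq f)
qed

lemma bounded_integrable:
  assumes "(f :: 'a \<Rightarrow> real) \<in> borel_measurable M" "\<And>\<omega>. \<omega> \<in> space M \<Longrightarrow> \<bar>f \<omega>\<bar> \<le> C"
  shows "integrable M f"
  using assms by (intro integrable_const_bound[of _ C]) (auto intro!: AE_I2)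

lemma bounded_integral:
  assumes "(f :: 'a \<Rightarrow> real) \<in> borel_measurable M" "\<And>\<omega>. \<omega> \<in> space M \<Longrightarrow> \<bar>f \<omega>\<bar> \<le> C"
  shows "\<bar>LINT \<omega>|M. f \<omega>\<bar> \<le> C"
proof -
  have "\<bar>LINT \<omega>|M. f \<omega>\<bar> \<le> (LINT \<omega>|M. \<bar>f \<omega>\<bar>)" by (rule integral_abs_bound)
  also have "\<dots> \<le> C"
    using assms bounded_integrable[OF assms] by (intro integral_le_const integrable_abs AE_I2) auto
  finally show ?thesis .
qed

end

section \<open>The random invariant measure\<close>

locale lsv_cocycle = ergodic_automorphism M \<sigma> for M :: "'a measure" and \<sigma> +
  fixes \<kappa> :: "'a \<Rightarrow> real" and \<mu> :: "'a \<Rightarrow> real measure" and \<alpha> :: real and D :: "nat \<Rightarrow> real"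
  assumes \<alpha>: "0 < \<alpha>" "\<alpha> < 1/2" and rate: "memory_rate \<alpha> D" "summable D"
    and \<kappa>_measurable [measurable]: "\<kappa> \<in> borel_measurable M"
    and \<kappa>: "\<And>\<omega>. \<omega> \<in> space M \<Longrightarrow> \<kappa> \<omega> \<in> {0<..\<alpha>}"
    and acim: "random_acim M \<sigma> (\<lambda>\<omega>. lsv (\<kappa> \<omega>)) \<mu>"
begin

abbreviation "T \<equiv> base_orbit \<sigma> \<kappa>"

lemma \<kappa>_funpow: "\<omega> \<in> space M \<Longrightarrow> \<kappa> ((\<sigma> ^^ i) \<omega>) \<in> {0<..\<alpha>}"
  by (intro \<kappa> funpow_space)

lemma T_range: "\<omega> \<in> space M \<Longrightarrow> x \<in> {0..1} \<Longrightarrow> T n \<omega> x \<in> {0..1}"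
  using \<kappa> by (intro base_orbit_range) auto

lemma T_measurable_pair: "(\<lambda>(\<omega>, x). T n \<omega> x) \<in> M \<Otimes>\<^sub>M unit_borel \<rightarrow>\<^sub>M unit_borel"
  using \<kappa> by (intro base_orbit_measurable_unit) auto

lemma T_measurable [measurable (raw)]:
  assumes "f \<in> N \<rightarrow>\<^sub>M M" "g \<in> N \<rightarrow>\<^sub>M unit_borel"
  shows "(\<lambda>z. T n (f z) (g z)) \<in> N \<rightarrow>\<^sub>M unit_borel"
  using measurable_compose[OF measurable_Pair[OF assms] T_measurable_pair[of n]] by simp

lemma \<mu>_measurable [measurable]: "\<mu> \<in> M \<rightarrow>\<^sub>M prob_algebra unit_borel"
  using acim by (simp add: random_acim_def)

lemma \<mu>_prob:
  assumes "\<omega> \<in> space M"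
  shows "prob_space (\<mu> \<omega>)" "sets (\<mu> \<omega>) = sets unit_borel" "space (\<mu> \<omega>) = {0..1}"
proof -
  show 1: "prob_space (\<mu> \<omega>)" "sets (\<mu> \<omega>) = sets unit_borel"
    using measurable_space[OF \<mu>_measurable assms] by (auto simp: space_prob_algebra)
  show "space (\<mu> \<omega>) = {0..1}" using sets_eq_imp_space_eq[OF 1(2)] by simp
qed

lemma \<mu>_equivariant: "AE \<omega> in M. distr (\<mu> \<omega>) unit_borel (T n \<omega>) = \<mu> ((\<sigma> ^^ n) \<omega>)"
proof (induction n)
  case 0
  have "T 0 \<omega> = (\<lambda>x. x)" for \<omega> by (simp add: fun_eq_iff)
  then have "distr (\<mu> \<omega>) unit_borel (T 0 \<omega>) = \<mu> \<omega>" if "\<omega> \<in> space M" for \<omega>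
    using \<mu>_prob[OF that] by (simp add: distr_id2)
  then show ?case by (intro AE_I2) (simp del: base_orbit_0)
next
  case (Suc n)
  have "AE \<omega> in M. distr (\<mu> \<omega>) unit_borel (lsv (\<kappa> \<omega>)) = \<mu> (\<sigma> \<omega>)"
    using acim by (simp add: random_acim_def)
  from AE_funpow[OF this, of n]
  have "AE \<omega> in M. distr (\<mu> ((\<sigma> ^^ n) \<omega>)) unit_borel (lsv (\<kappa> ((\<sigma> ^^ n) \<omega>))) = \<mu> ((\<sigma> ^^ Suc n) \<omega>)"
    by simp
  then show ?case
    using Suc AE_space
  proof eventually_elim
    case (elim \<omega>)
    note [measurable_cong] = \<mu>_prob(2)[OF elim(3)]
    have lsv_m: "lsv (\<kappa> ((\<sigma> ^^ n) \<omega>)) \<in> unit_borel \<rightarrow>\<^sub>M unit_borel"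
      using lsv_range[of "\<kappa> ((\<sigma> ^^ n) \<omega>)"] \<kappa>_funpow[OF elim(3), of n] by (intro measurable_restrict_space3) auto
    have T_m: "T n \<omega> \<in> \<mu> \<omega> \<rightarrow>\<^sub>M unit_borel" using elim(3) by measurable
    have "distr (\<mu> \<omega>) unit_borel (T (Suc n) \<omega>) = distr (\<mu> \<omega>) unit_borel (lsv (\<kappa> ((\<sigma> ^^ n) \<omega>)) \<circ> T n \<omega>)"
      by (rule arg_cong[of _ _ "distr (\<mu> \<omega>) unit_borel"]) (simp add: base_orbit_def fun_eq_iff)
    also have "\<dots> = distr (distr (\<mu> \<omega>) unit_borel (T n \<omega>)) unit_borel (lsv (\<kappa> ((\<sigma> ^^ n) \<omega>)))"
      using lsv_m T_m by (simp add: distr_distr)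
    finally show ?case using elim by simp
  qed
qed

text \<open>The measure on the product with fibres \<open>\<mu> \<omega>\<close> is invariant under
  the skew product: equivariance moves the fibre measure to \<open>(\<sigma> ^^ n) \<omega>\<close>
  almost surely, and \<open>\<sigma>\<close> preserves \<open>M\<close>.\<close>

lemma invariance:
  assumes \<Phi> [measurable]: "(\<lambda>(\<omega>, x). \<Phi> \<omega> x) \<in> borel_measurable (M \<Otimes>\<^sub>M unit_borel)"
  shows "(LINT \<omega>|M. (LINT x|\<mu> \<omega>. \<Phi> ((\<sigma> ^^ n) \<omega>) (T n \<omega> x))) = (\<integral>\<omega>. (LINT x|\<mu> \<omega>. \<Phi> \<omega> x) \<partial>M :: real)"
proof -
  have "(LINT \<omega>|M. (LINT x|\<mu> \<omega>. \<Phi> ((\<sigma> ^^ n) \<omega>) (T n \<omega> x))) = (LINT \<omega>|M. (LINT x|\<mu> ((\<sigma> ^^ n) \<omega>). \<Phi> ((\<sigma> ^^ n) \<omega>) x))"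
  proof (rule integral_cong_AE)
    show "(\<lambda>\<omega>. LINT x|\<mu> \<omega>. \<Phi> ((\<sigma> ^^ n) \<omega>) (T n \<omega> x)) \<in> borel_measurable M"
      by (intro kernel_integral_measurable[where N=unit_borel]) measurable
    have "(\<lambda>\<omega>. LINT x|\<mu> \<omega>. \<Phi> \<omega> x) \<in> borel_measurable M"
      by (intro kernel_integral_measurable[where N=unit_borel]) measurable
    from measurable_compose[OF funpow_measurable this, of n]
    show "(\<lambda>\<omega>. LINT x|\<mu> ((\<sigma> ^^ n) \<omega>). \<Phi> ((\<sigma> ^^ n) \<omega>) x) \<in> borel_measurable M" .
    show "AE \<omega> in M. (LINT x|\<mu> \<omega>. \<Phi> ((\<sigma> ^^ n) \<omega>) (T n \<omega> x)) = (LINT x|\<mu> ((\<sigma> ^^ n) \<omega>). \<Phi> ((\<sigma> ^^ n) \<omega>) x)"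
      using \<mu>_equivariant[of n] AE_space
    proof eventually_elim
      case (elim \<omega>)
      note [measurable_cong] = \<mu>_prob(2)[OF elim(2)]
      have [measurable]: "T n \<omega> \<in> \<mu> \<omega> \<rightarrow>\<^sub>M unit_borel" using elim(2) by measurable
      have "(\<sigma> ^^ n) \<omega> \<in> space M" by (rule funpow_space[OF elim(2)])
      then have "\<Phi> ((\<sigma> ^^ n) \<omega>) \<in> borel_measurable unit_borel"
        using measurable_compose[OF measurable_Pair1' \<Phi>] by simp
      then show ?case
        unfolding elim(1)[symmetric] by (subst integral_distr) auto
    qed
  qed
  also have "\<dots> = (LINT \<omega>|M. (LINT x|\<mu> \<omega>. \<Phi> \<omega> x))"
    by (rule funpow_integral, intro kernel_integral_measurable[where N=unit_borel]) measurable
  finally show ?thesis .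
qed

end

context lsv_cocycle
begin

lemma pair_section [measurable (raw)]:
  assumes "(\<lambda>(\<omega>, x). \<Phi> \<omega> x) \<in> borel_measurable (M \<Otimes>\<^sub>M unit_borel)" "\<omega> \<in> space M"
  shows "\<Phi> \<omega> \<in> borel_measurable unit_borel"
  using measurable_compose[OF measurable_Pair1'[OF assms(2)] assms(1)] by simp

lemma skew_measurable:
  fixes \<Phi> :: "'a \<Rightarrow> real \<Rightarrow> real"
  assumes [measurable]: "(\<lambda>(\<omega>, x). \<Phi> \<omega> x) \<in> borel_measurable (M \<Otimes>\<^sub>M unit_borel)"
  shows "(\<lambda>(\<omega>, x). \<Phi> ((\<sigma> ^^ n) \<omega>) (T m \<omega> x)) \<in> borel_measurable (M \<Otimes>\<^sub>M unit_borel)"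
proof -
  have "(\<lambda>p. (\<lambda>(\<omega>, x). \<Phi> \<omega> x) ((\<sigma> ^^ n) (fst p), T m (fst p) (snd p))) \<in> borel_measurable (M \<Otimes>\<^sub>M unit_borel)"
    by measurable
  then show ?thesis by (simp add: case_prod_beta')
qed

lemma skew_integral_measurable:
  fixes \<Phi> :: "'a \<Rightarrow> real \<Rightarrow> real"
  assumes "(\<lambda>(\<omega>, x). \<Phi> \<omega> x) \<in> borel_measurable (M \<Otimes>\<^sub>M unit_borel)"
    and "L \<in> M \<rightarrow>\<^sub>M prob_algebra unit_borel"
  shows "(\<lambda>\<omega>. LINT x|L \<omega>. \<Phi> ((\<sigma> ^^ n) \<omega>) (T m \<omega> x)) \<in> borel_measurable M"
  by (rule kernel_integral_measurable[OF skew_measurable[OF assms(1)] assms(2)])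

text \<open>Nothing is known about the fibre densities besides integrability. They are compared with Lebesgue
  measure fibrewise at a time \<open>k\<close> tending to infinity, and the rate then comes from Lebesgue measure alone.\<close>

lemma acim_approximation:
  fixes \<Phi> :: "'a \<Rightarrow> real \<Rightarrow> real"
  assumes \<Phi>: "(\<lambda>(\<omega>, x). \<Phi> \<omega> x) \<in> borel_measurable (M \<Otimes>\<^sub>M unit_borel)"
    and \<Phi>1: "\<And>\<omega> x. \<omega> \<in> space M \<Longrightarrow> x \<in> {0..1} \<Longrightarrow> \<bar>\<Phi> \<omega> x\<bar> \<le> 1"
  shows "\<bar>(LINT \<omega>|M. (LINT x|\<mu> \<omega>. \<Phi> \<omega> x)) - (LINT \<omega>|M. (LINT x|unit_leb. \<Phi> ((\<sigma> ^^ N) \<omega>) (T N \<omega> x)))\<bar> \<le> 4 * D N"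
proof -
  let ?E = "LINT \<omega>|M. (LINT x|\<mu> \<omega>. \<Phi> \<omega> x)"
  define e where "e = (\<lambda>k \<omega>. (LINT x|\<mu> \<omega>. \<Phi> ((\<sigma> ^^ k) \<omega>) (T k \<omega> x)))"
  define l where "l = (\<lambda>k \<omega>. (LINT x|unit_leb. \<Phi> ((\<sigma> ^^ k) \<omega>) (T k \<omega> x)))"
  have em [measurable]: "e k \<in> borel_measurable M" for k
    unfolding e_def by (rule skew_integral_measurable[OF \<Phi> \<mu>_measurable])
  have lm [measurable]: "l k \<in> borel_measurable M" for k
    unfolding l_def by (rule skew_integral_measurable[OF \<Phi> lebesgue_kernel])
  let ?l = "\<lambda>k. LINT \<omega>|M. l k \<omega>"
  have \<Phi>T: "\<bar>\<Phi> ((\<sigma> ^^ k) \<omega>) (T k \<omega> x)\<bar> \<le> 1" if "\<omega> \<in> space M" "x \<in> {0..1}" for k \<omega> x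
    using that by (intro \<Phi>1 funpow_space T_range)
  have e1: "\<bar>e k \<omega>\<bar> \<le> 1" if "\<omega> \<in> space M" for k \<omega>
    unfolding e_def by (rule kernel_integral_bound[OF \<mu>_measurable that \<Phi>T[OF that]]) auto
  have l1: "\<bar>l k \<omega>\<bar> \<le> 1" if "\<omega> \<in> space M" for k \<omega>
    unfolding l_def by (rule kernel_integral_bound[OF lebesgue_kernel that \<Phi>T[OF that]]) auto
  have "(\<lambda>k. LINT \<omega>|M. e k \<omega> - l k \<omega>) \<longlonglongrightarrow> (LINT \<omega>|M. 0)"
  proof (rule integral_dominated_convergence[where w="\<lambda>_. 2"])
    show "AE \<omega> in M. (\<lambda>k. e k \<omega> - l k \<omega>) \<longlonglongrightarrow> 0"
    proof (intro AE_I2)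
      fix \<omega> assume \<omega>: "\<omega> \<in> space M"
      have ac: "absolutely_continuous unit_leb (\<mu> \<omega>)"
        using acim \<omega> by (simp add: random_acim_def)
      show "(\<lambda>k. e k \<omega> - l k \<omega>) \<longlonglongrightarrow> 0"
        unfolding e_def l_def base_orbit_def
        by (rule absolutely_continuous_loss_of_memory[OF \<alpha> rate(1) summable_LIMSEQ_zero[OF rate(2)]
              \<kappa>_funpow[OF \<omega>] pair_section[OF \<Phi> funpow_space[OF \<omega>]] \<Phi>1[OF funpow_space[OF \<omega>]]
              \<mu>_prob(1,2)[OF \<omega>] ac])
    qed
    show "AE \<omega> in M. norm (e k \<omega> - l k \<omega>) \<le> 2" for k
    proof (intro AE_I2)
      fix \<omega> assume "\<omega> \<in> space M"
      then show "norm (e k \<omega> - l k \<omega>) \<le> 2" using e1[of \<omega> k] l1[of \<omega> k] by simp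
    qed
  qed auto
  then have "(\<lambda>k. (LINT \<omega>|M. e k \<omega>) - ?l k) \<longlonglongrightarrow> 0"
    using bounded_integrable[OF em e1] bounded_integrable[OF lm l1] by simp
  moreover have "(LINT \<omega>|M. e k \<omega>) = ?E" for k
    unfolding e_def by (rule invariance[OF \<Phi>])
  ultimately have "(\<lambda>k. ?E - ?l (k + N)) \<longlonglongrightarrow> 0"
    by (intro LIMSEQ_ignore_initial_segment) simp
  \<comment> \<open>The reverse triangle inequality bounds this expression by the distance between
    \<open>?E\<close> and \<open>?l (k + N)\<close>, while the inner sum collapses to
    \<open>?E - ?l N\<close>.\<close>
  then have lim: "(\<lambda>k. \<bar>?E - ?l (k + N)
        + (?l (k + N) - ?l N)\<bar> - \<bar>?l (k + N) - ?l N\<bar>) \<longlonglongrightarrow> 0"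
    by (rule Lim_null_comparison[rotated, OF tendsto_rabs_zero]) (auto intro!: always_eventually)
  \<comment> \<open>Both integrals observe the fibre over
    \<open>(\<sigma> ^^ (k + N)) \<omega>\<close>; Lebesgue measure is started at time
    \<open>0\<close> in one and at time \<open>k\<close> in the other. Shifting \<open>l N\<close>
    by \<open>k\<close> does not change its integral over \<open>M\<close>.\<close>
  have shift: "\<bar>?l (k + N) - ?l N\<bar> \<le> 4 * D N" for k
  proof -
    have "?l (k + N) - ?l N = ?l (k + N) - (LINT \<omega>|M. l N ((\<sigma> ^^ k) \<omega>))"
      by (simp add: funpow_integral)
    also have "\<dots> = (LINT \<omega>|M. l (k + N) \<omega> - l N ((\<sigma> ^^ k) \<omega>))"
      using bounded_integrable[OF lm l1] measurable_compose[OF funpow_measurable lm]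
        bounded_integrable[of "\<lambda>\<omega>. l N ((\<sigma> ^^ k) \<omega>)" 1] l1[OF funpow_space]
      by (intro Bochner_Integration.integral_diff[symmetric]) auto
    also have "\<bar>\<dots>\<bar> \<le> 4 * D N"
    proof (rule bounded_integral)
      show "(\<lambda>\<omega>. l (k + N) \<omega> - l N ((\<sigma> ^^ k) \<omega>)) \<in> borel_measurable M"
        using measurable_compose[OF funpow_measurable lm] by (intro borel_measurable_diff lm)
      fix \<omega> assume \<omega>: "\<omega> \<in> space M"
      have "l N ((\<sigma> ^^ k) \<omega>) = (LINT x|unit_leb. \<Phi> ((\<sigma> ^^ (k + N)) \<omega>) (orbit (\<lambda>i. \<kappa> ((\<sigma> ^^ (k + i)) \<omega>)) N x))"
        unfolding base_orbit_shift by (simp add: l_def funpow_shift)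
      moreover have "l (k + N) \<omega> = (LINT x|unit_leb. \<Phi> ((\<sigma> ^^ (k + N)) \<omega>) (orbit (\<lambda>i. \<kappa> ((\<sigma> ^^ i) \<omega>)) (k + N) x))"
        by (simp add: l_def base_orbit_def)
      ultimately show "\<bar>l (k + N) \<omega> - l N ((\<sigma> ^^ k) \<omega>)\<bar> \<le> 4 * D N"
        using lebesgue_loss_of_memory[OF \<alpha> rate(1) \<kappa>_funpow[OF \<omega>] pair_section[OF \<Phi> funpow_space[OF \<omega>]] \<Phi>1[OF funpow_space[OF \<omega>]]]
        by simp
    qed
    finally show ?thesis .
  qed
  have "\<bar>?E - ?l N\<bar> - 4 * D N
     \<le> \<bar>?E - ?l (k + N)
        + (?l (k + N) - ?l N)\<bar> - \<bar>?l (k + N) - ?l N\<bar>" for k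
    using shift[of k] by simp
  then have "\<bar>?E - ?l N\<bar> - 4 * D N \<le> 0"
    by (intro LIMSEQ_le_const[OF lim]) auto
  then show ?thesis by (simp add: l_def)
qed

lemma acim_approximation_scaled:
  fixes \<Phi> :: "'a \<Rightarrow> real \<Rightarrow> real"
  assumes \<Phi>: "(\<lambda>(\<omega>, x). \<Phi> \<omega> x) \<in> borel_measurable (M \<Otimes>\<^sub>M unit_borel)"
    and \<Phi>C: "\<And>\<omega> x. \<omega> \<in> space M \<Longrightarrow> x \<in> {0..1} \<Longrightarrow> \<bar>\<Phi> \<omega> x\<bar> \<le> C" and C: "0 < C"
  shows "\<bar>(LINT \<omega>|M. (LINT x|\<mu> \<omega>. \<Phi> \<omega> x)) - (LINT \<omega>|M. (LINT x|unit_leb. \<Phi> ((\<sigma> ^^ N) \<omega>) (T N \<omega> x)))\<bar> \<le> C * (4 * D N)"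
proof -
  have "(\<lambda>(\<omega>, x). \<Phi> \<omega> x / C) \<in> borel_measurable (M \<Otimes>\<^sub>M unit_borel)"
    using borel_measurable_divide[OF \<Phi> borel_measurable_const[of C]] by (simp add: case_prod_beta')
  moreover have "\<bar>\<Phi> \<omega> x / C\<bar> \<le> 1" if "\<omega> \<in> space M" "x \<in> {0..1}" for \<omega> x
    using \<Phi>C[OF that] C by (simp add: abs_divide divide_le_eq)
  ultimately have "\<bar>(LINT \<omega>|M. (LINT x|\<mu> \<omega>. \<Phi> \<omega> x / C)) - (LINT \<omega>|M. (LINT x|unit_leb. \<Phi> ((\<sigma> ^^ N) \<omega>) (T N \<omega> x) / C))\<bar> \<le> 4 * D N"
    by (rule acim_approximation)
  then have "\<bar>((LINT \<omega>|M. (LINT x|\<mu> \<omega>. \<Phi> \<omega> x)) - (LINT \<omega>|M. (LINT x|unit_leb. \<Phi> ((\<sigma> ^^ N) \<omega>) (T N \<omega> x)))) / C\<bar> \<le> 4 * D N"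
    by (simp add: integral_divide_zero diff_divide_distrib)
  then show ?thesis using C by (simp add: abs_divide divide_le_eq mult.commute)
qed

end

section \<open>Correlations and their Lebesgue counterparts\<close>

definition observed :: "('a \<Rightarrow> 'a) \<Rightarrow> ('a \<Rightarrow> real) \<Rightarrow> ('a \<Rightarrow> real \<Rightarrow> real) \<Rightarrow> nat \<Rightarrow> 'a \<Rightarrow> real \<Rightarrow> real" where
  "observed \<sigma> \<kappa> F n \<omega> x = F ((\<sigma> ^^ n) \<omega>) (base_orbit \<sigma> \<kappa> n \<omega> x)"

definition lebesgue_mean :: "('a \<Rightarrow> 'a) \<Rightarrow> ('a \<Rightarrow> real) \<Rightarrow> ('a \<Rightarrow> real \<Rightarrow> real) \<Rightarrow> nat \<Rightarrow> 'a \<Rightarrow> real" where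
  "lebesgue_mean \<sigma> \<kappa> F n \<omega> = (LINT x|unit_leb. observed \<sigma> \<kappa> F n \<omega> x)"

text \<open>Free of the invariant measures: in the application it depends on
  \<open>\<epsilon>\<close> only through the parameters \<open>\<kappa>\<close>.\<close>

definition lebesgue_covariance ::
    "'a measure \<Rightarrow> ('a \<Rightarrow> 'a) \<Rightarrow> ('a \<Rightarrow> real) \<Rightarrow> ('a \<Rightarrow> real \<Rightarrow> real) \<Rightarrow> nat \<Rightarrow> nat \<Rightarrow> real" where
  "lebesgue_covariance M \<sigma> \<kappa> F N n =
     (LINT \<omega>|M. (LINT x|unit_leb. observed \<sigma> \<kappa> F N \<omega> x * observed \<sigma> \<kappa> F (N + n) \<omega> x)
        - lebesgue_mean \<sigma> \<kappa> F N \<omega> * lebesgue_mean \<sigma> \<kappa> F (N + n) \<omega>)"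

locale lsv_observable = lsv_cocycle M \<sigma> \<kappa> \<mu> \<alpha> D
  for M :: "'a measure" and \<sigma> \<kappa> \<mu> \<alpha> D +
  fixes F :: "'a \<Rightarrow> real \<Rightarrow> real" and K :: real
  assumes F_measurable: "(\<lambda>(\<omega>, x). F \<omega> x) \<in> borel_measurable (M \<Otimes>\<^sub>M unit_borel)"
    and K: "0 < K"
    and F_bound: "\<And>\<omega> x. \<omega> \<in> space M \<Longrightarrow> x \<in> {0..1} \<Longrightarrow> \<bar>F \<omega> x\<bar> \<le> K"
    and F_lipschitz: "\<And>\<omega> x y. \<omega> \<in> space M \<Longrightarrow> x \<in> {0..1} \<Longrightarrow> y \<in> {0..1} \<Longrightarrow> \<bar>F \<omega> x - F \<omega> y\<bar> \<le> K * \<bar>x - y\<bar>"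
begin

abbreviation "obs \<equiv> observed \<sigma> \<kappa> F"
abbreviation "mean \<equiv> lebesgue_mean \<sigma> \<kappa> F"
abbreviation "cov \<equiv> lebesgue_covariance M \<sigma> \<kappa> F"

definition fibre_mean :: "'a \<Rightarrow> real" where
  "fibre_mean \<omega> = (LINT x|\<mu> \<omega>. F \<omega> x)"

definition correlation :: "nat \<Rightarrow> real" where
  "correlation n = (LINT \<omega>|M. (LINT x|\<mu> \<omega>. centred F \<mu> \<omega> x * centred F \<mu> ((\<sigma> ^^ n) \<omega>) (T n \<omega> x)))"

lemma obs_measurable: "(\<lambda>(\<omega>, x). obs n \<omega> x) \<in> borel_measurable (M \<Otimes>\<^sub>M unit_borel)"
  unfolding observed_def by (rule skew_measurable[OF F_measurable])

lemma obs_bound: "\<omega> \<in> space M \<Longrightarrow> x \<in> {0..1} \<Longrightarrow> \<bar>obs n \<omega> x\<bar> \<le> K"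
  unfolding observed_def by (intro F_bound funpow_space T_range)

lemma obs_shift: "obs n ((\<sigma> ^^ m) \<omega>) (T m \<omega> x) = obs (m + n) \<omega> x"
  by (simp add: observed_def funpow_shift base_orbit_add)

lemma obs_0 [simp]: "obs 0 = F"
  by (simp add: observed_def fun_eq_iff)

lemma obs_product_measurable:
  "(\<lambda>(\<omega>, x). obs m \<omega> x * obs n \<omega> x) \<in> borel_measurable (M \<Otimes>\<^sub>M unit_borel)"
  using borel_measurable_times[OF obs_measurable[of m] obs_measurable[of n]] by (simp add: case_prod_beta')

lemma obs_product_bound: "\<omega> \<in> space M \<Longrightarrow> x \<in> {0..1} \<Longrightarrow> \<bar>obs m \<omega> x * obs n \<omega> x\<bar> \<le> K * K"
  unfolding abs_mult using K by (intro mult_mono obs_bound) auto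

lemma fibre_mean_measurable [measurable]: "fibre_mean \<in> borel_measurable M"
  unfolding fibre_mean_def using kernel_integral_measurable[OF F_measurable \<mu>_measurable] .

lemma mean_measurable [measurable]: "mean n \<in> borel_measurable M"
  unfolding lebesgue_mean_def using kernel_integral_measurable[OF obs_measurable lebesgue_kernel] .

lemma fibre_mean_bound: "\<omega> \<in> space M \<Longrightarrow> \<bar>fibre_mean \<omega>\<bar> \<le> K"
  unfolding fibre_mean_def using K by (intro kernel_integral_bound[OF \<mu>_measurable] F_bound) auto

lemma mean_bound: "\<omega> \<in> space M \<Longrightarrow> \<bar>mean n \<omega>\<bar> \<le> K"
  unfolding lebesgue_mean_def using K by (intro kernel_integral_bound[OF lebesgue_kernel] obs_bound) auto

lemma kernel_integrable:
  fixes f :: "real \<Rightarrow> real"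
  assumes L: "L \<in> M \<rightarrow>\<^sub>M prob_algebra unit_borel" and \<omega>: "\<omega> \<in> space M"
    and f: "f \<in> borel_measurable unit_borel" "\<And>x. x \<in> {0..1} \<Longrightarrow> \<bar>f x\<bar> \<le> C"
  shows "integrable (L \<omega>) f"
proof -
  have L_prob: "prob_space (L \<omega>)"
    using measurable_space[OF L \<omega>] by (simp add: space_prob_algebra)
  have sets: "sets (L \<omega>) = sets unit_borel"
    using measurable_space[OF L \<omega>] by (simp add: space_prob_algebra)
  then have sp: "space (L \<omega>) = {0..1}"
    using sets_eq_imp_space_eq[of "L \<omega>" unit_borel] by simp
  show ?thesis
    using f sp by (intro finite_measure.integrable_const_bound[OF prob_space.finite_measure[OF L_prob], where B=C]) (auto intro!: AE_I2 simp: measurable_cong_sets[OF sets refl])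
qed

text \<open>Invertibility of the base enters here: the weight at \<open>\<omega>\<close> has to be read as a function of
  \<open>(\<sigma> ^^ N) \<omega>\<close>.\<close>

lemma mean_approximation:
  assumes w [measurable]: "w \<in> borel_measurable M" and w1: "\<And>\<omega>. \<omega> \<in> space M \<Longrightarrow> \<bar>w \<omega>\<bar> \<le> K"
  shows "\<bar>LINT \<omega>|M. w \<omega> * (fibre_mean ((\<sigma> ^^ N) \<omega>) - mean N \<omega>)\<bar> \<le> K * K * (4 * D N)"
proof -
  obtain \<tau> where \<tau> [measurable]: "\<tau> \<in> M \<rightarrow>\<^sub>M M" and \<tau>\<sigma>: "\<And>\<omega>. \<omega> \<in> space M \<Longrightarrow> \<tau> ((\<sigma> ^^ N) \<omega>) = \<omega>"
    using inverse_funpow[of N] by blast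
  define \<Phi> where "\<Phi> = (\<lambda>\<omega> x. w (\<tau> \<omega>) * F \<omega> x)"
  have \<Phi>m: "(\<lambda>(\<omega>, x). \<Phi> \<omega> x) \<in> borel_measurable (M \<Otimes>\<^sub>M unit_borel)"
  proof -
    have "(\<lambda>p. w (\<tau> (fst p)) * (\<lambda>(\<omega>, x). F \<omega> x) p) \<in> borel_measurable (M \<Otimes>\<^sub>M unit_borel)"
      by (intro borel_measurable_times F_measurable) measurable
    then show ?thesis by (simp add: \<Phi>_def case_prod_beta')
  qed
  have "\<bar>\<Phi> \<omega> x\<bar> \<le> K * K" if "\<omega> \<in> space M" "x \<in> {0..1}" for \<omega> x
    unfolding \<Phi>_def abs_mult using K that measurable_space[OF \<tau>] by (intro mult_mono w1 F_bound) auto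
  from acim_approximation_scaled[OF \<Phi>m this, of N]
  have "\<bar>(LINT \<omega>|M. (LINT x|\<mu> \<omega>. \<Phi> \<omega> x)) - (LINT \<omega>|M. (LINT x|unit_leb. \<Phi> ((\<sigma> ^^ N) \<omega>) (T N \<omega> x)))\<bar> \<le> K * K * (4 * D N)"
    using K by simp
  moreover have "(LINT \<omega>|M. (LINT x|\<mu> \<omega>. \<Phi> \<omega> x)) = (LINT \<omega>|M. w \<omega> * fibre_mean ((\<sigma> ^^ N) \<omega>))"
  proof -
    have "(LINT \<omega>|M. (LINT x|\<mu> \<omega>. \<Phi> \<omega> x)) = (LINT \<omega>|M. w (\<tau> \<omega>) * fibre_mean \<omega>)"
      by (simp add: \<Phi>_def fibre_mean_def)
    also have "\<dots> = (LINT \<omega>|M. w (\<tau> ((\<sigma> ^^ N) \<omega>)) * fibre_mean ((\<sigma> ^^ N) \<omega>))"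
      by (rule funpow_integral[symmetric]) measurable
    also have "\<dots> = (LINT \<omega>|M. w \<omega> * fibre_mean ((\<sigma> ^^ N) \<omega>))"
      by (intro Bochner_Integration.integral_cong) (auto simp: \<tau>\<sigma>)
    finally show ?thesis .
  qed
  moreover have "(LINT \<omega>|M. (LINT x|unit_leb. \<Phi> ((\<sigma> ^^ N) \<omega>) (T N \<omega> x))) = (LINT \<omega>|M. w \<omega> * mean N \<omega>)"
    by (intro Bochner_Integration.integral_cong) (auto simp: \<tau>\<sigma> \<Phi>_def lebesgue_mean_def observed_def)
  moreover have "(LINT \<omega>|M. w \<omega> * (fibre_mean ((\<sigma> ^^ N) \<omega>) - mean N \<omega>))
      = (LINT \<omega>|M. w \<omega> * fibre_mean ((\<sigma> ^^ N) \<omega>)) - (LINT \<omega>|M. w \<omega> * mean N \<omega>)"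
  proof -
    have "integrable M (\<lambda>\<omega>. w \<omega> * fibre_mean ((\<sigma> ^^ N) \<omega>))"
      using K by (intro bounded_integrable[of _ "K * K"])
        (auto simp: abs_mult intro!: mult_mono w1 fibre_mean_bound funpow_space)
    moreover have "integrable M (\<lambda>\<omega>. w \<omega> * mean N \<omega>)"
      using K by (intro bounded_integrable[of _ "K * K"])
        (auto simp: abs_mult intro!: mult_mono w1 mean_bound)
    ultimately show ?thesis by (simp add: right_diff_distrib)
  qed
  ultimately show ?thesis by simp
qed

lemma correlation_eq:
  "correlation n = (LINT \<omega>|M. (LINT x|\<mu> \<omega>. obs 0 \<omega> x * obs n \<omega> x)) - (LINT \<omega>|M. fibre_mean \<omega> * fibre_mean ((\<sigma> ^^ n) \<omega>))"
proof -
  let ?C = "\<lambda>\<omega>. (LINT x|\<mu> \<omega>. obs 0 \<omega> x * obs n \<omega> x) - fibre_mean \<omega> * fibre_mean ((\<sigma> ^^ n) \<omega>)"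
  have pm: "(\<lambda>\<omega>. LINT x|\<mu> \<omega>. obs 0 \<omega> x * obs n \<omega> x) \<in> borel_measurable M"
    by (rule kernel_integral_measurable[OF obs_product_measurable \<mu>_measurable])
  have mm: "(\<lambda>\<omega>. fibre_mean \<omega> * fibre_mean ((\<sigma> ^^ n) \<omega>)) \<in> borel_measurable M" by measurable
  have "correlation n = (LINT \<omega>|M. ?C \<omega>)"
    unfolding correlation_def
  proof (rule integral_cong_AE)
    let ?g = "\<lambda>\<omega> x. (F \<omega> x - fibre_mean \<omega>) * (obs n \<omega> x - fibre_mean ((\<sigma> ^^ n) \<omega>))"
    have c: "(LINT x|\<mu> \<omega>. centred F \<mu> \<omega> x * centred F \<mu> ((\<sigma> ^^ n) \<omega>) (T n \<omega> x)) = (LINT x|\<mu> \<omega>. ?g \<omega> x)"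
      if "\<omega> \<in> space M" for \<omega>
      using \<mu>_prob(3)[OF that] T_range[OF that]
      by (intro Bochner_Integration.integral_cong) (auto simp: centred_def observed_def fibre_mean_def)
    have gm: "(\<lambda>(\<omega>, x). ?g \<omega> x) \<in> borel_measurable (M \<Otimes>\<^sub>M unit_borel)"
    proof -
      have "(\<lambda>p. ((\<lambda>(\<omega>, x). F \<omega> x) p - fibre_mean (fst p)) * ((\<lambda>(\<omega>, x). obs n \<omega> x) p - fibre_mean ((\<sigma> ^^ n) (fst p))))
        \<in> borel_measurable (M \<Otimes>\<^sub>M unit_borel)"
        by (intro borel_measurable_times borel_measurable_diff F_measurable obs_measurable) measurable
      then show ?thesis by (simp add: case_prod_beta')
    qed
    show "(\<lambda>\<omega>. LINT x|\<mu> \<omega>. centred F \<mu> \<omega> x * centred F \<mu> ((\<sigma> ^^ n) \<omega>) (T n \<omega> x)) \<in> borel_measurable M"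
      using kernel_integral_measurable[OF gm \<mu>_measurable] by (subst measurable_cong[OF c])
    show "?C \<in> borel_measurable M" by (intro borel_measurable_diff pm mm)
    show "AE \<omega> in M. (LINT x|\<mu> \<omega>. centred F \<mu> \<omega> x * centred F \<mu> ((\<sigma> ^^ n) \<omega>) (T n \<omega> x)) = ?C \<omega>"
      using \<mu>_equivariant[of n] AE_space
    proof eventually_elim
      case (elim \<omega>)
      note \<omega> = elim(2)
      have one: "measure (\<mu> \<omega>) (space (\<mu> \<omega>)) = 1"
        by (rule prob_space.prob_space[OF \<mu>_prob(1)[OF \<omega>]])
      have const: "integrable (\<mu> \<omega>) (\<lambda>_. c)" for c :: real
        by (rule finite_measure.integrable_const[OF prob_space.finite_measure[OF \<mu>_prob(1)[OF \<omega>]]])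
      note [measurable_cong] = \<mu>_prob(2)[OF \<omega>]
      have [measurable]: "T n \<omega> \<in> \<mu> \<omega> \<rightarrow>\<^sub>M unit_borel" using \<omega> by measurable
      have [measurable]: "F ((\<sigma> ^^ n) \<omega>) \<in> borel_measurable unit_borel"
        using pair_section[OF F_measurable funpow_space[OF \<omega>]] .
      have pn: "(LINT x|\<mu> \<omega>. obs n \<omega> x) = fibre_mean ((\<sigma> ^^ n) \<omega>)"
        unfolding fibre_mean_def elim(1)[symmetric] observed_def by (subst integral_distr) auto
      have i: "integrable (\<mu> \<omega>) (obs k \<omega>)" for k
        by (rule kernel_integrable[OF \<mu>_measurable \<omega> pair_section[OF obs_measurable \<omega>]]) (rule obs_bound[OF \<omega>])
      have ii: "integrable (\<mu> \<omega>) (\<lambda>x. obs 0 \<omega> x * obs n \<omega> x)"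
        by (rule kernel_integrable[OF \<mu>_measurable \<omega> pair_section[OF obs_product_measurable \<omega>]]) (rule obs_product_bound[OF \<omega>])
      have "(LINT x|\<mu> \<omega>. ?g \<omega> x) = (LINT x|\<mu> \<omega>. obs 0 \<omega> x * obs n \<omega> x - fibre_mean ((\<sigma> ^^ n) \<omega>) * obs 0 \<omega> x
          - fibre_mean \<omega> * obs n \<omega> x + fibre_mean \<omega> * fibre_mean ((\<sigma> ^^ n) \<omega>))"
        by (intro Bochner_Integration.integral_cong) (auto simp: algebra_simps)
      also have "\<dots> = (LINT x|\<mu> \<omega>. obs 0 \<omega> x * obs n \<omega> x) - fibre_mean ((\<sigma> ^^ n) \<omega>) * (LINT x|\<mu> \<omega>. obs 0 \<omega> x)
          - fibre_mean \<omega> * (LINT x|\<mu> \<omega>. obs n \<omega> x) + fibre_mean \<omega> * fibre_mean ((\<sigma> ^^ n) \<omega>)"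
        using i ii one const by (simp del: obs_0)
      also have "(LINT x|\<mu> \<omega>. obs 0 \<omega> x) = fibre_mean \<omega>" by (simp add: fibre_mean_def)
      finally show ?case unfolding c[OF \<omega>] pn by simp
    qed
  qed
  also have "\<dots> = (LINT \<omega>|M. (LINT x|\<mu> \<omega>. obs 0 \<omega> x * obs n \<omega> x)) - (LINT \<omega>|M. fibre_mean \<omega> * fibre_mean ((\<sigma> ^^ n) \<omega>))"
  proof (rule Bochner_Integration.integral_diff)
    show "integrable M (\<lambda>\<omega>. LINT x|\<mu> \<omega>. obs 0 \<omega> x * obs n \<omega> x)"
      using K by (intro bounded_integrable[OF pm, of "K * K"] kernel_integral_bound[OF \<mu>_measurable] obs_product_bound) auto
    show "integrable M (\<lambda>\<omega>. fibre_mean \<omega> * fibre_mean ((\<sigma> ^^ n) \<omega>))"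
      using K by (intro bounded_integrable[OF mm, of "K * K"])
        (auto simp: abs_mult intro!: mult_mono fibre_mean_bound funpow_space)
  qed
  finally show ?thesis .
qed

text \<open>The product of the observables costs \<open>4 * D N\<close>. Fibre means are exchanged
  for Lebesgue means through \<open>a * b - a' * b' = a * (b - b') + b' * (a - a')\<close>, where
  each term is an average over the base with a bounded weight, as in
  \<open>mean_approximation\<close>; these two exchanges cost \<open>4 * D (N + n)\<close> and
  \<open>4 * D N\<close>.\<close>

lemma correlation_approximation:
  "\<bar>correlation n - cov N n\<bar> \<le> K * K * (8 * D N + 4 * D (N + n))"
proof -
  let ?I = "\<lambda>k \<omega>. fibre_mean ((\<sigma> ^^ k) \<omega>)" and ?J = mean
  have Im [measurable]: "?I k \<in> borel_measurable M" for k by measurable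
  have Ib: "\<bar>?I k \<omega>\<bar> \<le> K" if "\<omega> \<in> space M" for k \<omega> by (intro fibre_mean_bound funpow_space that)
  have int: "integrable M (\<lambda>\<omega>. f \<omega> * g \<omega>)"
    if "f \<in> borel_measurable M" "g \<in> borel_measurable M"
      "\<And>\<omega>. \<omega> \<in> space M \<Longrightarrow> \<bar>f \<omega>\<bar> \<le> A" "\<And>\<omega>. \<omega> \<in> space M \<Longrightarrow> \<bar>g \<omega>\<bar> \<le> B" "0 \<le> A" for f g :: "'a \<Rightarrow> real" and A B
    using that by (intro bounded_integrable[of _ "A * B"]) (auto simp: abs_mult intro!: mult_mono)
  have IJ: "\<bar>?I k \<omega> - ?J k \<omega>\<bar> \<le> 2 * K" if "\<omega> \<in> space M" for k \<omega>
    using Ib[OF that, of k] mean_bound[OF that, of k] by linarith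
  define P where "P = (\<lambda>\<omega>. LINT x|unit_leb. obs N \<omega> x * obs (N + n) \<omega> x)"
  have Pm: "P \<in> borel_measurable M"
    unfolding P_def by (rule kernel_integral_measurable[OF obs_product_measurable lebesgue_kernel])
  have Pi: "integrable M P"
    using K unfolding P_def
    by (intro bounded_integrable[OF Pm[unfolded P_def], of "K * K"] kernel_integral_bound[OF lebesgue_kernel] obs_product_bound) auto
  have 1: "\<bar>(LINT \<omega>|M. (LINT x|\<mu> \<omega>. obs 0 \<omega> x * obs n \<omega> x)) - (LINT \<omega>|M. P \<omega>)\<bar> \<le> K * K * (4 * D N)"
    using acim_approximation_scaled[OF obs_product_measurable obs_product_bound, of "0" "n" N] K
    unfolding obs_shift P_def by simp
  have "(LINT \<omega>|M. fibre_mean \<omega> * fibre_mean ((\<sigma> ^^ n) \<omega>)) = (LINT \<omega>|M. ?I N \<omega> * fibre_mean ((\<sigma> ^^ n) ((\<sigma> ^^ N) \<omega>)))"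
    by (rule funpow_integral[symmetric]) measurable
  also have "\<dots> = (LINT \<omega>|M. ?I N \<omega> * ?I (N + n) \<omega>)"
    by (simp add: funpow_shift)
  finally have 2: "(LINT \<omega>|M. fibre_mean \<omega> * fibre_mean ((\<sigma> ^^ n) \<omega>)) = (LINT \<omega>|M. ?I N \<omega> * ?I (N + n) \<omega>)" .
  have "(LINT \<omega>|M. ?I N \<omega> * ?I (N + n) \<omega>) - (LINT \<omega>|M. ?J N \<omega> * ?J (N + n) \<omega>)
    = (LINT \<omega>|M. ?I N \<omega> * ?I (N + n) \<omega> - ?J N \<omega> * ?J (N + n) \<omega>)"
    using K by (intro Bochner_Integration.integral_diff[symmetric] int[of _ _ K K] Ib mean_bound) auto
  also have "\<dots> = (LINT \<omega>|M. ?I N \<omega> * (?I (N + n) \<omega> - ?J (N + n) \<omega>) + ?J (N + n) \<omega> * (?I N \<omega> - ?J N \<omega>))"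
    by (intro Bochner_Integration.integral_cong) (auto simp: algebra_simps)
  also have "\<dots> = (LINT \<omega>|M. ?I N \<omega> * (?I (N + n) \<omega> - ?J (N + n) \<omega>)) + (LINT \<omega>|M. ?J (N + n) \<omega> * (?I N \<omega> - ?J N \<omega>))"
    using K by (intro Bochner_Integration.integral_add int[of _ _ K "2 * K"] Ib mean_bound IJ) auto
  finally have 3: "\<bar>(LINT \<omega>|M. ?I N \<omega> * ?I (N + n) \<omega>) - (LINT \<omega>|M. ?J N \<omega> * ?J (N + n) \<omega>)\<bar>
     \<le> K * K * (4 * D (N + n)) + K * K * (4 * D N)"
    using mean_approximation[of "?I N" "N + n", OF Im Ib] mean_approximation[of "?J (N + n)" N, OF mean_measurable mean_bound]
    by linarith
  have "cov N n = (LINT \<omega>|M. P \<omega> - ?J N \<omega> * ?J (N + n) \<omega>)"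
    by (simp add: lebesgue_covariance_def P_def)
  also have "\<dots> = (LINT \<omega>|M. P \<omega>) - (LINT \<omega>|M. ?J N \<omega> * ?J (N + n) \<omega>)"
    using K by (intro Bochner_Integration.integral_diff Pi int[of _ _ K K] mean_bound) auto
  finally show ?thesis
    using 1 3 unfolding correlation_eq 2 by (simp add: algebra_simps)
qed

text \<open>\<open>covariance_decay\<close> on every fibre, with the later observable divided by
  \<open>K\<close> to meet the bound \<open>1\<close>. Uniformity in \<open>N\<close> is what
  \<open>correlation_bound\<close> relies on.\<close>

lemma lebesgue_covariance_bound: "\<bar>cov N n\<bar> \<le> K * K * (20 * D n)"
  unfolding lebesgue_covariance_def
proof (rule bounded_integral)
  have "(\<lambda>\<omega>. LINT x|unit_leb. obs N \<omega> x * obs (N + n) \<omega> x) \<in> borel_measurable M"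
    by (rule kernel_integral_measurable[OF obs_product_measurable lebesgue_kernel])
  then show "(\<lambda>\<omega>. (LINT x|unit_leb. obs N \<omega> x * obs (N + n) \<omega> x) - mean N \<omega> * mean (N + n) \<omega>)
      \<in> borel_measurable M" by measurable
  fix \<omega> assume \<omega>: "\<omega> \<in> space M"
  have "(\<lambda>x. F ((\<sigma> ^^ (N + n)) \<omega>) x / K) \<in> borel_measurable unit_borel"
    by (intro borel_measurable_divide pair_section[OF F_measurable] funpow_space \<omega>) auto
  moreover have "\<bar>F ((\<sigma> ^^ (N + n)) \<omega>) x / K\<bar> \<le> 1" if "x \<in> {0..1}" for x
    using F_bound[OF funpow_space[OF \<omega>] that] K by (simp add: abs_divide divide_le_eq)
  ultimately have "\<bar>(LINT x|unit_leb. obs N \<omega> x * (obs (N + n) \<omega> x / K))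
      - (LINT x|unit_leb. obs N \<omega> x) * (LINT x|unit_leb. obs (N + n) \<omega> x / K)\<bar> \<le> (20 * K) * D n"
    unfolding observed_def base_orbit_def
    by (intro covariance_decay[OF \<alpha> rate(1)] \<kappa>_funpow pair_section[OF F_measurable] funpow_space \<omega> K F_bound F_lipschitz) auto
  then have "\<bar>((LINT x|unit_leb. obs N \<omega> x * obs (N + n) \<omega> x) - mean N \<omega> * mean (N + n) \<omega>) / K\<bar> \<le> (20 * K) * D n"
    by (simp add: lebesgue_mean_def diff_divide_distrib)
  then show "\<bar>(LINT x|unit_leb. obs N \<omega> x * obs (N + n) \<omega> x) - mean N \<omega> * mean (N + n) \<omega>\<bar> \<le> K * K * (20 * D n)"
    using K by (simp add: abs_divide divide_le_eq mult_ac)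
qed

text \<open>As \<open>N\<close> grows the approximation error vanishes, while the covariance bound
  stays the same.\<close>

lemma correlation_bound: "\<bar>correlation n\<bar> \<le> K * K * (20 * D n)"
proof -
  have D0: "D \<longlonglongrightarrow> 0" by (rule summable_LIMSEQ_zero[OF rate(2)])
  have "(\<lambda>N. K * K * (8 * D N + 4 * D (N + n)) + K * K * (20 * D n)) \<longlonglongrightarrow> K * K * (8 * 0 + 4 * 0) + K * K * (20 * D n)"
    by (intro tendsto_intros D0 LIMSEQ_ignore_initial_segment)
  moreover have "\<bar>correlation n\<bar> \<le> K * K * (8 * D N + 4 * D (N + n)) + K * K * (20 * D n)" for N
    using correlation_approximation[of n N] lebesgue_covariance_bound[of N n] by linarith
  ultimately show ?thesis
    by (intro LIMSEQ_le_const[where X="\<lambda>N. K * K * (8 * D N + 4 * D (N + n)) + K * K * (20 * D n)"]) auto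
qed

lemma asymptotic_variance_eq:
  "asymptotic_variance M \<sigma> (\<lambda>\<omega>. lsv (\<kappa> \<omega>)) \<mu> F = correlation 0 + 2 * (\<Sum>n. correlation (Suc n))"
  by (simp add: asymptotic_variance_def correlation_def cocycle_eq_base_orbit power2_eq_square)

end

section \<open>Continuity\<close>

lemma lsv_tendsto:
  assumes k: "(k \<longlongrightarrow> k0) G" and y: "(y \<longlongrightarrow> y0) G" and y0: "0 < y0" "y0 \<noteq> 1/2"
  shows "((\<lambda>j. lsv (k j) (y j)) \<longlongrightarrow> lsv k0 y0) G"
proof (cases "y0 < 1/2")
  case True
  have "((\<lambda>j. y j * (1 + 2 powr k j * y j powr k j)) \<longlongrightarrow> y0 * (1 + 2 powr k0 * y0 powr k0)) G"
    using y0 by (intro tendsto_intros k y) auto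
  moreover have "\<forall>\<^sub>F j in G. y j * (1 + 2 powr k j * y j powr k j) = lsv (k j) (y j)"
    using order_tendstoD(2)[OF y True] by eventually_elim (simp add: lsv_def)
  ultimately show ?thesis
    using True by (auto simp: lsv_def intro: Lim_transform_eventually)
next
  case False
  then have gt: "1/2 < y0" using y0 by simp
  have "((\<lambda>j. 2 * y j - 1) \<longlongrightarrow> 2 * y0 - 1) G"
    by (intro tendsto_intros y)
  moreover have "\<forall>\<^sub>F j in G. 2 * y j - 1 = lsv (k j) (y j)"
    using order_tendstoD(1)[OF y gt] by eventually_elim (simp add: lsv_def)
  ultimately show ?thesis
    using gt by (auto simp: lsv_def intro: Lim_transform_eventually)
qed

lemma orbit_tendsto:
  assumes k: "\<And>i. ((\<lambda>j. k j i) \<longlongrightarrow> k0 i) G"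
    and y: "\<And>i. orbit k0 i x \<in> {0..1} - {0, 1/2}"
  shows "((\<lambda>j. orbit (k j) n x) \<longlongrightarrow> orbit k0 n x) G"
proof (induction n)
  case (Suc n)
  then show ?case using y[of n] by (auto intro!: lsv_tendsto k)
qed simp

text \<open>The image of Lebesgue measure at each time has a density, so the two exceptional points
  carry no mass; there are only countably many times.\<close>

lemma AE_orbit_avoids:
  assumes \<alpha>: "\<alpha> < 1/2" and k: "\<And>i. k i \<in> {0<..\<alpha>}"
  shows "AE x in unit_leb. \<forall>i. orbit k i x \<in> {0..1} - {0, 1/2}"
proof -
  interpret U: prob_space unit_leb by (rule prob_space_unit_leb)
  have "AE x in unit_leb. orbit k i x \<in> {0..1} - {0, 1/2}" for i
  proof -
    have k': "k i \<in> {0<..1/2}" for i using k[of i] \<alpha> by auto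
    have [measurable]: "orbit k i \<in> borel_measurable unit_leb"
      by (intro measurable_restrict_space1) simp
    have "(LINT x|unit_leb. indicator {0, 1/2} (orbit k i x)) = (LBINT x. transfers k i (indicator {0<..1}) x * indicator {0, 1/2} x)"
      using k by (intro orbit_unit_integral[OF \<alpha>]) auto
    also have "\<dots> = (\<integral>x. 0 \<partial>(lborel :: real measure))"
    proof (rule integral_cong_AE)
      have "decr_density (transfers k i (indicator {0<..1}))"
        using k' coneD(1)[OF one_cone[of 0]] by (intro transfers_decreasing) auto
      from decr_density_measurable[OF this]
      show "(\<lambda>x. transfers k i (indicator {0<..1}) x * indicator {0, 1/2} x) \<in> borel_measurable lborel" by simp
      show "AE x in lborel. transfers k i (indicator {0<..1}) x * indicator {0, 1/2} x = 0"
        using AE_lborel_singleton[of 0] AE_lborel_singleton[of "1/2"] by eventually_elim simp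
    qed simp
    finally have "(LINT x|unit_leb. indicator {0, 1/2} (orbit k i x)) = (0::real)" by simp
    moreover have "integrable unit_leb (\<lambda>x. indicator {0, 1/2} (orbit k i x) :: real)"
      by (intro U.integrable_const_bound[of _ 1]) (auto intro!: AE_I2 split: split_indicator)
    ultimately have "AE x in unit_leb. indicator {0, 1/2} (orbit k i x) = (0::real)"
      by (subst (asm) integral_nonneg_eq_0_iff_AE) auto
    then show ?thesis
      using AE_space
    proof eventually_elim
      case (elim x)
      then show ?case using orbit_range[of k x i] k by (auto split: split_indicator_asm)
    qed
  qed
  then show ?thesis by (simp add: AE_all_countable)
qed

text \<open>Dominated convergence twice, on the fibre and then over the base. It is the orbit for
  the limiting parameters \<open>\<kappa>0\<close> that has to avoid the exceptional points.\<close>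

lemma (in ergodic_automorphism) lebesgue_covariance_tendsto:
  fixes \<kappa> :: "nat \<Rightarrow> 'a \<Rightarrow> real" and F :: "'a \<Rightarrow> real \<Rightarrow> real"
  assumes \<alpha>: "0 < \<alpha>" "\<alpha> < 1/2"
    and \<kappa>m: "\<And>j. \<kappa> j \<in> borel_measurable M" "\<kappa>0 \<in> borel_measurable M"
    and \<kappa>: "\<And>j \<omega>. \<omega> \<in> space M \<Longrightarrow> \<kappa> j \<omega> \<in> {0<..\<alpha>}" "\<And>\<omega>. \<omega> \<in> space M \<Longrightarrow> \<kappa>0 \<omega> \<in> {0<..\<alpha>}"
    and lim: "\<And>\<omega>. \<omega> \<in> space M \<Longrightarrow> (\<lambda>j. \<kappa> j \<omega>) \<longlonglongrightarrow> \<kappa>0 \<omega>"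
    and F: "(\<lambda>(\<omega>, x). F \<omega> x) \<in> borel_measurable (M \<Otimes>\<^sub>M unit_borel)"
    and FK: "\<And>\<omega> x. \<omega> \<in> space M \<Longrightarrow> x \<in> {0..1} \<Longrightarrow> \<bar>F \<omega> x\<bar> \<le> K" and K: "0 < K"
    and Fc: "\<And>\<omega>. \<omega> \<in> space M \<Longrightarrow> continuous_on {0..1} (F \<omega>)"
  shows "(\<lambda>j. lebesgue_covariance M \<sigma> (\<kappa> j) F N n) \<longlonglongrightarrow> lebesgue_covariance M \<sigma> \<kappa>0 F N n"
proof -
  interpret U: prob_space unit_leb by (rule prob_space_unit_leb)
  let ?O = "\<lambda>j. observed \<sigma> (\<kappa> j) F" and ?Z = "observed \<sigma> \<kappa>0 F" and ?U = unit_leb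
  have om: "(\<lambda>(\<omega>, x). observed \<sigma> k F i \<omega> x) \<in> borel_measurable (M \<Otimes>\<^sub>M unit_borel)"
    if "k \<in> borel_measurable M" "\<And>\<omega>. \<omega> \<in> space M \<Longrightarrow> k \<omega> \<in> {0<..\<alpha>}" for k i
  proof -
    have "(\<lambda>(\<omega>, x). base_orbit \<sigma> k i \<omega> x) \<in> M \<Otimes>\<^sub>M unit_borel \<rightarrow>\<^sub>M unit_borel"
      using that by (intro base_orbit_measurable_unit) auto
    then have [measurable]: "(\<lambda>p. base_orbit \<sigma> k i (fst p) (snd p)) \<in> M \<Otimes>\<^sub>M unit_borel \<rightarrow>\<^sub>M unit_borel"
      by (simp add: case_prod_beta')
    have "(\<lambda>p. (\<lambda>(\<omega>, x). F \<omega> x) ((\<sigma> ^^ i) (fst p), base_orbit \<sigma> k i (fst p) (snd p))) \<in> borel_measurable (M \<Otimes>\<^sub>M unit_borel)"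
      by (intro measurable_compose[OF _ F]) measurable
    then show ?thesis by (simp add: observed_def case_prod_beta')
  qed
  have ob: "\<bar>observed \<sigma> k F i \<omega> x\<bar> \<le> K"
    if "\<And>\<omega>. \<omega> \<in> space M \<Longrightarrow> k \<omega> \<in> {0<..\<alpha>}" "\<omega> \<in> space M" "x \<in> {0..1}" for k i \<omega> x
    unfolding observed_def using that funpow_space[of \<omega>]
    by (intro FK funpow_space) (auto simp: base_orbit_def intro!: orbit_range[unfolded atLeastAtMost_iff])
  have os: "observed \<sigma> k F i \<omega> \<in> borel_measurable unit_leb"
    if "k \<in> borel_measurable M" "\<And>\<omega>. \<omega> \<in> space M \<Longrightarrow> k \<omega> \<in> {0<..\<alpha>}" "\<omega> \<in> space M" for k i \<omega>
    using measurable_compose[OF measurable_Pair1'[OF that(3)] om[OF that(1,2)], of i]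
    by (simp add: measurable_cong_sets[OF sets_unit_leb refl])
  have oc: "AE x in ?U. \<forall>i. (\<lambda>j. ?O j i \<omega> x) \<longlonglongrightarrow> ?Z i \<omega> x"
    if \<omega>: "\<omega> \<in> space M" for \<omega>
  proof -
    have k0: "\<kappa>0 ((\<sigma> ^^ i) \<omega>) \<in> {0<..\<alpha>}" for i by (intro \<kappa> funpow_space \<omega>)
    show ?thesis
      using AE_orbit_avoids[of \<alpha> "\<lambda>i. \<kappa>0 ((\<sigma> ^^ i) \<omega>)", OF \<alpha>(2) k0] AE_space
    proof eventually_elim
      case (elim x)
      have 1: "(\<lambda>j. base_orbit \<sigma> (\<kappa> j) i \<omega> x) \<longlonglongrightarrow> base_orbit \<sigma> \<kappa>0 i \<omega> x" for i
        unfolding base_orbit_def using elim(1) by (intro orbit_tendsto lim funpow_space \<omega>) auto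
      have 2: "base_orbit \<sigma> \<kappa>0 i \<omega> x \<in> {0..1}" for i
        using elim(1) by (simp add: base_orbit_def)
      have 3: "base_orbit \<sigma> (\<kappa> j) i \<omega> x \<in> {0..1}" for i j
        using \<kappa>(1) \<omega> elim(2) by (intro base_orbit_range) auto
      have "(\<lambda>j. ?O j i \<omega> x) \<longlonglongrightarrow> ?Z i \<omega> x" for i
        unfolding observed_def
        by (rule continuous_on_tendsto_compose[OF Fc[OF funpow_space[OF \<omega>]] 1 2 always_eventually[OF allI[OF 3]]])
      then show ?case by blast
    qed
  qed
  have mean_lim: "(\<lambda>j. lebesgue_mean \<sigma> (\<kappa> j) F i \<omega>) \<longlonglongrightarrow> lebesgue_mean \<sigma> \<kappa>0 F i \<omega>" if \<omega>: "\<omega> \<in> space M" for i \<omega>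
    unfolding lebesgue_mean_def
  proof (rule integral_dominated_convergence[where w="\<lambda>_. K"])
    show "AE x in ?U. (\<lambda>j. ?O j i \<omega> x) \<longlonglongrightarrow> ?Z i \<omega> x"
      using oc[OF \<omega>] by eventually_elim blast
    show "AE x in ?U. norm (?O j i \<omega> x) \<le> K" for j
      using ob[OF \<kappa>(1) \<omega>] by (intro AE_I2) auto
  qed (auto intro!: os \<kappa>m \<kappa> \<omega> simp del: greaterThanAtMost_iff)
  have prod_lim: "(\<lambda>j. LINT x|?U. ?O j N \<omega> x * ?O j (N + n) \<omega> x)
      \<longlonglongrightarrow> (LINT x|?U. ?Z N \<omega> x * ?Z (N + n) \<omega> x)" if \<omega>: "\<omega> \<in> space M" for \<omega>
  proof (rule integral_dominated_convergence[where w="\<lambda>_. K * K"])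
    show "AE x in ?U. (\<lambda>j. ?O j N \<omega> x * ?O j (N + n) \<omega> x)
        \<longlonglongrightarrow> ?Z N \<omega> x * ?Z (N + n) \<omega> x"
      using oc[OF \<omega>] by eventually_elim (intro tendsto_mult, blast, blast)
    show "AE x in ?U. norm (?O j N \<omega> x * ?O j (N + n) \<omega> x) \<le> K * K" for j
    proof (intro AE_I2)
      fix x assume "x \<in> space unit_leb"
      then show "norm (?O j N \<omega> x * ?O j (N + n) \<omega> x) \<le> K * K"
        using ob[OF \<kappa>(1) \<omega>] K by (simp add: abs_mult mult_mono)
    qed
  qed (auto intro!: borel_measurable_times os \<kappa>m \<kappa> \<omega> simp del: greaterThanAtMost_iff)
  let ?f = "\<lambda>k \<omega>. (LINT x|?U. observed \<sigma> k F N \<omega> x * observed \<sigma> k F (N + n) \<omega> x)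
        - lebesgue_mean \<sigma> k F N \<omega> * lebesgue_mean \<sigma> k F (N + n) \<omega>"
  have fm: "?f k \<in> borel_measurable M"
    if "k \<in> borel_measurable M" "\<And>\<omega>. \<omega> \<in> space M \<Longrightarrow> k \<omega> \<in> {0<..\<alpha>}" for k
  proof -
    have "(\<lambda>(\<omega>, x). observed \<sigma> k F N \<omega> x * observed \<sigma> k F (N + n) \<omega> x) \<in> borel_measurable (M \<Otimes>\<^sub>M unit_borel)"
      using borel_measurable_times[OF om[OF that] om[OF that]] by (simp add: case_prod_beta')
    from kernel_integral_measurable[OF this lebesgue_kernel] show ?thesis
      unfolding lebesgue_mean_def
      by (intro borel_measurable_diff borel_measurable_times kernel_integral_measurable[OF om[OF that] lebesgue_kernel])
  qed
  have mean_b: "\<bar>lebesgue_mean \<sigma> k F i \<omega>\<bar> \<le> K"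
    if "\<And>\<omega>. \<omega> \<in> space M \<Longrightarrow> k \<omega> \<in> {0<..\<alpha>}" "\<omega> \<in> space M" for k i \<omega>
    unfolding lebesgue_mean_def
    by (rule kernel_integral_bound[OF lebesgue_kernel that(2)]) (use ob[OF that] K in auto)
  have fb: "\<bar>?f (\<kappa> j) \<omega>\<bar> \<le> 2 * (K * K)" if \<omega>: "\<omega> \<in> space M" for j \<omega>
  proof -
    have "\<bar>LINT x|?U. ?O j N \<omega> x * ?O j (N + n) \<omega> x\<bar> \<le> K * K"
      using ob[OF \<kappa>(1) \<omega>] K
      by (intro kernel_integral_bound[OF lebesgue_kernel \<omega>]) (auto simp: abs_mult intro!: mult_mono)
    moreover have "\<bar>lebesgue_mean \<sigma> (\<kappa> j) F N \<omega> * lebesgue_mean \<sigma> (\<kappa> j) F (N + n) \<omega>\<bar> \<le> K * K"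
      unfolding abs_mult using mean_b[OF \<kappa>(1) \<omega>] K by (intro mult_mono) auto
    ultimately show ?thesis by linarith
  qed
  show ?thesis
    unfolding lebesgue_covariance_def
  proof (rule integral_dominated_convergence[where w="\<lambda>_. 2 * (K * K)"])
    show "AE \<omega> in M. (\<lambda>j. ?f (\<kappa> j) \<omega>) \<longlonglongrightarrow> ?f \<kappa>0 \<omega>"
      by (intro AE_I2 tendsto_diff tendsto_mult mean_lim prod_lim)
    show "AE \<omega> in M. norm (?f (\<kappa> j) \<omega>) \<le> 2 * (K * K)" for j
      using fb by (intro AE_I2) simp
  qed (auto intro!: fm \<kappa>m \<kappa> simp del: greaterThanAtMost_iff)
qed

lemma suminf_continuous_uniform:
  fixes c :: "nat \<Rightarrow> nat \<Rightarrow> real"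
  assumes B: "summable B" "\<And>j n. \<bar>c j n\<bar> \<le> B n" and lim: "\<And>n. (\<lambda>j. c j n) \<longlonglongrightarrow> c0 n"
  shows "(\<lambda>j. \<Sum>n. c j n) \<longlonglongrightarrow> (\<Sum>n. c0 n)"
proof -
  have "\<forall>\<^sub>F (n, j) in at_top \<times>\<^sub>F sequentially. norm (c j n) \<le> B n"
    using B(2) by (intro always_eventually) auto
  from tannerys_theorem[OF lim this B(1)] show ?thesis by simp
qed

text \<open>One rate \<open>D\<close>, determined by \<open>\<alpha>\<close>, serves all
  \<open>j\<close>. Hence \<open>N\<close> can be fixed before \<open>j\<close>: each correlation is
  within a uniformly small error of a covariance that converges, and a multiple of \<open>D\<close>
  dominates the series.\<close>

lemma (in ergodic_automorphism) asymptotic_variance_tendsto: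
  fixes \<kappa> :: "nat \<Rightarrow> 'a \<Rightarrow> real" and F :: "'a \<Rightarrow> real \<Rightarrow> real"
  assumes \<alpha>: "0 < \<alpha>" "\<alpha> < 1/2"
    and \<kappa>m: "\<And>j. \<kappa> j \<in> borel_measurable M" "\<kappa>0 \<in> borel_measurable M"
    and \<kappa>: "\<And>j \<omega>. \<omega> \<in> space M \<Longrightarrow> \<kappa> j \<omega> \<in> {0<..\<alpha>}" "\<And>\<omega>. \<omega> \<in> space M \<Longrightarrow> \<kappa>0 \<omega> \<in> {0<..\<alpha>}"
    and lim: "\<And>\<omega>. \<omega> \<in> space M \<Longrightarrow> (\<lambda>j. \<kappa> j \<omega>) \<longlonglongrightarrow> \<kappa>0 \<omega>"
    and acim: "\<And>j. random_acim M \<sigma> (\<lambda>\<omega>. lsv (\<kappa> j \<omega>)) (\<mu> j)" "random_acim M \<sigma> (\<lambda>\<omega>. lsv (\<kappa>0 \<omega>)) \<mu>0"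
    and F: "(\<lambda>(\<omega>, x). F \<omega> x) \<in> borel_measurable (M \<Otimes>\<^sub>M unit_borel)"
    and K: "0 < K" and FK: "\<And>\<omega> x. \<omega> \<in> space M \<Longrightarrow> x \<in> {0..1} \<Longrightarrow> \<bar>F \<omega> x\<bar> \<le> K"
    and Fl: "\<And>\<omega> x y. \<omega> \<in> space M \<Longrightarrow> x \<in> {0..1} \<Longrightarrow> y \<in> {0..1} \<Longrightarrow> \<bar>F \<omega> x - F \<omega> y\<bar> \<le> K * \<bar>x - y\<bar>"
  shows "(\<lambda>j. asymptotic_variance M \<sigma> (\<lambda>\<omega>. lsv (\<kappa> j \<omega>)) (\<mu> j) F)
     \<longlonglongrightarrow> asymptotic_variance M \<sigma> (\<lambda>\<omega>. lsv (\<kappa>0 \<omega>)) \<mu>0 F"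
proof -
  obtain D where D: "summable D" "memory_rate \<alpha> D"
    using summable_memory_rate[OF \<alpha>] by blast
  have obs: "lsv_observable M \<sigma> (\<kappa> j) (\<mu> j) \<alpha> D F K" for j
    using ergodic_automorphism_axioms \<alpha> D \<kappa>m \<kappa> acim F K FK Fl
    by (simp add: lsv_observable_def lsv_observable_axioms_def lsv_cocycle_def lsv_cocycle_axioms_def)
  have obs0: "lsv_observable M \<sigma> \<kappa>0 \<mu>0 \<alpha> D F K"
    using ergodic_automorphism_axioms \<alpha> D \<kappa>m \<kappa> acim F K FK Fl
    by (simp add: lsv_observable_def lsv_observable_axioms_def lsv_cocycle_def lsv_cocycle_axioms_def)
  define c0 where "c0 = lsv_observable.correlation M \<sigma> \<kappa>0 \<mu>0 F"
  define c where "c = (\<lambda>j. lsv_observable.correlation M \<sigma> (\<kappa> j) (\<mu> j) F)"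
  have Fc: "continuous_on {0..1} (F \<omega>)" if "\<omega> \<in> space M" for \<omega>
  proof (rule lipschitz_on_continuous_on[of K])
    show "K-lipschitz_on {0..1} (F \<omega>)"
      using Fl[OF that] K by (intro lipschitz_onI) (auto simp: dist_real_def)
  qed
  have D0: "D \<longlonglongrightarrow> 0" by (rule summable_LIMSEQ_zero[OF D(1)])
  have c_lim: "(\<lambda>j. c j n) \<longlonglongrightarrow> c0 n" for n
  proof (rule LIMSEQ_I)
    fix e :: real assume e: "0 < e"
    have "(\<lambda>N. K * K * (8 * D N + 4 * D (N + n))) \<longlonglongrightarrow> K * K * (8 * 0 + 4 * 0)"
      by (intro tendsto_intros D0 LIMSEQ_ignore_initial_segment)
    then have "\<forall>\<^sub>F N in sequentially. K * K * (8 * D N + 4 * D (N + n)) < e / 3"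
      using e by (intro order_tendstoD(2)) auto
    then obtain N where N: "K * K * (8 * D N + 4 * D (N + n)) < e / 3"
      unfolding eventually_sequentially by blast
    have "(\<lambda>j. lebesgue_covariance M \<sigma> (\<kappa> j) F N n) \<longlonglongrightarrow> lebesgue_covariance M \<sigma> \<kappa>0 F N n"
      by (rule lebesgue_covariance_tendsto[OF \<alpha> \<kappa>m \<kappa> lim F FK K Fc])
    then obtain j0 where j0: "\<And>j. j \<ge> j0 \<Longrightarrow> norm (lebesgue_covariance M \<sigma> (\<kappa> j) F N n - lebesgue_covariance M \<sigma> \<kappa>0 F N n) < e / 3"
      using LIMSEQ_D[of _ _ "e / 3"] e by (metis divide_pos_pos zero_less_numeral)
    have "norm (c j n - c0 n) < e" if "j \<ge> j0" for j
      using j0[OF that] N lsv_observable.correlation_approximation[OF obs0, of n N]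
        lsv_observable.correlation_approximation[OF obs, of j n N]
      unfolding c_def c0_def real_norm_def by linarith
    then show "\<exists>j0. \<forall>j\<ge>j0. norm (c j n - c0 n) < e" by blast
  qed
  have "(\<lambda>j. \<Sum>n. c j (Suc n)) \<longlonglongrightarrow> (\<Sum>n. c0 (Suc n))"
  proof (rule suminf_continuous_uniform)
    have "summable (\<lambda>n. D (Suc n))" using D(1) by (simp add: summable_Suc_iff)
    then show "summable (\<lambda>n. K * K * (20 * D (Suc n)))" by (intro summable_mult)
    show "\<bar>c j (Suc n)\<bar> \<le> K * K * (20 * D (Suc n))" for j n
      unfolding c_def by (rule lsv_observable.correlation_bound[OF obs])
  qed (rule c_lim)
  then have "(\<lambda>j. c j 0 + 2 * (\<Sum>n. c j (Suc n))) \<longlonglongrightarrow> c0 0 + 2 * (\<Sum>n. c0 (Suc n))"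
    by (intro tendsto_intros c_lim)
  then show ?thesis
    by (simp add: lsv_observable.asymptotic_variance_eq[OF obs0] c0_def lsv_observable.asymptotic_variance_eq[OF obs] c_def)
qed

section \<open>From almost sure to sure hypotheses\<close>

lemma centred_measurable:
  assumes F: "(\<lambda>(\<omega>, x). F \<omega> x) \<in> borel_measurable (M \<Otimes>\<^sub>M unit_borel)"
    and \<mu>: "\<mu> \<in> M \<rightarrow>\<^sub>M prob_algebra unit_borel"
  shows "(\<lambda>(\<omega>, x). centred F \<mu> \<omega> x) \<in> borel_measurable (M \<Otimes>\<^sub>M borel)"
proof -
  \<comment> \<open>\<open>F\<close> is known to be measurable on the unit interval only, so its
    argument is clamped to it; the indicator removes the spurious values.\<close>
  let ?f = "\<lambda>p. indicator {0..1} (snd p) * ((\<lambda>(\<omega>, x). F \<omega> x) (fst p, max 0 (min 1 (snd p))) - (LINT y|\<mu> (fst p). F (fst p) y))"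
  have [measurable]: "(\<lambda>x::real. max 0 (min 1 x)) \<in> borel \<rightarrow>\<^sub>M unit_borel"
    by (rule measurable_restrict_space2) auto
  have [measurable]: "(\<lambda>\<omega>. LINT y|\<mu> \<omega>. F \<omega> y) \<in> borel_measurable M"
    by (rule kernel_integral_measurable[OF F \<mu>])
  have [measurable]: "(\<lambda>p. (\<lambda>(\<omega>, x). F \<omega> x) (fst p, max 0 (min 1 (snd p)))) \<in> borel_measurable (M \<Otimes>\<^sub>M borel)"
    by (intro measurable_compose[OF _ F]) measurable
  have "?f
      \<in> borel_measurable (M \<Otimes>\<^sub>M borel)"
    by measurable
  also have "?f
      = (\<lambda>(\<omega>, x). centred F \<mu> \<omega> x)"
    by (auto simp: fun_eq_iff centred_def split: split_indicator)
  finally show ?thesis .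
qed

lemma (in ergodic_automorphism) correlation_integrand_measurable:
  assumes F: "(\<lambda>(\<omega>, x). F \<omega> x) \<in> borel_measurable (M \<Otimes>\<^sub>M unit_borel)"
    and \<mu>: "\<mu> \<in> M \<rightarrow>\<^sub>M prob_algebra unit_borel" and \<kappa>: "\<kappa> \<in> borel_measurable M"
  shows "(\<lambda>\<omega>. LINT x|\<mu> \<omega>. centred F \<mu> \<omega> x * centred F \<mu> ((\<sigma> ^^ n) \<omega>) (base_orbit \<sigma> \<kappa> n \<omega> x)) \<in> borel_measurable M"
proof (rule kernel_integral_measurable[OF _ \<mu>])
  have [measurable]: "(\<lambda>x. x) \<in> unit_borel \<rightarrow>\<^sub>M borel" by (rule measurable_restrict_space1) simp
  have 1: "(\<lambda>p. (\<lambda>(\<omega>, x). centred F \<mu> \<omega> x) (fst p, (\<lambda>x. x) (snd p))) \<in> borel_measurable (M \<Otimes>\<^sub>M unit_borel)"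
    by (rule measurable_compose[OF _ centred_measurable[OF F \<mu>]]) measurable
  have [measurable]: "(\<lambda>p. (\<lambda>(\<omega>, x). base_orbit \<sigma> \<kappa> n \<omega> x) (fst p, (\<lambda>x. x) (snd p))) \<in> borel_measurable (M \<Otimes>\<^sub>M unit_borel)"
    by (rule measurable_compose[OF _ base_orbit_measurable_real[OF \<kappa>]]) measurable
  have 2: "(\<lambda>p. (\<lambda>(\<omega>, x). centred F \<mu> \<omega> x) ((\<sigma> ^^ n) (fst p), (\<lambda>(\<omega>, x). base_orbit \<sigma> \<kappa> n \<omega> x) (fst p, (\<lambda>x. x) (snd p))))
      \<in> borel_measurable (M \<Otimes>\<^sub>M unit_borel)"
    by (rule measurable_compose[OF _ centred_measurable[OF F \<mu>]]) measurable
  show "(\<lambda>(\<omega>, x). centred F \<mu> \<omega> x * centred F \<mu> ((\<sigma> ^^ n) \<omega>) (base_orbit \<sigma> \<kappa> n \<omega> x)) \<in> borel_measurable (M \<Otimes>\<^sub>M unit_borel)"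
    using borel_measurable_times[OF 1 2] by (simp add: case_prod_beta')
qed

text \<open>Almost every \<open>\<omega>\<close> has its whole orbit outside the exceptional set.
  \<open>integral_cong_AE\<close> asks for measurable integrands on both sides, so also for the
  unmodified parameters; \<open>correlation_integrand_measurable\<close> provides this.\<close>

lemma (in ergodic_automorphism) asymptotic_variance_cong_AE:
  assumes F: "(\<lambda>(\<omega>, x). F \<omega> x) \<in> borel_measurable (M \<Otimes>\<^sub>M unit_borel)"
    and F': "(\<lambda>(\<omega>, x). F' \<omega> x) \<in> borel_measurable (M \<Otimes>\<^sub>M unit_borel)"
    and \<mu>: "\<mu> \<in> M \<rightarrow>\<^sub>M prob_algebra unit_borel"
    and \<kappa>: "\<kappa> \<in> borel_measurable M" "\<kappa>' \<in> borel_measurable M"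
    and eq: "AE \<omega> in M. \<kappa> \<omega> = \<kappa>' \<omega>" "AE \<omega> in M. \<forall>x\<in>{0..1}. F \<omega> x = F' \<omega> x"
  shows "asymptotic_variance M \<sigma> (\<lambda>\<omega>. lsv (\<kappa> \<omega>)) \<mu> F = asymptotic_variance M \<sigma> (\<lambda>\<omega>. lsv (\<kappa>' \<omega>)) \<mu> F'"
proof -
  have all: "AE \<omega> in M. \<forall>n. \<kappa> ((\<sigma> ^^ n) \<omega>) = \<kappa>' ((\<sigma> ^^ n) \<omega>) \<and> (\<forall>x\<in>{0..1}. F ((\<sigma> ^^ n) \<omega>) x = F' ((\<sigma> ^^ n) \<omega>) x)"
    using AE_funpow[OF eq(1)] AE_funpow[OF eq(2)] by (simp add: AE_all_countable)
  have "(LINT \<omega>|M. (LINT x|\<mu> \<omega>. centred F \<mu> \<omega> x * centred F \<mu> ((\<sigma> ^^ n) \<omega>) (base_orbit \<sigma> \<kappa> n \<omega> x)))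
      = (LINT \<omega>|M. (LINT x|\<mu> \<omega>. centred F' \<mu> \<omega> x * centred F' \<mu> ((\<sigma> ^^ n) \<omega>) (base_orbit \<sigma> \<kappa>' n \<omega> x)))" for n
  proof (rule integral_cong_AE)
    show "AE \<omega> in M. (LINT x|\<mu> \<omega>. centred F \<mu> \<omega> x * centred F \<mu> ((\<sigma> ^^ n) \<omega>) (base_orbit \<sigma> \<kappa> n \<omega> x))
      = (LINT x|\<mu> \<omega>. centred F' \<mu> \<omega> x * centred F' \<mu> ((\<sigma> ^^ n) \<omega>) (base_orbit \<sigma> \<kappa>' n \<omega> x))"
      using all AE_space
    proof eventually_elim
      case (elim \<omega>)
      have c: "centred F \<mu> ((\<sigma> ^^ k) \<omega>) = centred F' \<mu> ((\<sigma> ^^ k) \<omega>)" for k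
      proof -
        have "\<mu> ((\<sigma> ^^ k) \<omega>) \<in> space (prob_algebra unit_borel)"
          by (rule measurable_space[OF \<mu> funpow_space[OF elim(2)]])
        then have "sets (\<mu> ((\<sigma> ^^ k) \<omega>)) = sets unit_borel"
          by (simp add: space_prob_algebra)
        then have "space (\<mu> ((\<sigma> ^^ k) \<omega>)) = {0..1}"
          using sets_eq_imp_space_eq[of "\<mu> ((\<sigma> ^^ k) \<omega>)" unit_borel] by simp
        then have "(LINT y|\<mu> ((\<sigma> ^^ k) \<omega>). F ((\<sigma> ^^ k) \<omega>) y) = (LINT y|\<mu> ((\<sigma> ^^ k) \<omega>). F' ((\<sigma> ^^ k) \<omega>) y)"
          using elim(1) by (intro Bochner_Integration.integral_cong) auto
        then show ?thesis
          using elim(1) by (auto simp: fun_eq_iff centred_def)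
      qed
      have "base_orbit \<sigma> \<kappa> n \<omega> = base_orbit \<sigma> \<kappa>' n \<omega>"
        using elim(1) by (simp add: base_orbit_def)
      then show ?case using c[of n] c[of 0] by simp
    qed
  qed (intro correlation_integrand_measurable F F' \<mu> \<kappa>)+
  from this[of 0] this[of "Suc _"] show ?thesis
    by (simp add: asymptotic_variance_def cocycle_eq_base_orbit power2_eq_square)
qed

lemma C1_norm_bounds:
  assumes "C1_unit g"
  shows "x \<in> {0..1} \<Longrightarrow> \<bar>g x\<bar> \<le> C1_norm g"
    and "x \<in> {0..1} \<Longrightarrow> y \<in> {0..1} \<Longrightarrow> \<bar>g x - g y\<bar> \<le> C1_norm g * \<bar>x - y\<bar>"
proof -
  obtain g' where g': "\<And>x. x \<in> {0..1} \<Longrightarrow> (g has_real_derivative g' x) (at x within {0..1})" "continuous_on {0..1} g'"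
    using assms unfolding C1_unit_def by blast
  have vd: "vector_derivative g (at x within {0..1}) = g' x" if "x \<in> {0..1}" for x
    using g'(1)[OF that] that
    by (intro vector_derivative_within_closed_interval) (auto simp: has_real_derivative_iff_has_vector_derivative)
  have gc: "continuous_on {0..1} g"
    using g'(1) by (intro DERIV_continuous_on) auto
  have sup: "\<bar>h x\<bar> \<le> (SUP x\<in>{0..1}. \<bar>h x\<bar>)" if h: "continuous_on {0..1} h" and x: "x \<in> {0..1}" for h :: "real \<Rightarrow> real" and x
  proof (rule cSUP_upper[OF x])
    have "compact ((\<lambda>x. \<bar>h x\<bar>) ` {0..1})"
      using h by (intro compact_continuous_image continuous_intros) auto
    then show "bdd_above ((\<lambda>x. \<bar>h x\<bar>) ` {0..1})"
      by (rule bounded_imp_bdd_above[OF compact_imp_bounded])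
  qed
  have C1: "C1_norm g = (SUP x\<in>{0..1}. \<bar>g x\<bar>) + (SUP x\<in>{0..1}. \<bar>g' x\<bar>)"
    unfolding C1_norm_def by (intro arg_cong2[of _ _ _ _ "(+)"] SUP_cong refl) (simp add: vd)
  have nonneg: "0 \<le> (SUP x\<in>{0..1}. \<bar>g x\<bar>)" "0 \<le> (SUP x\<in>{0..1}. \<bar>g' x\<bar>)"
    using sup[OF gc, of 0] sup[OF g'(2), of 0] by auto
  show "\<bar>g x\<bar> \<le> C1_norm g" if "x \<in> {0..1}" for x
    using sup[OF gc that] nonneg by (simp add: C1)
  have g'b: "\<bar>g' x\<bar> \<le> C1_norm g" if "x \<in> {0..1}" for x
    using sup[OF g'(2) that] nonneg by (simp add: C1)
  show "\<bar>g x - g y\<bar> \<le> C1_norm g * \<bar>x - y\<bar>" if "x \<in> {0..1}" "y \<in> {0..1}" for x y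
    using field_differentiable_bound[of "{0..1}" g g' "C1_norm g" x y] g'(1) g'b that by auto
qed

lemma random_acim_cong_AE:
  assumes "random_acim M \<sigma> T \<mu>" "AE \<omega> in M. T \<omega> = T' \<omega>"
  shows "random_acim M \<sigma> T' \<mu>"
  using assms(1) unfolding random_acim_def
proof (intro conjI; elim conjE)
  assume "AE \<omega> in M. distr (\<mu> \<omega>) unit_borel (T \<omega>) = \<mu> (\<sigma> \<omega>)"
  with assms(2) show "AE \<omega> in M. distr (\<mu> \<omega>) unit_borel (T' \<omega>) = \<mu> (\<sigma> \<omega>)"
    by eventually_elim simp
qed

theorem theorem5:
  fixes M :: "'a measure" and \<sigma> :: "'a \<Rightarrow> 'a"
    and \<beta> \<delta> :: "'a \<Rightarrow> real" and \<epsilon>0 :: real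
    and \<mu> :: "real \<Rightarrow> 'a \<Rightarrow> real measure"
    and F :: "'a \<Rightarrow> real \<Rightarrow> real"
  assumes "ergodic_automorphism M \<sigma>"
    and "\<epsilon>0 > 0"
    and "\<beta> \<in> borel_measurable M" and "\<And>\<omega>. \<omega> \<in> space M \<Longrightarrow> \<beta> \<omega> \<in> {0<..<1}"
    and "\<delta> \<in> borel_measurable M" and "\<And>\<omega>. \<omega> \<in> space M \<Longrightarrow> \<delta> \<omega> \<in> {0<..<1}"
    and "esssup M (\<lambda>\<omega>. ereal (\<beta> \<omega>)) + ereal \<epsilon>0 < ereal (1/2)"
    and "essinf M (\<lambda>\<omega>. ereal (\<beta> \<omega>)) - ereal \<epsilon>0 > 0"
    and "\<And>\<epsilon>. \<epsilon> \<in> {-\<epsilon>0<..<\<epsilon>0} \<Longrightarrow>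
           random_acim M \<sigma> (\<lambda>\<omega>. lsv (\<beta> \<omega> + \<epsilon> * \<delta> \<omega>)) (\<mu> \<epsilon>)"
    and "(\<lambda>(\<omega>, x). F \<omega> x) \<in> borel_measurable (M \<Otimes>\<^sub>M unit_borel)"
    and "\<And>\<omega>. \<omega> \<in> space M \<Longrightarrow> C1_unit (F \<omega>)"
    and "esssup M (\<lambda>\<omega>. ereal (C1_norm (F \<omega>))) < \<infinity>"
  shows "continuous (at 0 within {-\<epsilon>0<..<\<epsilon>0})
           (\<lambda>\<epsilon>. asymptotic_variance M \<sigma> (\<lambda>\<omega>. lsv (\<beta> \<omega> + \<epsilon> * \<delta> \<omega>)) (\<mu> \<epsilon>) F)"
proof -
  note [measurable] = assms(3,5)
  note F = assms(10)
  obtain a where a: "esssup M (\<lambda>\<omega>. ereal (\<beta> \<omega>)) + ereal \<epsilon>0 < ereal a" "a < 1/2"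
    using ereal_dense2[OF assms(7)] by auto
  \<comment> \<open>The maximum with \<open>1/4\<close> secures that \<open>\<alpha>\<close> is
    positive.\<close>
  define \<alpha> where "\<alpha> = max a (1/4)"
  have \<alpha>: "0 < \<alpha>" "\<alpha> < 1/2" using a by (auto simp: \<alpha>_def)
  have upper: "AE \<omega> in M. \<beta> \<omega> + \<epsilon>0 < \<alpha>"
    using esssup_AE[of "\<lambda>\<omega>. ereal (\<beta> \<omega>)" M]
  proof eventually_elim
    case (elim \<omega>)
    have "ereal (\<beta> \<omega>) + ereal \<epsilon>0 \<le> esssup M (\<lambda>\<omega>. ereal (\<beta> \<omega>)) + ereal \<epsilon>0"
      using elim by (rule add_right_mono)
    also note a(1)
    finally show ?case by (simp add: \<alpha>_def)
  qed
  have lower: "AE \<omega> in M. \<epsilon>0 < \<beta> \<omega>"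
  proof -
    have "essinf M (\<lambda>\<omega>. ereal (\<beta> \<omega>)) = Liminf (ae_filter M) (\<lambda>\<omega>. ereal (\<beta> \<omega>))"
      by (simp add: essinf_def)
    moreover have "ereal \<epsilon>0 < essinf M (\<lambda>\<omega>. ereal (\<beta> \<omega>))"
      using assms(8) by (cases "essinf M (\<lambda>\<omega>. ereal (\<beta> \<omega>))") auto
    ultimately have "\<forall>\<^sub>F \<omega> in ae_filter M. ereal \<epsilon>0 < ereal (\<beta> \<omega>)"
      by (metis less_LiminfD)
    then show ?thesis by simp
  qed
  obtain k where k: "esssup M (\<lambda>\<omega>. ereal (C1_norm (F \<omega>))) < ereal k"
    using ereal_dense2[OF assms(12)] by auto
  define K where "K = max k 1"
  have K: "0 < K" by (simp add: K_def)
  have FK: "AE \<omega> in M. C1_norm (F \<omega>) \<le> K"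
    using esssup_AE[of "\<lambda>\<omega>. ereal (C1_norm (F \<omega>))" M]
  proof eventually_elim
    case (elim \<omega>)
    also note k
    finally show ?case by (simp add: K_def)
  qed
  \<comment> \<open>The essential supremum of a nonmeasurable function is \<open>top\<close> by
    convention, so finiteness yields measurability of the norm.\<close>
  have "(\<lambda>\<omega>. ereal (C1_norm (F \<omega>))) \<in> borel_measurable M"
    using esssup_non_measurable[of "\<lambda>\<omega>. ereal (C1_norm (F \<omega>))" M] assms(12) by (auto simp: top_ereal_def)
  then have [measurable]: "(\<lambda>\<omega>. C1_norm (F \<omega>)) \<in> borel_measurable M"
    by simp
  \<comment> \<open>On a null set, \<open>F\<close> and the parameters are replaced so that all bounds hold for every \<open>\<omega>\<close>.\<close>
  define F' where "F' = (\<lambda>\<omega> x. if C1_norm (F \<omega>) \<le> K then F \<omega> x else 0)"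
  have F': "(\<lambda>(\<omega>, x). F' \<omega> x) \<in> borel_measurable (M \<Otimes>\<^sub>M unit_borel)"
  proof -
    have "(\<lambda>p. if C1_norm (F (fst p)) \<le> K then (\<lambda>(\<omega>, x). F \<omega> x) p else 0) \<in> borel_measurable (M \<Otimes>\<^sub>M unit_borel)"
      by (intro measurable_If F) measurable
    also have "(\<lambda>p. if C1_norm (F (fst p)) \<le> K then (\<lambda>(\<omega>, x). F \<omega> x) p else 0) = (\<lambda>(\<omega>, x). F' \<omega> x)"
      by (simp add: fun_eq_iff F'_def)
    finally show ?thesis .
  qed
  have F'K: "\<bar>F' \<omega> x\<bar> \<le> K" if "\<omega> \<in> space M" "x \<in> {0..1}" for \<omega> x
  proof (cases "C1_norm (F \<omega>) \<le> K")
    case True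
    then show ?thesis
      using order_trans[OF C1_norm_bounds(1)[OF assms(11)[OF that(1)] that(2)] True] by (simp add: F'_def)
  qed (simp add: F'_def less_imp_le[OF K])
  have F'l: "\<bar>F' \<omega> x - F' \<omega> y\<bar> \<le> K * \<bar>x - y\<bar>" if "\<omega> \<in> space M" "x \<in> {0..1}" "y \<in> {0..1}" for \<omega> x y
  proof (cases "C1_norm (F \<omega>) \<le> K")
    case True
    then show ?thesis
      using order_trans[OF C1_norm_bounds(2)[OF assms(11)[OF that(1)] that(2,3)] mult_right_mono[OF True abs_ge_zero]]
      by (simp add: F'_def)
  qed (simp add: F'_def less_imp_le[OF K])
  \<comment> \<open>The exceptional set does not depend on \<open>\<epsilon>\<close>, so the
    modified parameters converge for every \<open>\<omega>\<close>; \<open>\<alpha>\<close> is a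
    default value in the admissible range.\<close>
  define \<kappa> where "\<kappa> = (\<lambda>\<epsilon> \<omega>. if \<beta> \<omega> + \<epsilon>0 < \<alpha> \<and> \<epsilon>0 < \<beta> \<omega> then \<beta> \<omega> + \<epsilon> * \<delta> \<omega> else \<alpha>)"
  have \<kappa>m [measurable]: "\<kappa> \<epsilon> \<in> borel_measurable M" for \<epsilon>
    unfolding \<kappa>_def by measurable
  have \<kappa>: "\<kappa> \<epsilon> \<omega> \<in> {0<..\<alpha>}" if "\<epsilon> \<in> {-\<epsilon>0<..<\<epsilon>0}" "\<omega> \<in> space M" for \<epsilon> \<omega>
  proof -
    have "\<bar>\<epsilon> * \<delta> \<omega>\<bar> \<le> \<bar>\<epsilon>\<bar> * 1"
      unfolding abs_mult using assms(6)[OF that(2)] by (intro mult_left_mono) auto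
    also have "\<dots> < \<epsilon>0" using that(1) by auto
    finally show ?thesis using \<alpha> by (auto simp: \<kappa>_def abs_less_iff)
  qed
  have \<kappa>_AE: "AE \<omega> in M. \<beta> \<omega> + \<epsilon> * \<delta> \<omega> = \<kappa> \<epsilon> \<omega>" for \<epsilon>
    using upper lower by eventually_elim (simp add: \<kappa>_def)
  have acim: "random_acim M \<sigma> (\<lambda>\<omega>. lsv (\<kappa> \<epsilon> \<omega>)) (\<mu> \<epsilon>)" if "\<epsilon> \<in> {-\<epsilon>0<..<\<epsilon>0}" for \<epsilon>
    by (rule random_acim_cong_AE[OF assms(9)[OF that]]) (use \<kappa>_AE[of \<epsilon>] in \<open>eventually_elim, simp\<close>)
  have F_AE: "AE \<omega> in M. \<forall>x\<in>{0..1}. F \<omega> x = F' \<omega> x"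
    using FK by eventually_elim (simp add: F'_def)
  have av: "asymptotic_variance M \<sigma> (\<lambda>\<omega>. lsv (\<beta> \<omega> + \<epsilon> * \<delta> \<omega>)) (\<mu> \<epsilon>) F
      = asymptotic_variance M \<sigma> (\<lambda>\<omega>. lsv (\<kappa> \<epsilon> \<omega>)) (\<mu> \<epsilon>) F'" if "\<epsilon> \<in> {-\<epsilon>0<..<\<epsilon>0}" for \<epsilon>
    using assms(9)[OF that] by (intro ergodic_automorphism.asymptotic_variance_cong_AE[OF assms(1)] F F' \<kappa>_AE F_AE \<kappa>m) (auto simp: random_acim_def)
  have zero: "0 \<in> {-\<epsilon>0<..<\<epsilon>0}" using assms(2) by simp
  show ?thesis
    unfolding continuous_within_sequentially
  proof (intro allI impI, elim conjE)
    fix e :: "nat \<Rightarrow> real"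
    assume e: "\<forall>n. e n \<in> {-\<epsilon>0<..<\<epsilon>0}" "e \<longlonglongrightarrow> 0"
    have e': "e n \<in> {-\<epsilon>0<..<\<epsilon>0}" for n using e(1) by blast
    have "(\<lambda>j. \<kappa> (e j) \<omega>) \<longlonglongrightarrow> \<kappa> 0 \<omega>" for \<omega>
      unfolding \<kappa>_def by (cases "\<beta> \<omega> + \<epsilon>0 < \<alpha> \<and> \<epsilon>0 < \<beta> \<omega>") (auto intro!: tendsto_eq_intros e(2))
    from ergodic_automorphism.asymptotic_variance_tendsto[OF assms(1) \<alpha> \<kappa>m \<kappa>m \<kappa>[OF e'] \<kappa>[OF zero] this acim[OF e'] acim[OF zero] F' K F'K F'l]
    show "((\<lambda>\<epsilon>. asymptotic_variance M \<sigma> (\<lambda>\<omega>. lsv (\<beta> \<omega> + \<epsilon> * \<delta> \<omega>)) (\<mu> \<epsilon>) F) \<circ> e)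
        \<longlonglongrightarrow> asymptotic_variance M \<sigma> (\<lambda>\<omega>. lsv (\<beta> \<omega> + 0 * \<delta> \<omega>)) (\<mu> 0) F"
      unfolding comp_def av[OF e'] av[OF zero] .
  qed
qed

end
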